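(* Let $\mathsf G=(\mathsf V,\mathsf E,\partial)$ be a countable graph with $\mathsf E\neq\emptyset$, and let $(e^{t\Delta})_{t\ge 0}$ be the heat semigroup on $L^2(\mathsf G)$. The following assertions are equivalent. (a) The semigroup $(e^{t\Delta})_{t\geq 0}$ is irreducible. (b) $S_{\rm fin}(\mathsf e)=\mathsf G$ for one $\mathsf e\in\mathsf E$ (that is, there exists $\mathsf e\in\mathsf E$ such that the edge set of $S_{\rm fin}(\mathsf e)$ is all of $\mathsf E$). (c) $S_{\rm fin}(\mathsf e)=\mathsf G$ for all $\mathsf e\in\mathsf E$ (that is, for every $\mathsf e\in\mathsf E$ the edge set of $S_{\rm fin}(\mathsf e)$ is all of $\mathsf E$).
   Context: Graphs. An oriented graph is a triple $\mathsf G=(\mathsf V,\mathsf E,\partial)$ with sets $\mathsf V$ (nodes) and $\mathsf E$ (edges) and a map $\partial=(\partial_1,\partial_2):\mathsf E\to\mathsf V\times\mathsf V$; the edge $\mathsf e$ starts at $\partial_1\mathsf e$ and ends at $\partial_2\mathsf e$. It is countable if $\mathsf V,\mathsf E$ are countable (finite or countably infinite). $\Gamma^+(\mathsf v)$ (resp. $\Gamma^-(\mathsf v)$) is the set of edges ending (resp. starting) at $\mathsf v$, and $\deg(\mathsf v)=|\Gamma^+(\mathsf v)|+|\Gamma^-(\mathsf v)|\in\{0,1,\dots,\infty\}$. An edge is incident to its start and end nodes. Heat semigroup. $L^2(\mathsf G):=\bigoplus_{\mathsf e\in\mathsf E}L^2(0,1)$ (Hilbert direct sum, complex-valued functions), with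 elements $\psi=(\psi_{\mathsf e})_{\mathsf e\in\mathsf E}$; it is identified with $L^2$ of the disjoint union of one copy of $[0,1]$ for each edge. Let $V$ be the set of all $\psi\in\bigoplus_{\mathsf e\in\mathsf E}H^1(0,1)$ (Hilbert direct sum) for which there is $d^\psi\in\ell^2(\mathsf V)$ with $\psi_{\mathsf e}(0)=d^\psi_{\partial_1\mathsf e}$ and $\psi_{\mathsf e}(1)=d^\psi_{\partial_2\mathsf e}$ for all $\mathsf e\in\mathsf E$. The Laplace operator $\Delta$ on $L^2(\mathsf G)$ is the operator associated with the form $a(f,g)=\sum_{\mathsf e\in\mathsf E}\int_0^1 f_{\mathsf e}'(x)\overline{g_{\mathsf e}'(x)}\,dx$ with form domain $V$: $f\in D(\Delta)$ and $\Delta f=h$ iff $f\in V$, $h\in L^2(\mathsf G)$ and $a(f,g)=-(h\mid g)_{L^2(\mathsf G)}$ for all $g\in V$. The semigroup $(e^{t\Delta})_{t\ge0}$ generated by $\Delta$ is the heat semigroup. Irreducibility. For a measurable subset $\omega$ of the disjoint union of the edge intervals, $L^2(\omega)$ is the ideal of functions in $L^2(\mathsf G)$ vanishing a.e. outside $\omega$. The semigroup is irreducible if whenever $L^2(\omega)$ is invariant (i.e. $e^{t\Delta}L^2(\omega)\subset L^2(\omega)$ for all $t\ge0$), either $\omega$ or its complement has measure zero. Finite span. A path from $\mathsf e$ to $\mathsf e'$ is a finite sequence of edges $\mathsf e=\mathsf e_0,\dots,\mathsf e_n=\mathsf e'$ ($n\ge0$) together with nodes $\mathsf v_1,\dots,\mathsf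 v_n$ such that $\mathsf v_i$ is incident to both $\mathsf e_{i-1}$ and $\mathsf e_i$ (orientation is irrelevant); it contains no infinite stars (has finite weight) if $\deg(\mathsf v_i)<\infty$ for all $i$. The finite span $S_{\rm fin}(\mathsf e)$ is the subgraph consisting of all edges $\mathsf e'$ for which there is a path of finite weight from $\mathsf e$ to $\mathsf e'$, together with their endpoints. *)

theory Defs
  imports
    "HOL-Analysis.Analysis"
    "HOL-Library.Extended_Nat"
    "Graph_Theory.Digraph"
begin

subsection \<open>The space $L^2$ of a measure space\<close>

text \<open>
  Elements of $L^2$ are handled through representatives: functions that are equal almost
  everywhere are not identified on the type level, so every notion below is stated up to
  \<open>AE\<close>-equality.
\<close>

definition l2 :: "'a measure \<Rightarrow> ('a \<Rightarrow> complex) set" where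
  "l2 M = {f. f \<in> borel_measurable M \<and> integrable M (\<lambda>z. (cmod (f z))\<^sup>2)}"

definition l2_inner :: "'a measure \<Rightarrow> ('a \<Rightarrow> complex) \<Rightarrow> ('a \<Rightarrow> complex) \<Rightarrow> complex" where
  "l2_inner M f g = (\<integral>z. f z * cnj (g z) \<partial>M)"

definition l2_norm :: "'a measure \<Rightarrow> ('a \<Rightarrow> complex) \<Rightarrow> real" where
  "l2_norm M f = sqrt (\<integral>z. (cmod (f z))\<^sup>2 \<partial>M)"

text \<open>The ideal $L^2(\omega)$ of functions vanishing almost everywhere outside $\omega$.\<close>

definition l2_ideal :: "'a measure \<Rightarrow> 'a set \<Rightarrow> ('a \<Rightarrow> complex) set" where
  "l2_ideal M \<omega> = {f \<in> l2 M. AE z in M. z \<notin> \<omega> \<longrightarrow> f z = 0}"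


subsection \<open>Strongly continuous semigroups on $L^2$\<close>

text \<open>
  The first conjunct of each of the following two definitions makes the map on representatives
  descend to a map on equivalence classes.
\<close>

definition l2_bounded_operator ::
    "'a measure \<Rightarrow> (('a \<Rightarrow> complex) \<Rightarrow> ('a \<Rightarrow> complex)) \<Rightarrow> bool" where
  "l2_bounded_operator M S \<longleftrightarrow>
     (\<forall>f\<in>l2 M. S f \<in> l2 M \<and> (\<forall>g\<in>l2 M. (AE z in M. f z = g z) \<longrightarrow> (AE z in M. S f z = S g z))) \<and>
     (\<forall>f\<in>l2 M. \<forall>g\<in>l2 M. AE z in M. S (\<lambda>w. f w + g w) z = S f z + S g z) \<and>
     (\<forall>c. \<forall>f\<in>l2 M. AE z in M. S (\<lambda>w. c * f w) z = c * S f z) \<and>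
     (\<exists>C. \<forall>f\<in>l2 M. l2_norm M (S f) \<le> C * l2_norm M f)"

definition c0_semigroup ::
    "'a measure \<Rightarrow> (real \<Rightarrow> ('a \<Rightarrow> complex) \<Rightarrow> ('a \<Rightarrow> complex)) \<Rightarrow> bool" where
  "c0_semigroup M T \<longleftrightarrow>
     (\<forall>t\<ge>0. l2_bounded_operator M (T t)) \<and>
     (\<forall>f\<in>l2 M. AE z in M. T 0 f z = f z) \<and>
     (\<forall>s\<ge>0. \<forall>t\<ge>0. \<forall>f\<in>l2 M. AE z in M. T (s + t) f z = T s (T t f) z) \<and>
     (\<forall>f\<in>l2 M. ((\<lambda>t. l2_norm M (\<lambda>z. T t f z - f z)) \<longlongrightarrow> 0) (at_right 0))"

text \<open>The generator, as a graph: \<open>f\<close> lies in its domain and is mapped to \<open>h\<close>.\<close>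

definition generator ::
    "'a measure \<Rightarrow> (real \<Rightarrow> ('a \<Rightarrow> complex) \<Rightarrow> ('a \<Rightarrow> complex)) \<Rightarrow>
     ('a \<Rightarrow> complex) \<Rightarrow> ('a \<Rightarrow> complex) \<Rightarrow> bool" where
  "generator M T f h \<longleftrightarrow> f \<in> l2 M \<and> h \<in> l2 M \<and>
     ((\<lambda>t. l2_norm M (\<lambda>z. (T t f z - f z) / complex_of_real t - h z)) \<longlongrightarrow> 0) (at_right 0)"

definition irreducible_semigroup ::
    "'a measure \<Rightarrow> (real \<Rightarrow> ('a \<Rightarrow> complex) \<Rightarrow> ('a \<Rightarrow> complex)) \<Rightarrow> bool" where
  "irreducible_semigroup M T \<longleftrightarrow>
     (\<forall>\<omega>\<in>sets M. (\<forall>t\<ge>0. T t ` l2_ideal M \<omega> \<subseteq> l2_ideal M \<omega>) \<longrightarrow>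
        emeasure M \<omega> = 0 \<or> emeasure M (space M - \<omega>) = 0)"


subsection \<open>The heat semigroup of a graph\<close>

text \<open>
  An oriented graph is a \<open>pre_digraph\<close> satisfying \<open>wf_digraph\<close>, with $\partial_1 =$ \<open>tail\<close>
  and $\partial_2 =$ \<open>head\<close>; loops and parallel edges are allowed.  The point \<open>(e, x)\<close> is the
  point \<open>x\<close> of the interval belonging to the edge \<open>e\<close>; a function $\psi$ on the disjoint union
  of the intervals corresponds to the family $\psi_e =$ \<open>\<lambda>x. \<psi> (e, x)\<close>, and
  \<open>l2 (edge_measure G)\<close> is the Hilbert direct sum of the spaces $L^2(0,1)$.
\<close>

definition edge_measure :: "('v, 'e) pre_digraph \<Rightarrow> ('e \<times> real) measure" where
  "edge_measure G = count_space (arcs G) \<Otimes>\<^sub>M lebesgue_on {0..1}"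

text \<open>Test functions of class $C^1_c(0,1)$, extended by zero to the real line.\<close>

definition test_function :: "(real \<Rightarrow> real) \<Rightarrow> bool" where
  "test_function \<phi> \<longleftrightarrow> \<phi> C1_differentiable_on UNIV \<and>
     (\<exists>a b. 0 < a \<and> b < 1 \<and> (\<forall>x. x \<notin> {a..b} \<longrightarrow> \<phi> x = 0))"

definition has_weak_derivative :: "(real \<Rightarrow> complex) \<Rightarrow> (real \<Rightarrow> complex) \<Rightarrow> bool" where
  "has_weak_derivative u u' \<longleftrightarrow>
     (\<forall>\<phi>. test_function \<phi> \<longrightarrow>
        (\<integral>x. u x * complex_of_real (deriv \<phi> x) \<partial>lebesgue_on {0..1}) =
        - (\<integral>x. u' x * complex_of_real (\<phi> x) \<partial>lebesgue_on {0..1}))"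

definition edgewise_weak_derivative ::
    "('v, 'e) pre_digraph \<Rightarrow> ('e \<times> real \<Rightarrow> complex) \<Rightarrow> ('e \<times> real \<Rightarrow> complex) \<Rightarrow> bool" where
  "edgewise_weak_derivative G f f' \<longleftrightarrow> f' \<in> l2 (edge_measure G) \<and>
     (\<forall>e\<in>arcs G. has_weak_derivative (\<lambda>x. f (e, x)) (\<lambda>x. f' (e, x)))"

text \<open>The Hilbert direct sum of the spaces $H^1(0,1)$.\<close>

definition edge_H1 :: "('v, 'e) pre_digraph \<Rightarrow> ('e \<times> real \<Rightarrow> complex) set" where
  "edge_H1 G = {f \<in> l2 (edge_measure G). \<exists>f'. edgewise_weak_derivative G f f'}"

text \<open>Unique up to \<open>AE\<close>-equality on \<open>edge_H1 G\<close>.\<close>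

definition edge_deriv ::
    "('v, 'e) pre_digraph \<Rightarrow> ('e \<times> real \<Rightarrow> complex) \<Rightarrow> ('e \<times> real \<Rightarrow> complex)" where
  "edge_deriv G f = (SOME f'. edgewise_weak_derivative G f f')"

text \<open>
  \<open>a\<close> and \<open>b\<close> are the values at \<open>0\<close> and \<open>1\<close> of the continuous representative of \<open>u\<close>.
\<close>

definition has_boundary_values :: "(real \<Rightarrow> complex) \<Rightarrow> complex \<Rightarrow> complex \<Rightarrow> bool" where
  "has_boundary_values u a b \<longleftrightarrow>
     (\<exists>w. continuous_on {0..1} w \<and> (AE x in lebesgue_on {0..1}. u x = w x) \<and> w 0 = a \<and> w 1 = b)"

definition form_domain :: "('v, 'e) pre_digraph \<Rightarrow> ('e \<times> real \<Rightarrow> complex) set" where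
  "form_domain G = {f \<in> edge_H1 G. \<exists>d. (\<lambda>v. (cmod (d v))\<^sup>2) summable_on verts G \<and>
     (\<forall>e\<in>arcs G. has_boundary_values (\<lambda>x. f (e, x)) (d (tail G e)) (d (head G e)))}"

definition energy_form ::
    "('v, 'e) pre_digraph \<Rightarrow> ('e \<times> real \<Rightarrow> complex) \<Rightarrow> ('e \<times> real \<Rightarrow> complex) \<Rightarrow> complex" where
  "energy_form G f g =
     (\<Sum>\<^sub>\<infinity>e\<in>arcs G. \<integral>x. edge_deriv G f (e, x) * cnj (edge_deriv G g (e, x)) \<partial>lebesgue_on {0..1})"

text \<open>The Laplace operator, as a graph: \<open>f\<close> lies in its domain and is mapped to \<open>h\<close>.\<close>

definition graph_laplacian ::
    "('v, 'e) pre_digraph \<Rightarrow> ('e \<times> real \<Rightarrow> complex) \<Rightarrow> ('e \<times> real \<Rightarrow> complex) \<Rightarrow> bool" where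
  "graph_laplacian G f h \<longleftrightarrow> f \<in> form_domain G \<and> h \<in> l2 (edge_measure G) \<and>
     (\<forall>g\<in>form_domain G. energy_form G f g = - l2_inner (edge_measure G) h g)"

text \<open>
  A strongly continuous semigroup is determined (up to \<open>AE\<close>-equality) by its generator, so this
  describes a single object.
\<close>

definition heat_semigroup ::
    "('v, 'e) pre_digraph \<Rightarrow> (real \<Rightarrow> ('e \<times> real \<Rightarrow> complex) \<Rightarrow> ('e \<times> real \<Rightarrow> complex)) \<Rightarrow> bool" where
  "heat_semigroup G T \<longleftrightarrow> c0_semigroup (edge_measure G) T \<and>
     (\<forall>f h. generator (edge_measure G) T f h \<longleftrightarrow> graph_laplacian G f h)"


subsection \<open>The finite span of an edge\<close>

definition ecard :: "'a set \<Rightarrow> enat" where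
  "ecard A = (if finite A then enat (card A) else \<infinity>)"

text \<open>A loop is counted twice.\<close>

definition edegree :: "('v, 'e) pre_digraph \<Rightarrow> 'v \<Rightarrow> enat" where
  "edegree G v = ecard (in_arcs G v) + ecard (out_arcs G v)"

definition incident :: "('v, 'e) pre_digraph \<Rightarrow> 'e \<Rightarrow> 'v \<Rightarrow> bool" where
  "incident G e v \<longleftrightarrow> v = tail G e \<or> v = head G e"

text \<open>
  \<open>es\<close> lists the edges $e_0, \dots, e_n$ and \<open>vs\<close> the nodes $v_1, \dots, v_n$; the node $v_{i+1}$
  is \<open>vs ! i\<close>.
\<close>

definition edge_path ::
    "('v, 'e) pre_digraph \<Rightarrow> 'e \<Rightarrow> 'e list \<Rightarrow> 'v list \<Rightarrow> 'e \<Rightarrow> bool" where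
  "edge_path G e es vs e' \<longleftrightarrow>
     length es = Suc (length vs) \<and> set es \<subseteq> arcs G \<and> set vs \<subseteq> verts G \<and>
     hd es = e \<and> last es = e' \<and>
     (\<forall>i<length vs. incident G (es ! i) (vs ! i) \<and> incident G (es ! Suc i) (vs ! i))"

definition finite_weight :: "('v, 'e) pre_digraph \<Rightarrow> 'v list \<Rightarrow> bool" where
  "finite_weight G vs \<longleftrightarrow> (\<forall>v\<in>set vs. edegree G v < \<infinity>)"

definition finite_span :: "('v, 'e) pre_digraph \<Rightarrow> 'e \<Rightarrow> ('v, 'e) pre_digraph" where
  "finite_span G e =
     (let A = {e'. \<exists>es vs. edge_path G e es vs e' \<and> finite_weight G vs}
      in \<lparr>verts = tail G ` A \<union> head G ` A, arcs = A, tail = tail G, head = head G\<rparr>)"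

end

theory Submission
  imports Defs
begin

text \<open>
  Heat does not pass through nodes of infinite degree. By the trace inequality
  (\<open>boundary_value_bound\<close>), the boundary value at a node is bounded by the \<open>H\<^sup>1\<close> norm on each incident
  edge; the squares of these norms have a finite sum, so a function in the form domain vanishes at
  every node of infinite degree. Hence, if a set \<open>B\<close> of edges can be left only through nodes of infinite
  degree, multiplication by the indicator of \<open>B\<close> preserves the form domain
  (\<open>indicator_form_domain\<close>). It commutes with differentiation, therefore with the Laplacian, and
  therefore with the semigroup. Finite spans and their complements are such sets, so a finite span
  that is not the whole graph contradicts irreducibility (\<open>irreducible_imp_finite_span\<close>).

  Conversely, let \<open>L\<^sup>2(\<omega>)\<close> be invariant. The semigroup is self-adjoint, so it commutes with the
  multiplication by the indicator of \<open>\<omega>\<close>, and this multiplication preserves the domain of the Laplacian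
  (\<open>generator_indicator_if_invariant\<close>). In particular it yields functions that are continuous on the
  edges and have one common value at each node. Applying it to smooth plateaus inside one edge shows
  that \<open>\<omega>\<close> contains almost all or almost nothing of this edge. At a node of finite degree there is a
  function in the domain that is \<open>1\<close> near the node and is supported on the finitely many incident
  edges; applying the multiplication to it shows that the same alternative holds on all these edges.
  So \<open>\<omega>\<close> is trivial along every path of finite weight (\<open>invariant_set_trivial_if_finite_span\<close>).

  The semigroup is only given through its generator, and both directions pass between the two by
  \<open>semigroup_intertwines\<close>: if \<open>\<langle>p \<Delta> f, g\<rangle> = \<langle>p f, \<Delta> g\<rangle>\<close> for a bounded multiplier \<open>p\<close>, then
  \<open>\<langle>p T(t) f, g\<rangle> = \<langle>p f, T(t) g\<rangle>\<close>; the multiplier \<open>1\<close> gives self-adjointness. This needs that \<open>T\<close> is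
  bounded on compact time intervals, which follows from the uniform boundedness principle, and that
  the domain of the Laplacian is dense. It is dense because it contains the plateaus, whose span is
  dense in \<open>L\<^sup>2\<close> (\<open>subspace_with_plateaus_dense\<close>); the same density makes weak derivatives unique.
\<close>

section \<open>The Hilbert space of square integrable functions\<close>

lemma borel_measurable_cnj [measurable (raw)]:
  "f \<in> borel_measurable M \<Longrightarrow> (\<lambda>z. cnj (f z)) \<in> borel_measurable M"
  by (rule borel_measurable_continuous_on[of cnj]) (intro continuous_intros)

lemma l2_measurable: "f \<in> l2 M \<Longrightarrow> f \<in> borel_measurable M"
  by (simp add: l2_def)

lemma l2_sq_integrable: "f \<in> l2 M \<Longrightarrow> integrable M (\<lambda>z. (cmod (f z))\<^sup>2)"
  by (simp add: l2_def)

lemma l2_norm_nonneg [simp]: "0 \<le> l2_norm M f"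
  by (simp add: l2_norm_def)

lemma l2_norm_power2: "(l2_norm M f)\<^sup>2 = (\<integral>z. (cmod (f z))\<^sup>2 \<partial>M)"
  by (simp add: l2_norm_def)

lemma l2_dominated:
  assumes "g \<in> borel_measurable M" "integrable M w" "AE z in M. (cmod (g z))\<^sup>2 \<le> w z"
  shows "g \<in> l2 M"
  unfolding l2_def
  using assms by (auto intro!: Bochner_Integration.integrable_bound[OF assms(2)])

lemma l2_zero [simp]: "(\<lambda>z. 0) \<in> l2 M"
  by (simp add: l2_def)

lemma l2_add:
  assumes "f \<in> l2 M" "g \<in> l2 M"
  shows "(\<lambda>z. f z + g z) \<in> l2 M"
proof (rule l2_dominated)
  show "integrable M (\<lambda>z. 2 * (cmod (f z))\<^sup>2 + 2 * (cmod (g z))\<^sup>2)"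
    using assms by (auto simp: l2_def)
  have "(cmod (f z + g z))\<^sup>2 \<le> 2 * (cmod (f z))\<^sup>2 + 2 * (cmod (g z))\<^sup>2" for z
  proof -
    have "(cmod (f z + g z))\<^sup>2 \<le> (cmod (f z) + cmod (g z))\<^sup>2"
      by (intro power_mono norm_triangle_ineq) auto
    also have "\<dots> \<le> 2 * (cmod (f z))\<^sup>2 + 2 * (cmod (g z))\<^sup>2"
      using sum_squares_bound[of "cmod (f z)" "cmod (g z)"] by (simp add: power2_sum)
    finally show ?thesis .
  qed
  then show "AE z in M. (cmod (f z + g z))\<^sup>2 \<le> 2 * (cmod (f z))\<^sup>2 + 2 * (cmod (g z))\<^sup>2" by simp
qed (use assms in \<open>auto simp: l2_def\<close>)

lemma l2_mult_bounded:
  assumes "f \<in> l2 M" "p \<in> borel_measurable M" "\<And>z. cmod (p z) \<le> C"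
  shows "(\<lambda>z. p z * f z) \<in> l2 M"
proof (rule l2_dominated)
  show "integrable M (\<lambda>z. C\<^sup>2 * (cmod (f z))\<^sup>2)"
    using assms by (auto simp: l2_def)
  show "AE z in M. (cmod (p z * f z))\<^sup>2 \<le> C\<^sup>2 * (cmod (f z))\<^sup>2"
    using assms(3) by (auto simp: norm_mult power_mult_distrib intro!: mult_right_mono power_mono)
qed (use assms in \<open>auto simp: l2_def\<close>)

lemma l2_scale: "f \<in> l2 M \<Longrightarrow> (\<lambda>z. c * f z) \<in> l2 M"
  by (rule l2_mult_bounded[where C="cmod c"]) auto

lemma l2_divide: "f \<in> l2 M \<Longrightarrow> (\<lambda>z. f z / c) \<in> l2 M"
  using l2_scale[of f M "inverse c"] by (simp add: field_simps)

lemma l2_diff: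
  assumes "f \<in> l2 M" "g \<in> l2 M"
  shows "(\<lambda>z. f z - g z) \<in> l2 M"
  using l2_add[OF assms(1) l2_scale[OF assms(2), of "-1"]] by simp

lemma l2_norm_AE_cong:
  assumes "f \<in> borel_measurable M" "g \<in> borel_measurable M" "AE z in M. f z = g z"
  shows "l2_norm M f = l2_norm M g"
  unfolding l2_norm_def using assms by (intro arg_cong[where f=sqrt] integral_cong_AE) auto

lemma l2_norm_scale: "l2_norm M (\<lambda>z. c * f z) = cmod c * l2_norm M f"
  by (simp add: l2_norm_def norm_mult power_mult_distrib real_sqrt_mult)

lemma l2_norm_minus_commute: "l2_norm M (\<lambda>z. f z - g z) = l2_norm M (\<lambda>z. g z - f z)"
  by (simp add: l2_norm_def norm_minus_commute)

lemma l2_norm_mono: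
  assumes "f \<in> borel_measurable M" "g \<in> l2 M" "AE z in M. cmod (f z) \<le> C * cmod (g z)" "0 \<le> C"
  shows "l2_norm M f \<le> C * l2_norm M g"
proof -
  have *: "AE z in M. (cmod (f z))\<^sup>2 \<le> C\<^sup>2 * (cmod (g z))\<^sup>2"
    using assms(3) by (auto simp: power_mult_distrib[symmetric] intro!: power_mono)
  have "f \<in> l2 M"
    by (rule l2_dominated[OF assms(1) _ *]) (use assms in \<open>auto simp: l2_def\<close>)
  then have "(\<integral>z. (cmod (f z))\<^sup>2 \<partial>M) \<le> (\<integral>z. C\<^sup>2 * (cmod (g z))\<^sup>2 \<partial>M)"
    using * assms by (intro integral_mono_AE) (auto simp: l2_def)
  also have "\<dots> = (C * l2_norm M g)\<^sup>2"
    by (simp add: power_mult_distrib l2_norm_power2)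
  finally show ?thesis
    using \<open>0 \<le> C\<close> unfolding l2_norm_power2[symmetric]
    by (auto intro: power2_le_imp_le)
qed

lemma l2_norm_eq_0_iff:
  assumes "f \<in> l2 M"
  shows "l2_norm M f = 0 \<longleftrightarrow> (AE z in M. f z = 0)"
  using assms unfolding l2_norm_def
  by (auto simp: l2_def integral_nonneg_eq_0_iff_AE)

lemma l2_mult_integrable:
  assumes "f \<in> l2 M" "g \<in> l2 M"
  shows "integrable M (\<lambda>z. f z * cnj (g z))" "integrable M (\<lambda>z. cmod (f z) * cmod (g z))"
proof -
  have i: "integrable M (\<lambda>z. (cmod (f z))\<^sup>2 + (cmod (g z))\<^sup>2)"
    using assms by (auto simp: l2_def)
  have "cmod (f z) * cmod (g z) \<le> (cmod (f z))\<^sup>2 + (cmod (g z))\<^sup>2" for z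
  proof -
    have "0 \<le> cmod (f z) * cmod (g z)" by simp
    then show ?thesis
      using sum_squares_bound[of "cmod (f z)" "cmod (g z)"] by linarith
  qed
  moreover have "f \<in> borel_measurable M" "g \<in> borel_measurable M"
    using assms by (auto simp: l2_def)
  ultimately show "integrable M (\<lambda>z. f z * cnj (g z))" "integrable M (\<lambda>z. cmod (f z) * cmod (g z))"
    by (auto intro!: Bochner_Integration.integrable_bound[OF i] simp: norm_mult)
qed

text \<open>
  Integrating \<open>2 a b \<le> s a\<^sup>2 + b\<^sup>2 / s\<close> and optimising \<open>s\<close>.
\<close>

lemma l2_Cauchy_Schwarz_real:
  assumes "f \<in> l2 M" "g \<in> l2 M"
  shows "(\<integral>z. cmod (f z) * cmod (g z) \<partial>M) \<le> l2_norm M f * l2_norm M g"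
proof -
  define a b where "a = l2_norm M f" and "b = l2_norm M g"
  have ab: "a \<ge> 0" "b \<ge> 0" by (auto simp: a_def b_def)
  let ?I = "\<integral>z. cmod (f z) * cmod (g z) \<partial>M"
  have key: "2 * ?I \<le> s * a\<^sup>2 + b\<^sup>2 / s" if "s > 0" for s
  proof -
    have "2 * (cmod (f z) * cmod (g z)) \<le> s * (cmod (f z))\<^sup>2 + (cmod (g z))\<^sup>2 / s" for z
    proof -
      have "0 \<le> (s * cmod (f z) - cmod (g z))\<^sup>2 / s" using that by simp
      also have "\<dots> = s * (cmod (f z))\<^sup>2 + (cmod (g z))\<^sup>2 / s - 2 * (cmod (f z) * cmod (g z))"
        using that by (simp add: power2_eq_square field_simps)
      finally show ?thesis by simp
    qed
    then have "(\<integral>z. 2 * (cmod (f z) * cmod (g z)) \<partial>M)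
        \<le> (\<integral>z. s * (cmod (f z))\<^sup>2 + (cmod (g z))\<^sup>2 / s \<partial>M)"
      using assms l2_mult_integrable[OF assms] by (intro integral_mono) (auto simp: l2_def)
    also have "\<dots> = s * a\<^sup>2 + b\<^sup>2 / s"
      using assms by (simp add: l2_def a_def b_def l2_norm_power2)
    finally show ?thesis by simp
  qed
  \<comment> \<open>The optimal \<open>s\<close> is \<open>b / a\<close>; adding \<open>\<epsilon>\<close> keeps it positive and finite.\<close>
  have "?I \<le> (a + \<epsilon>) * (b + \<epsilon>)" if "\<epsilon> > 0" for \<epsilon>
  proof -
    have pos: "a + \<epsilon> > 0" "b + \<epsilon> > 0" using ab that by auto
    have "2 * ?I \<le> ((b + \<epsilon>) / (a + \<epsilon>)) * a\<^sup>2 + b\<^sup>2 / ((b + \<epsilon>) / (a + \<epsilon>))"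
      by (rule key) (use pos in auto)
    also have "\<dots> \<le> ((b + \<epsilon>) / (a + \<epsilon>)) * (a + \<epsilon>)\<^sup>2 + (b + \<epsilon>)\<^sup>2 / ((b + \<epsilon>) / (a + \<epsilon>))"
      using pos ab that by (intro add_mono mult_left_mono divide_right_mono power_mono) auto
    also have "\<dots> = 2 * ((a + \<epsilon>) * (b + \<epsilon>))"
      using pos by (simp add: power2_eq_square)
    finally show ?thesis by simp
  qed
  then have "\<forall>\<^sub>F \<epsilon> in at_right 0. ?I \<le> (a + \<epsilon>) * (b + \<epsilon>)"
    by (auto simp: eventually_at_filter)
  moreover have "((\<lambda>\<epsilon>. (a + \<epsilon>) * (b + \<epsilon>)) \<longlongrightarrow> (a + 0) * (b + 0)) (at_right 0)"
    by (intro tendsto_intros)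
  ultimately have "?I \<le> (a + 0) * (b + 0)"
    by (intro tendsto_lowerbound) auto
  then show ?thesis by (simp add: a_def b_def)
qed

lemma l2_Cauchy_Schwarz:
  assumes "f \<in> l2 M" "g \<in> l2 M"
  shows "cmod (l2_inner M f g) \<le> l2_norm M f * l2_norm M g"
proof -
  have "cmod (l2_inner M f g) \<le> (\<integral>z. cmod (f z * cnj (g z)) \<partial>M)"
    unfolding l2_inner_def by (rule integral_norm_bound)
  also have "\<dots> = (\<integral>z. cmod (f z) * cmod (g z) \<partial>M)" by (simp add: norm_mult)
  also note l2_Cauchy_Schwarz_real[OF assms]
  finally show ?thesis .
qed

lemma l2_norm_triangle:
  assumes "f \<in> l2 M" "g \<in> l2 M"
  shows "l2_norm M (\<lambda>z. f z + g z) \<le> l2_norm M f + l2_norm M g"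
proof -
  have "(l2_norm M (\<lambda>z. f z + g z))\<^sup>2 \<le>
      (\<integral>z. (cmod (f z))\<^sup>2 + (cmod (g z))\<^sup>2 + 2 * (cmod (f z) * cmod (g z)) \<partial>M)"
    unfolding l2_norm_power2
  proof (rule integral_mono)
    show "(cmod (f z + g z))\<^sup>2 \<le> (cmod (f z))\<^sup>2 + (cmod (g z))\<^sup>2 + 2 * (cmod (f z) * cmod (g z))" for z
      using power_mono[OF norm_triangle_ineq[of "f z" "g z"], of 2]
      by (simp add: power2_sum mult.assoc)
  qed (use assms l2_add[OF assms] l2_mult_integrable[OF assms] in \<open>auto simp: l2_def\<close>)
  also have "\<dots> = (l2_norm M f)\<^sup>2 + (l2_norm M g)\<^sup>2 + 2 * (\<integral>z. cmod (f z) * cmod (g z) \<partial>M)"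
    using assms l2_mult_integrable[OF assms] by (simp add: l2_norm_power2 l2_def)
  also have "\<dots> \<le> (l2_norm M f + l2_norm M g)\<^sup>2"
    using l2_Cauchy_Schwarz_real[OF assms] by (simp add: power2_sum)
  finally show ?thesis by (rule power2_le_imp_le) simp
qed

lemma l2_norm_triangle_diff:
  assumes "f \<in> l2 M" "g \<in> l2 M" "h \<in> l2 M"
  shows "l2_norm M (\<lambda>z. f z - h z) \<le> l2_norm M (\<lambda>z. f z - g z) + l2_norm M (\<lambda>z. g z - h z)"
  using l2_norm_triangle[OF l2_diff[OF assms(1,2)] l2_diff[OF assms(2,3)]] by simp

lemma l2_norm_triangle_sub:
  assumes "f \<in> l2 M" "g \<in> l2 M"
  shows "l2_norm M f \<le> l2_norm M g + l2_norm M (\<lambda>z. f z - g z)"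
  using l2_norm_triangle[OF assms(2) l2_diff[OF assms]] by simp

lemma l2_inner_diff_left:
  assumes "f \<in> l2 M" "g \<in> l2 M" "h \<in> l2 M"
  shows "l2_inner M (\<lambda>z. f z - g z) h = l2_inner M f h - l2_inner M g h"
  unfolding l2_inner_def using l2_mult_integrable(1)[OF assms(1,3)] l2_mult_integrable(1)[OF assms(2,3)]
  by (simp add: left_diff_distrib)

lemma l2_inner_diff_right:
  assumes "f \<in> l2 M" "g \<in> l2 M" "h \<in> l2 M"
  shows "l2_inner M h (\<lambda>z. f z - g z) = l2_inner M h f - l2_inner M h g"
  unfolding l2_inner_def using l2_mult_integrable(1)[OF assms(3,1)] l2_mult_integrable(1)[OF assms(3,2)]
  by (simp add: right_diff_distrib)

lemma l2_inner_add_left: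
  assumes "f \<in> l2 M" "g \<in> l2 M" "h \<in> l2 M"
  shows "l2_inner M (\<lambda>z. f z + g z) h = l2_inner M f h + l2_inner M g h"
  unfolding l2_inner_def using l2_mult_integrable(1)[OF assms(1,3)] l2_mult_integrable(1)[OF assms(2,3)]
  by (simp add: distrib_right)

lemma l2_inner_scale_left: "l2_inner M (\<lambda>z. c * f z) g = c * l2_inner M f g"
  unfolding l2_inner_def by (simp add: mult.assoc)

lemma l2_inner_cnj: "cnj (l2_inner M f g) = l2_inner M g f"
  unfolding l2_inner_def Bochner_Integration.integral_cnj[symmetric]
  by (simp only: complex_cnj_mult complex_cnj_cnj mult.commute)

lemma l2_inner_self: "l2_inner M f f = of_real ((l2_norm M f)\<^sup>2)"
  unfolding l2_inner_def l2_norm_power2 integral_complex_of_real[symmetric]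
  by (simp only: complex_norm_square[symmetric] of_real_power)

lemma l2_inner_AE_cong:
  assumes "f \<in> l2 M" "f' \<in> l2 M" "g \<in> l2 M" "g' \<in> l2 M"
    "AE z in M. f z = f' z" "AE z in M. g z = g' z"
  shows "l2_inner M f g = l2_inner M f' g'"
  unfolding l2_inner_def using assms by (intro integral_cong_AE) (auto simp: l2_def)

lemma l2_inner_tendsto:
  assumes u: "\<And>n. u n \<in> l2 M" "a \<in> l2 M" "(\<lambda>n. l2_norm M (\<lambda>z. u n z - a z)) \<longlonglongrightarrow> 0"
    and v: "\<And>n. v n \<in> l2 M" "b \<in> l2 M" "(\<lambda>n. l2_norm M (\<lambda>z. v n z - b z)) \<longlonglongrightarrow> 0"
  shows "(\<lambda>n. l2_inner M (u n) (v n)) \<longlonglongrightarrow> l2_inner M a b"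
proof -
  let ?d = "\<lambda>n. l2_norm M (\<lambda>z. u n z - a z)" and ?e = "\<lambda>n. l2_norm M (\<lambda>z. v n z - b z)"
  have le: "cmod (l2_inner M (u n) (v n) - l2_inner M a b) \<le> ?d n * (l2_norm M b + ?e n) + l2_norm M a * ?e n" for n
  proof -
    have "cmod (l2_inner M (\<lambda>z. u n z - a z) (v n)) \<le> ?d n * l2_norm M (v n)"
      by (rule l2_Cauchy_Schwarz[OF l2_diff[OF u(1,2)] v(1)])
    also have "\<dots> \<le> ?d n * (l2_norm M b + ?e n)"
      by (rule mult_left_mono[OF l2_norm_triangle_sub[OF v(1,2)]]) simp
    finally have 1: "cmod (l2_inner M (u n) (v n) - l2_inner M a (v n)) \<le> ?d n * (l2_norm M b + ?e n)"
      unfolding l2_inner_diff_left[OF u(1,2) v(1)] .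
    have 2: "cmod (l2_inner M a (v n) - l2_inner M a b) \<le> l2_norm M a * ?e n"
      using l2_Cauchy_Schwarz[OF u(2) l2_diff[OF v(1,2)], of n] unfolding l2_inner_diff_right[OF v(1,2) u(2)] .
    show ?thesis
      using norm_triangle_mono[OF 1 2] by (simp only: diff_add_cancel add_diff_eq)
  qed
  have "(\<lambda>n. ?d n * (l2_norm M b + ?e n) + l2_norm M a * ?e n) \<longlonglongrightarrow> 0 * (l2_norm M b + 0) + l2_norm M a * 0"
    by (intro tendsto_intros u(3) v(3))
  then have lim: "(\<lambda>n. ?d n * (l2_norm M b + ?e n) + l2_norm M a * ?e n) \<longlonglongrightarrow> 0" by simp
  have "(\<lambda>n. l2_inner M (u n) (v n) - l2_inner M a b) \<longlonglongrightarrow> 0"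
    by (rule Lim_null_comparison[OF always_eventually[OF allI[OF le]] lim])
  then show ?thesis by (rule LIM_zero_cancel)
qed

lemma l2_dominated_convergence:
  assumes f: "\<And>n. f n \<in> l2 M" and g: "g \<in> l2 M" and w: "integrable M w"
    and lim: "AE z in M. (\<lambda>n. f n z) \<longlonglongrightarrow> g z"
    and bd: "\<And>n. AE z in M. (cmod (f n z - g z))\<^sup>2 \<le> w z"
  shows "(\<lambda>n. l2_norm M (\<lambda>z. f n z - g z)) \<longlonglongrightarrow> 0"
proof -
  have [measurable]: "f n \<in> borel_measurable M" "g \<in> borel_measurable M" for n
    using f g by (auto simp: l2_def)
  have "(\<lambda>n. \<integral>z. (cmod (f n z - g z))\<^sup>2 \<partial>M) \<longlonglongrightarrow> (\<integral>z. 0 \<partial>M)"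
  proof (rule integral_dominated_convergence[OF _ _ w])
    show "AE z in M. (\<lambda>n. (cmod (f n z - g z))\<^sup>2) \<longlonglongrightarrow> 0"
      using lim
    proof eventually_elim
      case (elim z)
      then have "(\<lambda>n. (cmod (f n z - g z))\<^sup>2) \<longlonglongrightarrow> (cmod (g z - g z))\<^sup>2"
        by (intro tendsto_intros)
      then show ?case by simp
    qed
  qed (use bd in auto)
  then have "(\<lambda>n. sqrt (\<integral>z. (cmod (f n z - g z))\<^sup>2 \<partial>M)) \<longlonglongrightarrow> sqrt 0"
    by (intro tendsto_real_sqrt) simp
  then show ?thesis by (simp add: l2_norm_def)
qed

lemma l2_nn_integral:
  assumes "f \<in> l2 M"
  shows "(\<integral>\<^sup>+z. ennreal ((cmod (f z))\<^sup>2) \<partial>M) = ennreal ((l2_norm M f)\<^sup>2)"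
  using assms unfolding l2_norm_power2 by (intro nn_integral_eq_integral) (auto simp: l2_def)

text \<open>
  The increments satisfy \<open>\<Sum>n. 2\<^sup>n \<bar>d n\<bar>\<^sup>2 < \<infinity>\<close> almost everywhere, because the integral of this
  sum is finite. This forces pointwise convergence, and Fatou's lemma controls the distance to the
  limit.
\<close>

lemma l2_complete:
  fixes x :: "nat \<Rightarrow> 'a \<Rightarrow> complex"
  assumes x: "\<And>n. x n \<in> l2 M"
    and step: "\<And>n. l2_norm M (\<lambda>z. x (Suc n) z - x n z) \<le> (1/3) ^ n"
  obtains y where "y \<in> l2 M" "\<And>n. l2_norm M (\<lambda>z. y z - x n z) \<le> 3/2 * (1/3) ^ n"
proof -
  define d where "d n z = x (Suc n) z - x n z" for n z
  have d: "d n \<in> l2 M" for n unfolding d_def by (intro l2_diff x)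
  have [measurable]: "x n \<in> borel_measurable M" "d n \<in> borel_measurable M" for n
    using x d by (auto simp: l2_def)
  have "(\<integral>\<^sup>+z. (\<Sum>n. ennreal (2^n * (cmod (d n z))\<^sup>2)) \<partial>M)
      = (\<Sum>n. \<integral>\<^sup>+z. ennreal (2^n * (cmod (d n z))\<^sup>2) \<partial>M)"
    by (intro nn_integral_suminf) auto
  also have "\<dots> \<le> (\<Sum>n. ennreal ((2/9)^n))"
  proof (intro suminf_le)
    fix n
    have "(\<integral>\<^sup>+z. ennreal (2^n * (cmod (d n z))\<^sup>2) \<partial>M) = ennreal (2^n * (l2_norm M (d n))\<^sup>2)"
      by (simp add: ennreal_mult nn_integral_cmult l2_nn_integral[OF d])
    also have "\<dots> \<le> ennreal (2^n * ((1/3)^n)\<^sup>2)"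
      using step[of n] by (intro ennreal_leI mult_left_mono power_mono) (auto simp: d_def[abs_def])
    also have "2^n * ((1/3)^n)\<^sup>2 = (2/9::real)^n"
    proof -
      have "2^n * ((1/3)^n)\<^sup>2 = (2 * (1/3)\<^sup>2 :: real)^n"
        unfolding power_mult_distrib power_mult[symmetric] by (simp only: mult.commute[of n 2])
      then show ?thesis by (simp add: power2_eq_square)
    qed
    finally show "(\<integral>\<^sup>+z. ennreal (2^n * (cmod (d n z))\<^sup>2) \<partial>M) \<le> ennreal ((2/9)^n)" .
  qed auto
  also have "\<dots> < \<infinity>"
  proof -
    have "(\<Sum>n. ennreal ((2/9)^n)) = ennreal (\<Sum>n. (2/9)^n)"
      by (intro suminf_ennreal2) (simp_all add: summable_geometric)
    then show ?thesis by simp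
  qed
  finally have "AE z in M. (\<Sum>n. ennreal (2^n * (cmod (d n z))\<^sup>2)) \<noteq> \<infinity>"
    by (intro nn_integral_noteq_infinite) auto
  then have conv: "AE z in M. convergent (\<lambda>n. x n z)"
  proof eventually_elim
    case (elim z)
    then have s: "summable (\<lambda>n. 2^n * (cmod (d n z))\<^sup>2)"
      by (intro summable_suminf_not_top) auto
    have "summable (\<lambda>n. d n z)"
    proof (rule summable_comparison_test')
      show "summable (\<lambda>n. (1/2)^n + 2^n * (cmod (d n z))\<^sup>2)"
        using s by (intro summable_add) (auto simp: summable_geometric)
      fix n :: nat
      have amgm: "0 \<le> 1 / a + a * c\<^sup>2 - 2 * c" if "a > 0" for a c :: real
      proof -
        have "0 \<le> (1 - a * c)\<^sup>2 / a" using that by simp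
        also have "\<dots> = 1 / a + a * c\<^sup>2 - 2 * c"
          using that by (simp add: power2_eq_square field_simps)
        finally show ?thesis .
      qed
      have "0 \<le> (1/2)^n + 2^n * (cmod (d n z))\<^sup>2 - 2 * cmod (d n z)"
        using amgm[of "2^n" "cmod (d n z)"] by (simp add: power_one_over)
      then show "cmod (d n z) \<le> (1/2)^n + 2^n * (cmod (d n z))\<^sup>2"
        using norm_ge_zero[of "d n z"] by linarith
    qed
    moreover have "(\<Sum>k<n. d k z) = x n z - x 0 z" for n
      unfolding d_def by (rule sum_lessThan_telescope)
    ultimately have "convergent (\<lambda>n. x n z - x 0 z)"
      by (simp add: summable_iff_convergent)
    then have "convergent (\<lambda>n. (x n z - x 0 z) + x 0 z)"
      by (intro convergent_add convergent_const)
    then show ?case by simp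
  qed
  define y where "y z = lim (\<lambda>n. x n z)" for z
  have [measurable]: "y \<in> borel_measurable M" unfolding y_def by measurable
  have lim: "AE z in M. (\<lambda>n. x n z) \<longlonglongrightarrow> y z"
    using conv by eventually_elim (simp add: y_def convergent_LIMSEQ_iff)
  have dist: "l2_norm M (\<lambda>z. x (n + k) z - x n z) \<le> 3/2 * (1/3)^n" for n k
  proof -
    have "l2_norm M (\<lambda>z. x (n + k) z - x n z) \<le> 3/2 * (1/3)^n - 3/2 * (1/3)^(n + k)"
    proof (induction k)
      case 0
      show ?case by (simp add: l2_norm_def)
    next
      case (Suc k)
      have "l2_norm M (\<lambda>z. x (n + Suc k) z - x n z)
          \<le> l2_norm M (\<lambda>z. x (n + Suc k) z - x (n + k) z) + l2_norm M (\<lambda>z. x (n + k) z - x n z)"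
        by (rule l2_norm_triangle_diff[OF x x x])
      moreover have "(1/3::real)^(n + Suc k) = (1/3) * (1/3)^(n + k)" by simp
      ultimately show ?case using Suc step[of "n + k"] unfolding add_Suc_right by linarith
    qed
    moreover have "0 \<le> (1/3::real)^(n + k)" by simp
    ultimately show ?thesis by linarith
  qed
  have fatou: "(\<integral>\<^sup>+z. ennreal ((cmod (y z - x n z))\<^sup>2) \<partial>M) \<le> ennreal ((3/2 * (1/3)^n)\<^sup>2)" for n
  proof -
    have "(\<integral>\<^sup>+z. ennreal ((cmod (y z - x n z))\<^sup>2) \<partial>M)
        = (\<integral>\<^sup>+z. liminf (\<lambda>k. ennreal ((cmod (x (n + k) z - x n z))\<^sup>2)) \<partial>M)"
    proof (rule nn_integral_cong_AE)
      show "AE z in M. ennreal ((cmod (y z - x n z))\<^sup>2)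
          = liminf (\<lambda>k. ennreal ((cmod (x (n + k) z - x n z))\<^sup>2))"
        using lim
      proof eventually_elim
        case (elim z)
        then have "(\<lambda>k. x (n + k) z) \<longlonglongrightarrow> y z"
          using LIMSEQ_ignore_initial_segment[of "\<lambda>n. x n z" "y z" n] by (simp add: add.commute)
        then have "(\<lambda>k. ennreal ((cmod (x (n + k) z - x n z))\<^sup>2)) \<longlonglongrightarrow> ennreal ((cmod (y z - x n z))\<^sup>2)"
          by (intro tendsto_intros)
        then show ?case by (intro lim_imp_Liminf[symmetric]) auto
      qed
    qed
    also have "\<dots> \<le> liminf (\<lambda>k. \<integral>\<^sup>+z. ennreal ((cmod (x (n + k) z - x n z))\<^sup>2) \<partial>M)"
      by (intro nn_integral_liminf) auto
    also have "\<dots> \<le> ennreal ((3/2 * (1/3)^n)\<^sup>2)"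
    proof -
      have "(\<integral>\<^sup>+z. ennreal ((cmod (x (n + k) z - x n z))\<^sup>2) \<partial>M) \<le> ennreal ((3/2 * (1/3)^n)\<^sup>2)" for k
        unfolding l2_nn_integral[OF l2_diff[OF x x]]
        by (intro ennreal_leI power_mono dist) auto
      then show ?thesis
        by (intro Liminf_le) (auto intro!: always_eventually)
    qed
    finally show ?thesis .
  qed
  have diff: "(\<lambda>z. y z - x n z) \<in> l2 M" for n
    unfolding l2_def using fatou[of n]
    by (auto simp: integrable_iff_bounded intro: le_less_trans)
  have "y \<in> l2 M" using l2_add[OF diff[of 0] x[of 0]] by simp
  moreover have "l2_norm M (\<lambda>z. y z - x n z) \<le> 3/2 * (1/3)^n" for n
  proof (rule power2_le_imp_le)
    show "(l2_norm M (\<lambda>z. y z - x n z))\<^sup>2 \<le> (3/2 * (1/3)^n)\<^sup>2"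
      using fatou[of n] unfolding l2_nn_integral[OF diff] by (subst (asm) ennreal_le_iff) auto
  qed auto
  ultimately show ?thesis using that by blast
qed

section \<open>Uniform boundedness\<close>

lemma bounded_operator_l2: "l2_bounded_operator M S \<Longrightarrow> f \<in> l2 M \<Longrightarrow> S f \<in> l2 M"
  by (simp add: l2_bounded_operator_def)

lemma bounded_operator_add:
  "l2_bounded_operator M S \<Longrightarrow> f \<in> l2 M \<Longrightarrow> g \<in> l2 M \<Longrightarrow>
    AE z in M. S (\<lambda>w. f w + g w) z = S f z + S g z"
  by (simp add: l2_bounded_operator_def)

lemma bounded_operator_scale:
  "l2_bounded_operator M S \<Longrightarrow> f \<in> l2 M \<Longrightarrow> AE z in M. S (\<lambda>w. c * f w) z = c * S f z"
  by (simp add: l2_bounded_operator_def)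

lemma bounded_operator_diff:
  assumes "l2_bounded_operator M S" "f \<in> l2 M" "g \<in> l2 M"
  shows "AE z in M. S (\<lambda>w. f w - g w) z = S f z - S g z"
proof -
  have "AE z in M. S (\<lambda>w. f w + (-1) * g w) z = S f z + S (\<lambda>w. (-1) * g w) z"
    by (rule bounded_operator_add[OF assms(1,2) l2_scale[OF assms(3)]])
  moreover have "AE z in M. S (\<lambda>w. (-1) * g w) z = (-1) * S g z"
    by (rule bounded_operator_scale[OF assms(1,3)])
  ultimately have "AE z in M. S (\<lambda>w. f w + (-1) * g w) z = S f z - S g z"
    by eventually_elim simp
  then show ?thesis by simp
qed

lemma bounded_operator_norm_diff:
  assumes "l2_bounded_operator M S" "f \<in> l2 M" "g \<in> l2 M"
  shows "l2_norm M (S (\<lambda>w. f w - g w)) = l2_norm M (\<lambda>z. S f z - S g z)"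
  by (rule l2_norm_AE_cong[OF _ _ bounded_operator_diff[OF assms]])
    (rule l2_measurable bounded_operator_l2[OF assms(1)] l2_diff assms(2,3))+

lemma bounded_operator_norm_add_le:
  assumes S: "l2_bounded_operator M S" and f: "f \<in> l2 M" and g: "g \<in> l2 M"
  shows "l2_norm M (S (\<lambda>w. f w + g w)) \<le> l2_norm M (S f) + l2_norm M (S g)"
proof -
  have "l2_norm M (S (\<lambda>w. f w + g w)) = l2_norm M (\<lambda>z. S f z + S g z)"
    by (rule l2_norm_AE_cong[OF _ _ bounded_operator_add[OF assms]])
      (rule l2_measurable bounded_operator_l2[OF S] l2_add f g)+
  then show ?thesis
    using l2_norm_triangle[OF bounded_operator_l2[OF S f] bounded_operator_l2[OF S g]] by simp
qed

lemma bounded_operator_norm_diff_le: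
  assumes S: "l2_bounded_operator M S" and f: "f \<in> l2 M" and g: "g \<in> l2 M"
  shows "l2_norm M (S (\<lambda>w. f w - g w)) \<le> l2_norm M (S f) + l2_norm M (S g)"
proof -
  have "l2_norm M (\<lambda>z. S f z - S g z) \<le> l2_norm M (S f) + l2_norm M (\<lambda>z. (-1) * S g z)"
    using l2_norm_triangle[OF bounded_operator_l2[OF S f] l2_scale[OF bounded_operator_l2[OF S g]], of "-1"]
    by simp
  also have "l2_norm M (\<lambda>z. (-1) * S g z) = l2_norm M (S g)"
    unfolding l2_norm_scale by simp
  finally show ?thesis unfolding bounded_operator_norm_diff[OF assms] .
qed

lemma bounded_operator_norm_scale:
  assumes S: "l2_bounded_operator M S" and f: "f \<in> l2 M"
  shows "l2_norm M (S (\<lambda>w. c * f w)) = cmod c * l2_norm M (S f)"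
  unfolding l2_norm_scale[symmetric]
  by (rule l2_norm_AE_cong[OF _ _ bounded_operator_scale[OF assms]])
    (rule l2_measurable bounded_operator_l2[OF S] l2_scale f)+

text \<open>
  \<open>L\<close> is the infimum of all bounds. It is itself a bound and \<open>2/3 * L\<close> is none, which a suitable vector
  witnesses; rescaling gives this vector any prescribed length.
\<close>

lemma bounded_operator_norm:
  assumes S: "l2_bounded_operator M S"
  obtains L where "0 \<le> L" "\<And>f. f \<in> l2 M \<Longrightarrow> l2_norm M (S f) \<le> L * l2_norm M f"
    "\<And>r. 0 < r \<Longrightarrow> 0 < L \<Longrightarrow> \<exists>f\<in>l2 M. l2_norm M f = r \<and> 2/3 * L * r \<le> l2_norm M (S f)"
proof -
  define B where "B = {C. 0 \<le> C \<and> (\<forall>f\<in>l2 M. l2_norm M (S f) \<le> C * l2_norm M f)}"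
  obtain C0 where C0: "\<And>f. f \<in> l2 M \<Longrightarrow> l2_norm M (S f) \<le> C0 * l2_norm M f"
    using S unfolding l2_bounded_operator_def by blast
  have "max C0 0 \<in> B"
    unfolding B_def by (auto intro!: order_trans[OF C0] mult_right_mono)
  then have ne: "B \<noteq> {}" by auto
  have bdd: "bdd_below B" by (auto simp: B_def bdd_below_def)
  define L where "L = Inf B"
  have L0: "0 \<le> L" unfolding L_def by (rule cInf_greatest[OF ne]) (auto simp: B_def)
  have Lb: "l2_norm M (S f) \<le> L * l2_norm M f" if f: "f \<in> l2 M" for f
  proof (cases "l2_norm M f = 0")
    case True
    with C0[OF f] show ?thesis by simp
  next
    case False
    then have pos: "0 < l2_norm M f" using l2_norm_nonneg[of M f] by linarith
    have "l2_norm M (S f) / l2_norm M f \<le> L" unfolding L_def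
      using f pos by (intro cInf_greatest[OF ne]) (auto simp: B_def field_simps)
    then show ?thesis using pos by (simp add: field_simps)
  qed
  have att: "\<exists>f\<in>l2 M. l2_norm M f = r \<and> 2/3 * L * r \<le> l2_norm M (S f)" if r: "0 < r" and L: "0 < L" for r
  proof -
    have "2/3 * L \<notin> B"
    proof
      assume "2/3 * L \<in> B"
      then have "L \<le> 2/3 * L" unfolding L_def using bdd by (rule cInf_lower)
      with L show False by simp
    qed
    then obtain f where f: "f \<in> l2 M" "2/3 * L * l2_norm M f < l2_norm M (S f)"
      using L by (auto simp: B_def not_le)
    have "l2_norm M f \<noteq> 0" using C0[OF f(1)] f(2) by auto
    then have pos: "0 < l2_norm M f" using l2_norm_nonneg[of M f] by linarith
    define c where "c = complex_of_real (r / l2_norm M f)"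
    have c: "cmod c = r / l2_norm M f" using r pos by (simp add: c_def norm_divide)
    show ?thesis
    proof (intro bexI conjI)
      show "l2_norm M (\<lambda>w. c * f w) = r" unfolding l2_norm_scale c using pos by simp
      have "2/3 * L * r = cmod c * (2/3 * L * l2_norm M f)" unfolding c using pos by simp
      also have "\<dots> \<le> cmod c * l2_norm M (S f)" using f(2) by (intro mult_left_mono) auto
      finally show "2/3 * L * r \<le> l2_norm M (S (\<lambda>w. c * f w))"
        unfolding bounded_operator_norm_scale[OF S f(1)] .
    qed (rule l2_scale[OF f(1)])
  qed
  show ?thesis using that[OF L0 Lb att] .
qed

text \<open>
  The uniform boundedness principle by a gliding hump. If the operators are not uniformly bounded,
  pick \<open>S (n k)\<close> of norm at least \<open>k * 3^k\<close> and add, for every \<open>k\<close>, a vector of length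
  \<open>3^(-k)\<close> on which \<open>S (n k)\<close> is nearly maximal; its sign is chosen such that the image of the
  partial sum does not cancel it. The remaining vectors have total length at most half of this one,
  so they cannot undo its effect, and the orbit of the sum is unbounded.
\<close>

lemma uniform_boundedness:
  fixes S :: "nat \<Rightarrow> ('a \<Rightarrow> complex) \<Rightarrow> 'a \<Rightarrow> complex"
  assumes S: "\<And>n. l2_bounded_operator M (S n)"
    and pt: "\<And>f. f \<in> l2 M \<Longrightarrow> \<exists>C. \<forall>n. l2_norm M (S n f) \<le> C"
  shows "\<exists>C. \<forall>n. \<forall>f\<in>l2 M. l2_norm M (S n f) \<le> C * l2_norm M f"
proof (rule ccontr)
  assume contra: "\<not> ?thesis"
  have "\<forall>n. \<exists>L. 0 \<le> L \<and> (\<forall>f\<in>l2 M. l2_norm M (S n f) \<le> L * l2_norm M f) \<and>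
    (\<forall>r>0. 0 < L \<longrightarrow> (\<exists>f\<in>l2 M. l2_norm M f = r \<and> 2/3 * L * r \<le> l2_norm M (S n f)))"
    using bounded_operator_norm[OF S] by metis
  then obtain L where L: "\<And>n. 0 \<le> L n" "\<And>n f. f \<in> l2 M \<Longrightarrow> l2_norm M (S n f) \<le> L n * l2_norm M f"
    "\<And>n r. 0 < r \<Longrightarrow> 0 < L n \<Longrightarrow> \<exists>f\<in>l2 M. l2_norm M f = r \<and> 2/3 * L n * r \<le> l2_norm M (S n f)"
    by metis
  have big: "\<exists>n. C < L n" for C
  proof (rule ccontr)
    assume "\<not> (\<exists>n. C < L n)"
    then have "l2_norm M (S n f) \<le> C * l2_norm M f" if "f \<in> l2 M" for n f
      using L(2)[OF that, of n] mult_right_mono[of "L n" C "l2_norm M f"] by (auto simp: not_less)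
    with contra show False by blast
  qed
  have "\<forall>k::nat. \<exists>n. 6 * (real k + 1) * 3^k < L n" using big by blast
  then obtain n where n: "\<And>k. 6 * (real k + 1) * 3^k < L (n k)" by metis
  have Lpos: "0 < L (n k)" for k
    by (rule le_less_trans[OF _ n]) simp
  have "\<forall>k. \<exists>f\<in>l2 M. l2_norm M f = (1/3)^k \<and> 2/3 * L (n k) * (1/3)^k \<le> l2_norm M (S (n k) f)"
    using L(3)[OF _ Lpos] by simp
  then obtain h where h: "\<And>k. h k \<in> l2 M" "\<And>k. l2_norm M (h k) = (1/3)^k"
    "\<And>k. 2/3 * L (n k) * (1/3)^k \<le> l2_norm M (S (n k) (h k))"
    by metis
  have step: "\<exists>y\<in>l2 M. l2_norm M (\<lambda>z. y z - x z) \<le> (1/3)^k \<and> l2_norm M (S (n k) (h k)) \<le> l2_norm M (S (n k) y)"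
    if x: "x \<in> l2 M" for x k
  proof -
    let ?p = "\<lambda>z. x z + h k z" and ?m = "\<lambda>z. x z - h k z"
    have p: "?p \<in> l2 M" and m: "?m \<in> l2 M" using l2_add[OF x h(1)] l2_diff[OF x h(1)] by auto
    have "l2_norm M (S (n k) (\<lambda>z. 2 * h k z)) \<le> l2_norm M (S (n k) ?p) + l2_norm M (S (n k) ?m)"
      using bounded_operator_norm_diff_le[OF S p m, of "n k"] by simp
    then have "l2_norm M (S (n k) (h k)) \<le> l2_norm M (S (n k) ?p) \<or>
        l2_norm M (S (n k) (h k)) \<le> l2_norm M (S (n k) ?m)"
      unfolding bounded_operator_norm_scale[OF S h(1)] by simp linarith
    moreover have "l2_norm M (\<lambda>z. ?p z - x z) \<le> (1/3)^k" using h(2)[of k] by simp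
    moreover have "l2_norm M (\<lambda>z. ?m z - x z) \<le> (1/3)^k"
      using l2_norm_scale[of M "-1" "h k"] h(2)[of k] by simp
    ultimately show ?thesis using bexI[OF _ p] bexI[OF _ m] by (elim disjE) simp_all
  qed
  have "\<exists>x. \<forall>k. x k \<in> l2 M \<and> (l2_norm M (\<lambda>z. x (Suc k) z - x k z) \<le> (1/3)^k \<and>
      l2_norm M (S (n k) (h k)) \<le> l2_norm M (S (n k) (x (Suc k))))"
    by (rule dependent_nat_choice) (use step l2_zero in \<open>blast+\<close>)
  then obtain x where x: "\<And>k. x k \<in> l2 M" "\<And>k. l2_norm M (\<lambda>z. x (Suc k) z - x k z) \<le> (1/3)^k"
    "\<And>k. l2_norm M (S (n k) (h k)) \<le> l2_norm M (S (n k) (x (Suc k)))"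
    by blast
  obtain y where y: "y \<in> l2 M" "\<And>k. l2_norm M (\<lambda>z. y z - x k z) \<le> 3/2 * (1/3)^k"
    by (rule l2_complete[OF x(1,2)]) (rule that)
  have unb: "real k + 1 \<le> l2_norm M (S (n k) y)" for k
  proof -
    have "l2_norm M (\<lambda>z. x (Suc k) z - y z) \<le> (1/3)^k / 2"
      using y(2)[of "Suc k"] by (simp add: l2_norm_minus_commute)
    then have "L (n k) * l2_norm M (\<lambda>z. x (Suc k) z - y z) \<le> L (n k) * ((1/3)^k / 2)"
      by (rule mult_left_mono) (rule L(1))
    with L(2)[OF l2_diff[OF x(1) y(1)], of "n k" "Suc k"]
    have "l2_norm M (S (n k) (\<lambda>z. x (Suc k) z - y z)) \<le> L (n k) * ((1/3)^k / 2)" by linarith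
    moreover have "l2_norm M (S (n k) (x (Suc k))) \<le>
        l2_norm M (S (n k) y) + l2_norm M (S (n k) (\<lambda>z. x (Suc k) z - y z))"
      using bounded_operator_norm_add_le[OF S y(1) l2_diff[OF x(1) y(1)], of "n k" "Suc k"] by simp
    moreover have "2/3 * L (n k) * (1/3)^k - L (n k) * ((1/3)^k / 2) = L (n k) * (1/3)^k / 6"
      by (simp add: algebra_simps)
    ultimately have "L (n k) * (1/3)^k / 6 \<le> l2_norm M (S (n k) y)"
      using x(3)[of k] h(3)[of k] by linarith
    moreover have "real k + 1 \<le> L (n k) * (1/3)^k / 6"
      using n[of k] by (simp add: power_one_over field_simps)
    ultimately show ?thesis by (rule order_trans[rotated])
  qed
  obtain C where C: "\<And>m. l2_norm M (S m y) \<le> C" using pt[OF y(1)] by blast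
  obtain k :: nat where "C < real k" using reals_Archimedean2 by blast
  then show False using unb[of k] C[of "n k"] by linarith
qed

section \<open>Semigroups and multiplication operators\<close>

lemma semigroup_operator: "c0_semigroup M T \<Longrightarrow> 0 \<le> t \<Longrightarrow> l2_bounded_operator M (T t)"
  by (simp add: c0_semigroup_def)

lemma semigroup_l2: "c0_semigroup M T \<Longrightarrow> 0 \<le> t \<Longrightarrow> f \<in> l2 M \<Longrightarrow> T t f \<in> l2 M"
  by (rule bounded_operator_l2[OF semigroup_operator])

lemma semigroup_zero: "c0_semigroup M T \<Longrightarrow> f \<in> l2 M \<Longrightarrow> AE z in M. T 0 f z = f z"
  by (simp add: c0_semigroup_def)

lemma semigroup_add:
  "c0_semigroup M T \<Longrightarrow> 0 \<le> s \<Longrightarrow> 0 \<le> t \<Longrightarrow> f \<in> l2 M \<Longrightarrow> AE z in M. T (s + t) f z = T s (T t f) z"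
  by (simp add: c0_semigroup_def)

text \<open>
  Otherwise the operators \<open>T (s n)\<close> would be unbounded for some sequence \<open>s n\<close> tending to \<open>0\<close>, although
  every orbit converges along it.
\<close>

lemma semigroup_bounded_near_zero:
  assumes T: "c0_semigroup M T"
  obtains \<delta> C where "0 < \<delta>" "1 \<le> C"
    "\<And>s f. 0 \<le> s \<Longrightarrow> s \<le> \<delta> \<Longrightarrow> f \<in> l2 M \<Longrightarrow> l2_norm M (T s f) \<le> C * l2_norm M f"
proof -
  have "\<exists>n::nat. \<forall>s f. 0 < s \<longrightarrow> s \<le> 1 / real (Suc n) \<longrightarrow> f \<in> l2 M \<longrightarrow>
      l2_norm M (T s f) \<le> real n * l2_norm M f"
  proof (rule ccontr)
    assume "\<not> ?thesis"
    then have "\<forall>n::nat. \<exists>s. 0 < s \<and> s \<le> 1 / real (Suc n) \<and>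
        (\<exists>f\<in>l2 M. real n * l2_norm M f < l2_norm M (T s f))"
      by (metis not_le)
    then obtain s where s: "\<And>n::nat. 0 < s n" "\<And>n. s n \<le> 1 / real (Suc n)"
      "\<And>n. \<exists>f\<in>l2 M. real n * l2_norm M f < l2_norm M (T (s n) f)"
      by metis
    have s0: "s \<longlonglongrightarrow> 0"
      using LIMSEQ_inverse_real_of_nat s(1,2)
      by (intro tendsto_sandwich[of "\<lambda>_. 0" s sequentially "\<lambda>n. 1 / real (Suc n)" 0])
        (auto simp: inverse_eq_divide less_imp_le)
    have s_right: "filterlim s (at_right 0) sequentially"
    proof -
      have "s n \<in> {0<..} \<and> s n \<noteq> 0" for n using s(1)[of n] by simp
      then show ?thesis using s0 by (simp add: filterlim_at)
    qed
    have "\<exists>C. \<forall>n. \<forall>f\<in>l2 M. l2_norm M (T (s n) f) \<le> C * l2_norm M f"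
    proof (rule uniform_boundedness)
      show "l2_bounded_operator M (T (s n))" for n
        using semigroup_operator[OF T] s(1)[of n] by simp
      fix f assume f: "f \<in> l2 M"
      have "((\<lambda>t. l2_norm M (\<lambda>z. T t f z - f z)) \<longlongrightarrow> 0) (at_right 0)"
        using T f by (simp add: c0_semigroup_def)
      then have "(\<lambda>n. l2_norm M (\<lambda>z. T (s n) f z - f z)) \<longlonglongrightarrow> 0"
        using s_right by (rule filterlim_compose)
      then have "Bseq (\<lambda>n. l2_norm M (\<lambda>z. T (s n) f z - f z))"
        by (intro convergent_imp_Bseq convergentI)
      then obtain K where K: "\<And>n. norm (l2_norm M (\<lambda>z. T (s n) f z - f z)) \<le> K"
        by (rule BseqE) blast
      have "l2_norm M (T (s n) f) \<le> l2_norm M f + K" for n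
        using l2_norm_triangle_sub[OF semigroup_l2[OF T _ f] f, of "s n"] s(1)[of n] K[of n] by simp
      then show "\<exists>C. \<forall>n. l2_norm M (T (s n) f) \<le> C" by blast
    qed
    then obtain C where C: "\<And>n f. f \<in> l2 M \<Longrightarrow> l2_norm M (T (s n) f) \<le> C * l2_norm M f" by blast
    obtain m :: nat where "C \<le> real m" using real_arch_simple by blast
    moreover obtain f where f: "f \<in> l2 M" "real m * l2_norm M f < l2_norm M (T (s m) f)"
      using s(3) by blast
    moreover have "C * l2_norm M f \<le> real m * l2_norm M f"
      using \<open>C \<le> real m\<close> by (rule mult_right_mono) simp
    ultimately show False using C[OF f(1), of m] by linarith
  qed
  then obtain n :: nat where n: "\<And>s f. 0 < s \<Longrightarrow> s \<le> 1 / real (Suc n) \<Longrightarrow> f \<in> l2 M \<Longrightarrow>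
      l2_norm M (T s f) \<le> real n * l2_norm M f" by blast
  show ?thesis
  proof (rule that)
    show "0 < 1 / real (Suc n)" "1 \<le> real n + 1" by auto
    fix s f assume s: "0 \<le> s" "s \<le> 1 / real (Suc n)" and f: "f \<in> l2 M"
    show "l2_norm M (T s f) \<le> (real n + 1) * l2_norm M f"
    proof (cases "s = 0")
      case True
      have "l2_norm M (T 0 f) = l2_norm M f"
        by (rule l2_norm_AE_cong[OF _ _ semigroup_zero[OF T f]])
          (rule l2_measurable semigroup_l2[OF T] f order_refl)+
      moreover have "0 \<le> real n * l2_norm M f" by simp
      ultimately show ?thesis using True unfolding distrib_right by simp
    next
      case False
      then have "l2_norm M (T s f) \<le> real n * l2_norm M f" using n s f by simp
      then show ?thesis using l2_norm_nonneg[of M f] unfolding distrib_right by linarith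
    qed
  qed
qed

lemma semigroup_locally_bounded:
  assumes T: "c0_semigroup M T"
  obtains K where "0 \<le> K"
    "\<And>s f. 0 \<le> s \<Longrightarrow> s \<le> t \<Longrightarrow> f \<in> l2 M \<Longrightarrow> l2_norm M (T s f) \<le> K * l2_norm M f"
proof -
  obtain \<delta> C where \<delta>: "0 < \<delta>" and C1: "1 \<le> C"
    and C: "\<And>s f. 0 \<le> s \<Longrightarrow> s \<le> \<delta> \<Longrightarrow> f \<in> l2 M \<Longrightarrow> l2_norm M (T s f) \<le> C * l2_norm M f"
    by (rule semigroup_bounded_near_zero[OF T]) (rule that)
  have *: "l2_norm M (T s f) \<le> C ^ Suc k * l2_norm M f"
    if "0 \<le> s" "s \<le> real k * \<delta> + \<delta>" "f \<in> l2 M" for k s f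
    using that
  proof (induction k arbitrary: s f)
    case 0
    then show ?case using C[of s f] by simp
  next
    case (Suc k)
    show ?case
    proof (cases "s \<le> \<delta>")
      case True
      have "l2_norm M (T s f) \<le> C * l2_norm M f" using C Suc.prems True by simp
      also have "\<dots> \<le> C ^ Suc (Suc k) * l2_norm M f"
        using C1 power_increasing[of 1 "Suc (Suc k)" C] by (intro mult_right_mono) auto
      finally show ?thesis .
    next
      case False
      define r where "r = s - \<delta>"
      have r: "0 \<le> r" "r \<le> real k * \<delta> + \<delta>" "s = \<delta> + r"
        using False Suc.prems by (auto simp: r_def algebra_simps)
      have "l2_norm M (T s f) = l2_norm M (T \<delta> (T r f))"
        unfolding r(3) using \<delta> r(1) Suc.prems(3)
        by (intro l2_norm_AE_cong l2_measurable semigroup_l2[OF T] semigroup_add[OF T]) auto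
      also have "\<dots> \<le> C * l2_norm M (T r f)"
        using \<delta> r(1) Suc.prems(3) by (intro C semigroup_l2[OF T]) auto
      also have "\<dots> \<le> C * (C ^ Suc k * l2_norm M f)"
        using Suc.IH[OF r(1,2) Suc.prems(3)] C1 by (intro mult_left_mono) auto
      finally show ?thesis by (simp add: mult.assoc)
    qed
  qed
  obtain k :: nat where k: "t / \<delta> \<le> real k" using real_arch_simple by blast
  then have "t \<le> real k * \<delta>" using \<delta> by (simp add: field_simps)
  then have "t \<le> real k * \<delta> + \<delta>" using \<delta> by simp
  then show ?thesis using C1 by (intro that[of "C ^ Suc k"] *) auto
qed

lemma generator_l2:
  assumes "generator M T f h" shows "f \<in> l2 M" "h \<in> l2 M"
  using assms by (auto simp: generator_def)

text \<open>
  As \<open>T s\<close> commutes with \<open>T e\<close>, the error of the difference quotient at time \<open>s\<close> is the image of the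
  error at time \<open>0\<close>. So orbits in the domain of the generator have right derivatives, and the rate of
  convergence is uniform on compact time intervals.
\<close>

lemma generator_difference_quotient:
  assumes T: "c0_semigroup M T" and f: "f \<in> l2 M" and h: "h \<in> l2 M" and s: "0 \<le> s" and e: "0 < e"
  shows "AE z in M. (T e (T s f) z - T s f z) / complex_of_real e - T s h z
      = T s (\<lambda>z. (T e f z - f z) / complex_of_real e - h z) z"
proof -
  note S = semigroup_operator[OF T s]
  have Tef: "T e f \<in> l2 M" using semigroup_l2[OF T _ f] e by simp
  have d: "(\<lambda>z. T e f z - f z) \<in> l2 M" by (rule l2_diff[OF Tef f])
  have q: "(\<lambda>z. inverse (complex_of_real e) * (T e f z - f z)) \<in> l2 M" by (rule l2_scale[OF d])
  have "AE z in M. T (s + e) f z = T s (T e f) z" "AE z in M. T (e + s) f z = T e (T s f) z"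
    using s e f by (auto intro!: semigroup_add[OF T])
  moreover have "AE z in M. T s (\<lambda>z. inverse (complex_of_real e) * (T e f z - f z) - h z) z
      = T s (\<lambda>z. inverse (complex_of_real e) * (T e f z - f z)) z - T s h z"
    by (rule bounded_operator_diff[OF S q h])
  moreover have "AE z in M. T s (\<lambda>z. inverse (complex_of_real e) * (T e f z - f z)) z
      = inverse (complex_of_real e) * T s (\<lambda>z. T e f z - f z) z"
    by (rule bounded_operator_scale[OF S d])
  moreover have "AE z in M. T s (\<lambda>z. T e f z - f z) z = T s (T e f) z - T s f z"
    by (rule bounded_operator_diff[OF S Tef f])
  ultimately show ?thesis
    by eventually_elim (simp add: divide_inverse add.commute mult.commute)
qed

lemma generator_difference_quotient_norm:
  assumes T: "c0_semigroup M T" and f: "f \<in> l2 M" and h: "h \<in> l2 M" and s: "0 \<le> s" and e: "0 < e"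
  shows "l2_norm M (\<lambda>z. (T e (T s f) z - T s f z) / complex_of_real e - T s h z)
      = l2_norm M (T s (\<lambda>z. (T e f z - f z) / complex_of_real e - h z))"
  by (rule l2_norm_AE_cong[OF _ _ generator_difference_quotient[OF assms]])
    (rule l2_measurable semigroup_l2[OF T] l2_diff l2_divide f h s less_imp_le[OF e])+

lemma generator_semigroup:
  assumes T: "c0_semigroup M T" and g: "generator M T f h" and s: "0 \<le> s"
  shows "generator M T (T s f) (T s h)"
proof -
  note f = generator_l2(1)[OF g] and h = generator_l2(2)[OF g]
  obtain K where K: "0 \<le> K" "\<And>r f. 0 \<le> r \<Longrightarrow> r \<le> s \<Longrightarrow> f \<in> l2 M \<Longrightarrow> l2_norm M (T r f) \<le> K * l2_norm M f"
    by (rule semigroup_locally_bounded[OF T]) (rule that)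
  let ?q = "\<lambda>e z. (T e f z - f z) / complex_of_real e - h z"
  let ?Q = "\<lambda>e z. (T e (T s f) z - T s f z) / complex_of_real e - T s h z"
  have "((\<lambda>e. l2_norm M (?q e)) \<longlongrightarrow> 0) (at_right 0)"
    using g by (simp add: generator_def)
  then have lim: "((\<lambda>e. K * l2_norm M (?q e)) \<longlongrightarrow> 0) (at_right 0)"
    by (rule tendsto_mult_right_zero)
  have le: "l2_norm M (?Q e) \<le> K * l2_norm M (?q e)" if e: "0 < e" for e
  proof -
    have "?q e \<in> l2 M"
      by (rule semigroup_l2[OF T] l2_diff l2_divide f h less_imp_le[OF e])+
    then have "l2_norm M (T s (?q e)) \<le> K * l2_norm M (?q e)" using K(2) s by blast
    then show ?thesis unfolding generator_difference_quotient_norm[OF T f h s e] .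
  qed
  have "((\<lambda>e. l2_norm M (?Q e)) \<longlongrightarrow> 0) (at_right 0)"
  proof (rule tendsto_sandwich[OF _ _ tendsto_const lim])
    show "\<forall>\<^sub>F e in at_right 0. 0 \<le> l2_norm M (?Q e)" by simp
    show "\<forall>\<^sub>F e in at_right 0. l2_norm M (?Q e) \<le> K * l2_norm M (?q e)"
      using le by (auto simp: eventually_at_filter)
  qed
  then show ?thesis
    unfolding generator_def using semigroup_l2[OF T s] f h by blast
qed

text \<open>
  Let \<open>p\<close> be a multiplier that intertwines the generator with its adjoint in the sense of the
  hypothesis \<open>sym\<close>. Formally \<open>s \<mapsto> \<langle>p T(t - s) f, T(s) g\<rangle>\<close> has derivative zero. Instead of
  differentiating, divide \<open>[0, t]\<close> into \<open>n\<close> steps of length \<open>e = t / n\<close>: each of them changes the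
  value by \<open>o(e)\<close>, uniformly in its position because \<open>T\<close> is bounded on \<open>[0, t]\<close>, and the sum of
  all changes is \<open>o(1)\<close>. This uses nothing but right derivatives at time \<open>0\<close>.
\<close>

lemma semigroup_intertwines_on_domain:
  assumes T: "c0_semigroup M T"
    and p: "p \<in> borel_measurable M" "\<And>z. cmod (p z) \<le> 1"
    and sym: "\<And>f h g k. generator M T f h \<Longrightarrow> generator M T g k \<Longrightarrow>
      l2_inner M (\<lambda>z. p z * h z) g = l2_inner M (\<lambda>z. p z * f z) k"
    and fh: "generator M T f h" and gk: "generator M T g k" and t: "0 \<le> t"
  shows "l2_inner M (\<lambda>z. p z * T t f z) g = l2_inner M (\<lambda>z. p z * f z) (T t g)"
proof (cases "t = 0")
  case True
  note f = generator_l2(1)[OF fh] and g = generator_l2(1)[OF gk]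
  have "AE z in M. p z * T 0 f z = p z * f z" using semigroup_zero[OF T f] by eventually_elim simp
  then have "l2_inner M (\<lambda>z. p z * T 0 f z) g = l2_inner M (\<lambda>z. p z * f z) g"
    by (intro l2_inner_AE_cong) (rule l2_mult_bounded[OF _ p] semigroup_l2[OF T] f g order_refl | simp)+
  also have "\<dots> = l2_inner M (\<lambda>z. p z * f z) (T 0 g)"
  proof (rule l2_inner_AE_cong)
    show "AE z in M. g z = T 0 g z" using semigroup_zero[OF T g] by eventually_elim simp
  qed (rule l2_mult_bounded[OF _ p] semigroup_l2[OF T] f g order_refl | simp)+
  finally show ?thesis using True by simp
next
  case False
  then have tpos: "0 < t" using t by simp
  note f = generator_l2(1)[OF fh] and h = generator_l2(2)[OF fh]
    and g = generator_l2(1)[OF gk] and k = generator_l2(2)[OF gk]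
  obtain K where K: "0 \<le> K" "\<And>r f. 0 \<le> r \<Longrightarrow> r \<le> t \<Longrightarrow> f \<in> l2 M \<Longrightarrow> l2_norm M (T r f) \<le> K * l2_norm M f"
    by (rule semigroup_locally_bounded[OF T]) (rule that)
  define F where "F s = l2_inner M (\<lambda>z. p z * T (t - s) f z) (T s g)" for s
  define \<rho> where "\<rho> f h e = l2_norm M (\<lambda>z. (T e f z - f z) / complex_of_real e - h z)" for f h and e :: real
  define R where "R e = K\<^sup>2 * (l2_norm M f * \<rho> g k e + l2_norm M g * \<rho> f h e)" for e
  have pl2: "(\<lambda>z. p z * u z) \<in> l2 M" if "u \<in> l2 M" for u
    by (rule l2_mult_bounded[OF that p])
  have pnorm: "l2_norm M (\<lambda>z. p z * u z) \<le> l2_norm M u" if "u \<in> l2 M" for u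
    using l2_norm_mono[OF l2_measurable[OF pl2[OF that]] that, of 1] p(2)
    by (simp add: norm_mult mult_left_le_one_le)
  have step: "cmod (F (s + e) - F s) \<le> e * R e" if s: "0 \<le> s" and e: "0 < e" and se: "s + e \<le> t" for s e
  proof -
    define r where "r = t - s - e"
    have r: "0 \<le> r" "r \<le> t" "t - (s + e) = r" "t - s = e + r" "s \<le> t" using s e se by (auto simp: r_def)
    define a a' b b' where "a = T r f" and "a' = T r h" and "b = T s g" and "b' = T s k"
    have ga: "generator M T a a'" and gb: "generator M T b b'"
      unfolding a_def a'_def b_def b'_def
      using generator_semigroup[OF T fh r(1)] generator_semigroup[OF T gk s] .
    note a = generator_l2(1)[OF ga] and a' = generator_l2(2)[OF ga]
      and b = generator_l2(1)[OF gb] and b' = generator_l2(2)[OF gb]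
    note e0 = less_imp_le[OF e]
    define ra rb where "ra = (\<lambda>z. (T e a z - a z) / complex_of_real e - a' z)"
      and "rb = (\<lambda>z. (T e b z - b z) / complex_of_real e - b' z)"
    have Ta: "T e a \<in> l2 M" and Tb: "T e b \<in> l2 M" by (rule semigroup_l2[OF T e0 a] semigroup_l2[OF T e0 b])+
    have ral: "ra \<in> l2 M" and rbl: "rb \<in> l2 M"
      unfolding ra_def rb_def by (rule l2_diff l2_divide a a' b b' Ta Tb)+
    have quot: "\<rho> u v e = l2_norm M (\<lambda>z. (T e u z - u z) / complex_of_real e - v z)" for u v
      by (simp add: \<rho>_def)
    have bound: "l2_norm M (\<lambda>z. (T e (T q u) z - T q u z) / complex_of_real e - T q v z) \<le> K * \<rho> u v e"
      if "u \<in> l2 M" "v \<in> l2 M" "0 \<le> q" "q \<le> t" for u v q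
    proof -
      have "(\<lambda>z. (T e u z - u z) / complex_of_real e - v z) \<in> l2 M"
        by (rule l2_diff l2_divide semigroup_l2[OF T] e0 that)+
      then show ?thesis
        unfolding generator_difference_quotient_norm[OF T that(1,2,3) e] quot using K(2)[OF that(3,4)] by blast
    qed
    have ran: "l2_norm M ra \<le> K * \<rho> f h e"
      unfolding ra_def a_def a'_def by (rule bound[OF f h r(1,2)])
    have rbn: "l2_norm M rb \<le> K * \<rho> g k e"
      unfolding rb_def b_def b'_def by (rule bound[OF g k s r(5)])
    have an: "l2_norm M a \<le> K * l2_norm M f" and bn: "l2_norm M b \<le> K * l2_norm M g"
      unfolding a_def b_def using K(2)[OF r(1,2) f] K(2)[OF s r(5) g] .
    have F1: "F (s + e) = l2_inner M (\<lambda>z. p z * a z) (T e b)"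
      unfolding F_def r(3) a_def[symmetric]
    proof (rule l2_inner_AE_cong)
      show "AE z in M. T (s + e) g z = T e b z"
        using semigroup_add[OF T e0 s g] by (simp add: b_def add.commute)
      show "T (s + e) g \<in> l2 M" by (rule semigroup_l2[OF T _ g]) (use s e in simp)
    qed (rule pl2 a Tb | simp)+
    have F0: "F s = l2_inner M (\<lambda>z. p z * T e a z) b"
      unfolding F_def r(4) b_def[symmetric]
    proof (rule l2_inner_AE_cong)
      show "AE z in M. p z * T (e + r) f z = p z * T e a z"
        using semigroup_add[OF T e0 r(1) f] by eventually_elim (simp add: a_def)
      show "(\<lambda>z. p z * T (e + r) f z) \<in> l2 M"
        by (intro pl2 semigroup_l2[OF T _ f]) (use r e in simp)
    qed (rule pl2 b Ta | simp)+
    let ?e = "complex_of_real e"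
    have "l2_inner M (\<lambda>z. p z * a z) rb
        = (l2_inner M (\<lambda>z. p z * a z) (T e b) - l2_inner M (\<lambda>z. p z * a z) b) / ?e
          - l2_inner M (\<lambda>z. p z * a z) b'"
    proof -
      have "l2_inner M (\<lambda>z. p z * a z) (\<lambda>z. (T e b z - b z) / ?e)
          = l2_inner M (\<lambda>z. p z * a z) (\<lambda>z. T e b z - b z) / ?e"
        unfolding l2_inner_def by simp
      then show ?thesis
        unfolding rb_def l2_inner_diff_right[OF l2_divide[OF l2_diff[OF Tb b]] b' pl2[OF a]]
        by (simp add: l2_inner_diff_right[OF Tb b pl2[OF a]])
    qed
    moreover have "l2_inner M (\<lambda>z. p z * ra z) b
        = (l2_inner M (\<lambda>z. p z * T e a z) b - l2_inner M (\<lambda>z. p z * a z) b) / ?e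
          - l2_inner M (\<lambda>z. p z * a' z) b"
    proof -
      have "l2_inner M (\<lambda>z. p z * ra z) b
          = l2_inner M (\<lambda>z. inverse ?e * (p z * T e a z - p z * a z) - p z * a' z) b"
        by (rule arg_cong[where f="\<lambda>u. l2_inner M u b"]) (simp add: ra_def divide_inverse algebra_simps fun_eq_iff)
      also have "\<dots> = inverse ?e * (l2_inner M (\<lambda>z. p z * T e a z) b - l2_inner M (\<lambda>z. p z * a z) b)
          - l2_inner M (\<lambda>z. p z * a' z) b"
        unfolding l2_inner_diff_left[OF l2_scale[OF l2_diff[OF pl2[OF Ta] pl2[OF a]]] pl2[OF a'] b]
          l2_inner_scale_left l2_inner_diff_left[OF pl2[OF Ta] pl2[OF a] b] ..
      finally show ?thesis by (simp add: divide_inverse mult.commute)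
    qed
    ultimately have "l2_inner M (\<lambda>z. p z * a z) rb - l2_inner M (\<lambda>z. p z * ra z) b = (F (s + e) - F s) / ?e"
      using sym[OF ga gb] unfolding F0 F1 by (simp add: diff_divide_distrib)
    then have "F (s + e) - F s = ?e * (l2_inner M (\<lambda>z. p z * a z) rb - l2_inner M (\<lambda>z. p z * ra z) b)"
      using e by simp
    then have "cmod (F (s + e) - F s)
        = e * cmod (l2_inner M (\<lambda>z. p z * a z) rb - l2_inner M (\<lambda>z. p z * ra z) b)"
      using e by (simp add: norm_mult)
    also have "\<dots> \<le> e * R e"
    proof (rule mult_left_mono[OF _ e0])
      have "cmod (l2_inner M (\<lambda>z. p z * a z) rb) \<le> l2_norm M (\<lambda>z. p z * a z) * l2_norm M rb"
        by (rule l2_Cauchy_Schwarz[OF pl2[OF a] rbl])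
      also have "\<dots> \<le> (K * l2_norm M f) * (K * \<rho> g k e)"
        using pnorm[OF a] an rbn K(1) by (intro mult_mono) (auto simp: \<rho>_def)
      finally have 1: "cmod (l2_inner M (\<lambda>z. p z * a z) rb) \<le> (K * l2_norm M f) * (K * \<rho> g k e)" .
      have "cmod (l2_inner M (\<lambda>z. p z * ra z) b) \<le> l2_norm M (\<lambda>z. p z * ra z) * l2_norm M b"
        by (rule l2_Cauchy_Schwarz[OF pl2[OF ral] b])
      also have "\<dots> \<le> (K * \<rho> f h e) * (K * l2_norm M g)"
        using pnorm[OF ral] ran bn K(1) by (intro mult_mono) (auto simp: \<rho>_def)
      finally have 2: "cmod (l2_inner M (\<lambda>z. p z * ra z) b) \<le> (K * \<rho> f h e) * (K * l2_norm M g)" .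
      have "R e = (K * l2_norm M f) * (K * \<rho> g k e) + (K * \<rho> f h e) * (K * l2_norm M g)"
        by (simp add: R_def power2_eq_square algebra_simps)
      with 1 2 show "cmod (l2_inner M (\<lambda>z. p z * a z) rb - l2_inner M (\<lambda>z. p z * ra z) b) \<le> R e"
        using norm_triangle_ineq4[of "l2_inner M (\<lambda>z. p z * a z) rb" "l2_inner M (\<lambda>z. p z * ra z) b"]
        by linarith
    qed
    finally show ?thesis .
  qed
  have tele: "cmod (F t - F 0) \<le> t * R (t / real (Suc n))" for n
  proof -
    define e where "e = t / real (Suc n)"
    have e: "0 < e" "real (Suc n) * e = t" using tpos by (auto simp: e_def)
    have "cmod (F (real m * e) - F 0) \<le> real m * (e * R e)" if "m \<le> Suc n" for m
      using that
    proof (induction m)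
      case (Suc m)
      have sum: "real m * e + e = real (Suc m) * e" by (simp add: algebra_simps)
      have "real (Suc m) * e \<le> real (Suc n) * e" using Suc.prems e by (intro mult_right_mono) auto
      then have "cmod (F (real (Suc m) * e) - F (real m * e)) \<le> e * R e"
        using step[of "real m * e" e] e(1) unfolding sum e(2) by simp
      moreover have "cmod (F (real m * e) - F 0) \<le> real m * (e * R e)" using Suc by simp
      moreover have "cmod (F (real (Suc m) * e) - F 0)
          \<le> cmod (F (real (Suc m) * e) - F (real m * e)) + cmod (F (real m * e) - F 0)"
        using norm_triangle_ineq[of "F (real (Suc m) * e) - F (real m * e)" "F (real m * e) - F 0"] by simp
      moreover have "real (Suc m) * (e * R e) = real m * (e * R e) + e * R e" by (simp add: algebra_simps)
      ultimately show ?case by linarith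
    qed simp
    from this[of "Suc n"] have "cmod (F t - F 0) \<le> real (Suc n) * (e * R e)" unfolding e(2) by simp
    also have "\<dots> = t * R e" unfolding mult.assoc[symmetric] e(2) ..
    finally show ?thesis unfolding e_def .
  qed
  have "(\<lambda>n. t / real (Suc n)) \<longlonglongrightarrow> 0"
    using tendsto_mult_right_zero[OF LIMSEQ_inverse_real_of_nat, of t] by (simp add: divide_inverse)
  then have fl: "filterlim (\<lambda>n. t / real (Suc n)) (at_right 0) sequentially"
  proof -
    assume lim: "(\<lambda>n. t / real (Suc n)) \<longlonglongrightarrow> 0"
    have "t / real (Suc n) \<in> {0<..} \<and> t / real (Suc n) \<noteq> 0" for n using tpos by simp
    then show ?thesis using lim by (simp add: filterlim_at)
  qed
  have "(\<rho> f h \<longlongrightarrow> 0) (at_right 0)" "(\<rho> g k \<longlongrightarrow> 0) (at_right 0)"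
    using fh gk by (auto simp: generator_def \<rho>_def[abs_def])
  then have "((\<lambda>e. t * R e) \<longlongrightarrow> t * (K\<^sup>2 * (l2_norm M f * 0 + l2_norm M g * 0))) (at_right 0)"
    unfolding R_def by (intro tendsto_intros)
  from filterlim_compose[OF this fl]
  have "(\<lambda>n. t * R (t / real (Suc n))) \<longlonglongrightarrow> 0" by simp
  then have "cmod (F t - F 0) \<le> 0"
    by (rule tendsto_lowerbound) (use tele in auto)
  then have eq: "F t = F 0" by simp
  have Tt: "T t f \<in> l2 M" "T t g \<in> l2 M" by (rule semigroup_l2[OF T t] f g)+
  have "F t = l2_inner M (\<lambda>z. p z * f z) (T t g)"
    unfolding F_def
  proof (rule l2_inner_AE_cong)
    show "AE z in M. p z * T (t - t) f z = p z * f z" using semigroup_zero[OF T f] by eventually_elim simp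
    show "(\<lambda>z. p z * T (t - t) f z) \<in> l2 M" by (intro pl2 semigroup_l2[OF T _ f]) simp
  qed (rule pl2 f Tt | simp)+
  moreover have "F 0 = l2_inner M (\<lambda>z. p z * T t f z) g"
    unfolding F_def diff_zero
  proof (rule l2_inner_AE_cong)
    show "AE z in M. T 0 g z = g z" by (rule semigroup_zero[OF T g])
    show "T 0 g \<in> l2 M" by (rule semigroup_l2[OF T _ g]) simp
  qed (rule pl2 Tt g | simp)+
  ultimately show ?thesis using eq by simp
qed

text \<open>
  Both sides depend continuously on \<open>f\<close> and \<open>g\<close>, so it suffices to know the identity on the dense domain
  of the generator.
\<close>

lemma semigroup_intertwines:
  assumes T: "c0_semigroup M T"
    and p: "p \<in> borel_measurable M" "\<And>z. cmod (p z) \<le> 1"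
    and dense: "\<And>f e. f \<in> l2 M \<Longrightarrow> 0 < e \<Longrightarrow> \<exists>g h. generator M T g h \<and> l2_norm M (\<lambda>z. f z - g z) < e"
    and sym: "\<And>f h g k. generator M T f h \<Longrightarrow> generator M T g k \<Longrightarrow>
      l2_inner M (\<lambda>z. p z * h z) g = l2_inner M (\<lambda>z. p z * f z) k"
    and f: "f \<in> l2 M" and g: "g \<in> l2 M" and t: "0 \<le> t"
  shows "l2_inner M (\<lambda>z. p z * T t f z) g = l2_inner M (\<lambda>z. p z * f z) (T t g)"
proof -
  obtain K where K: "0 \<le> K" "\<And>r f. 0 \<le> r \<Longrightarrow> r \<le> t \<Longrightarrow> f \<in> l2 M \<Longrightarrow> l2_norm M (T r f) \<le> K * l2_norm M f"
    by (rule semigroup_locally_bounded[OF T]) (rule that)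
  note S = semigroup_operator[OF T t] and Tl = semigroup_l2[OF T t]
  have pl2: "(\<lambda>z. p z * u z) \<in> l2 M" if "u \<in> l2 M" for u
    by (rule l2_mult_bounded[OF that p])
  have approx: "\<exists>s k. (\<forall>n::nat. generator M T (s n) (k n)) \<and> (\<lambda>n. l2_norm M (\<lambda>z. s n z - u z)) \<longlonglongrightarrow> 0"
    if u: "u \<in> l2 M" for u
  proof -
    have "\<forall>n::nat. \<exists>g h. generator M T g h \<and> l2_norm M (\<lambda>z. u z - g z) < inverse (real (Suc n))"
      using dense[OF u] by simp
    then obtain s k where s: "\<And>n. generator M T (s n) (k n)" "\<And>n. l2_norm M (\<lambda>z. u z - s n z) < inverse (real (Suc n))"
      by metis
    have "(\<lambda>n. l2_norm M (\<lambda>z. s n z - u z)) \<longlonglongrightarrow> 0"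
      by (rule tendsto_sandwich[OF _ _ tendsto_const LIMSEQ_inverse_real_of_nat])
        (use s(2) in \<open>simp_all add: less_imp_le l2_norm_minus_commute[of M _ u]\<close>)
    then show ?thesis using s(1) by blast
  qed
  have Tconv: "(\<lambda>n. l2_norm M (\<lambda>z. T t (s n) z - T t u z)) \<longlonglongrightarrow> 0"
    if s: "\<And>n. s n \<in> l2 M" and u: "u \<in> l2 M" and conv: "(\<lambda>n. l2_norm M (\<lambda>z. s n z - u z)) \<longlonglongrightarrow> 0" for s u
  proof (rule tendsto_sandwich[OF _ _ tendsto_const tendsto_mult_right_zero[OF conv, of K]])
    show "\<forall>\<^sub>F n in sequentially. l2_norm M (\<lambda>z. T t (s n) z - T t u z) \<le> K * l2_norm M (\<lambda>z. s n z - u z)"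
      using K(2)[OF t order_refl l2_diff[OF s u]] bounded_operator_norm_diff[OF S s u] by simp
  qed simp
  have pconv: "(\<lambda>n. l2_norm M (\<lambda>z. p z * s n z - p z * u z)) \<longlonglongrightarrow> 0"
    if s: "\<And>n. s n \<in> l2 M" and u: "u \<in> l2 M" and conv: "(\<lambda>n. l2_norm M (\<lambda>z. s n z - u z)) \<longlonglongrightarrow> 0" for s u
  proof (rule tendsto_sandwich[OF _ _ tendsto_const conv])
    have "l2_norm M (\<lambda>z. p z * s n z - p z * u z) \<le> 1 * l2_norm M (\<lambda>z. s n z - u z)" for n
      by (rule l2_norm_mono[OF l2_measurable[OF l2_diff[OF pl2[OF s] pl2[OF u]]] l2_diff[OF s u]])
        (use p(2) in \<open>simp_all add: norm_mult mult_left_le_one_le flip: right_diff_distrib\<close>)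
    then show "\<forall>\<^sub>F n in sequentially. l2_norm M (\<lambda>z. p z * s n z - p z * u z) \<le> l2_norm M (\<lambda>z. s n z - u z)"
      by simp
  qed simp
  obtain s k where s: "\<And>n::nat. generator M T (s n) (k n)" "(\<lambda>n. l2_norm M (\<lambda>z. s n z - f z)) \<longlonglongrightarrow> 0"
    using approx[OF f] by blast
  obtain r l where r: "\<And>n::nat. generator M T (r n) (l n)" "(\<lambda>n. l2_norm M (\<lambda>z. r n z - g z)) \<longlonglongrightarrow> 0"
    using approx[OF g] by blast
  note sl = generator_l2(1)[OF s(1)] and rl = generator_l2(1)[OF r(1)]
  have "(\<lambda>n. l2_inner M (\<lambda>z. p z * T t (s n) z) (r n)) \<longlonglongrightarrow> l2_inner M (\<lambda>z. p z * T t f z) g"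
    by (rule l2_inner_tendsto[OF pl2[OF Tl[OF sl]] pl2[OF Tl[OF f]] pconv[OF Tl[OF sl] Tl[OF f] Tconv[OF sl f s(2)]] rl g r(2)])
  moreover have "(\<lambda>n. l2_inner M (\<lambda>z. p z * s n z) (T t (r n))) \<longlonglongrightarrow> l2_inner M (\<lambda>z. p z * f z) (T t g)"
    by (rule l2_inner_tendsto[OF pl2[OF sl] pl2[OF f] pconv[OF sl f s(2)] Tl[OF rl] Tl[OF g] Tconv[OF rl g r(2)]])
  moreover have "l2_inner M (\<lambda>z. p z * T t (s n) z) (r n) = l2_inner M (\<lambda>z. p z * s n z) (T t (r n))" for n
    by (rule semigroup_intertwines_on_domain[OF T p _ s(1) r(1) t]) (rule sym)
  ultimately show ?thesis by (simp only: LIMSEQ_unique)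
qed

lemma l2_indicator_mult: "f \<in> l2 M \<Longrightarrow> \<omega> \<in> sets M \<Longrightarrow> (\<lambda>z. indicator \<omega> z * f z) \<in> l2 M"
  by (rule l2_mult_bounded[where C=1]) (auto simp: indicator_def)

text \<open>
  The part \<open>g\<close> of \<open>T t f\<close> outside \<open>\<omega>\<close> satisfies \<open>\<parallel>g\<parallel>\<^sup>2 = \<langle>p T(t) f, g\<rangle> = \<langle>p f, T(t) g\<rangle> = 0\<close>, where \<open>p\<close> is the
  indicator of the complement of \<open>\<omega>\<close>.
\<close>

lemma invariant_ideal_if_intertwines:
  assumes T: "c0_semigroup M T" and t: "0 \<le> t" and \<omega>: "\<omega> \<in> sets M"
    and inter: "\<And>f g. f \<in> l2 M \<Longrightarrow> g \<in> l2 M \<Longrightarrow>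
      l2_inner M (\<lambda>z. indicator (space M - \<omega>) z * T t f z) g = l2_inner M (\<lambda>z. indicator (space M - \<omega>) z * f z) (T t g)"
  shows "T t ` l2_ideal M \<omega> \<subseteq> l2_ideal M \<omega>"
proof (intro image_subsetI)
  fix f assume "f \<in> l2_ideal M \<omega>"
  then have f: "f \<in> l2 M" and f0: "AE z in M. z \<notin> \<omega> \<longrightarrow> f z = 0" by (auto simp: l2_ideal_def)
  let ?c = "indicator (space M - \<omega>) :: _ \<Rightarrow> complex"
  have c: "space M - \<omega> \<in> sets M" using \<omega> by auto
  note Tf = semigroup_l2[OF T t f]
  define g where "g = (\<lambda>z. ?c z * T t f z)"
  have g: "g \<in> l2 M" unfolding g_def by (rule l2_indicator_mult[OF Tf c])
  have "l2_inner M g g = l2_inner M (\<lambda>z. ?c z * T t f z) g" by (simp add: g_def)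
  also have "\<dots> = l2_inner M (\<lambda>z. ?c z * f z) (T t g)" by (rule inter[OF f g])
  also have "\<dots> = l2_inner M (\<lambda>z. 0) (T t g)"
  proof (rule l2_inner_AE_cong[OF l2_indicator_mult[OF f c] l2_zero semigroup_l2[OF T t g] semigroup_l2[OF T t g]])
    show "AE z in M. ?c z * f z = 0" using f0 by eventually_elim (auto simp: indicator_def)
  qed simp
  also have "\<dots> = 0" by (simp add: l2_inner_def)
  finally have "l2_norm M g = 0" unfolding l2_inner_self by simp
  then have "AE z in M. g z = 0" by (simp add: l2_norm_eq_0_iff[OF g])
  then have "AE z in M. z \<notin> \<omega> \<longrightarrow> T t f z = 0"
    using AE_space by eventually_elim (auto simp: g_def indicator_def split: if_splits)
  with Tf show "T t f \<in> l2_ideal M \<omega>" by (simp add: l2_ideal_def)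
qed

text \<open>
  By self-adjointness, invariance of \<open>L\<^sup>2(\<omega>)\<close> carries over to its orthogonal complement, so the
  semigroup commutes with the orthogonal projection, and hence so does its generator.
\<close>

lemma generator_indicator_if_invariant:
  assumes T: "c0_semigroup M T" and \<omega>: "\<omega> \<in> sets M"
    and self_adjoint: "\<And>t f g. 0 \<le> t \<Longrightarrow> f \<in> l2 M \<Longrightarrow> g \<in> l2 M \<Longrightarrow> l2_inner M (T t f) g = l2_inner M f (T t g)"
    and inv: "\<And>t. 0 \<le> t \<Longrightarrow> T t ` l2_ideal M \<omega> \<subseteq> l2_ideal M \<omega>"
    and gen: "generator M T f h"
  shows "generator M T (\<lambda>z. indicator \<omega> z * f z) (\<lambda>z. indicator \<omega> z * h z)"
proof -
  note f = generator_l2(1)[OF gen] and h = generator_l2(2)[OF gen]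
  let ?w = "indicator \<omega> :: _ \<Rightarrow> complex"
  define P where "P u = (\<lambda>z. ?w z * u z)" for u
  define Q where "Q u = (\<lambda>z. u z - P u z)" for u
  have Pl: "P u \<in> l2 M" if "u \<in> l2 M" for u unfolding P_def by (rule l2_indicator_mult[OF that \<omega>])
  have Ql: "Q u \<in> l2 M" if "u \<in> l2 M" for u unfolding Q_def by (rule l2_diff[OF that Pl[OF that]])
  have Pideal: "P u \<in> l2_ideal M \<omega>" if "u \<in> l2 M" for u
    using Pl[OF that] by (auto simp: l2_ideal_def P_def)
  have TP: "AE z in M. z \<notin> \<omega> \<longrightarrow> T t (P u) z = 0" if "u \<in> l2 M" "0 \<le> t" for u t
  proof -
    have "T t (P u) \<in> l2_ideal M \<omega>" using inv[OF that(2)] Pideal[OF that(1)] by blast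
    then show ?thesis by (simp add: l2_ideal_def)
  qed
  have TQ: "AE z in M. P (T t (Q u)) z = 0" if u: "u \<in> l2 M" and t: "0 \<le> t" for u t
  proof -
    define g where "g = P (T t (Q u))"
    note TQl = semigroup_l2[OF T t Ql[OF u]]
    have g: "g \<in> l2 M" unfolding g_def by (rule Pl[OF TQl])
    have Pg: "P g = g" by (auto simp: g_def P_def indicator_def fun_eq_iff)
    have "l2_inner M g g = l2_inner M (T t (Q u)) g"
      unfolding l2_inner_def
      by (rule Bochner_Integration.integral_cong) (auto simp: g_def P_def indicator_def)
    also have "\<dots> = l2_inner M (Q u) (T t (P g))" unfolding Pg by (rule self_adjoint[OF t Ql[OF u] g])
    also have "\<dots> = (\<integral>z. 0 \<partial>M)"
      unfolding l2_inner_def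
    proof (rule integral_cong_AE)
      show "(\<lambda>z. Q u z * cnj (T t (P g) z)) \<in> borel_measurable M"
        using l2_mult_integrable(1)[OF Ql[OF u] semigroup_l2[OF T t Pl[OF g]]] by (rule borel_measurable_integrable)
      show "AE z in M. Q u z * cnj (T t (P g) z) = 0"
        using TP[OF g t] by eventually_elim (auto simp: Q_def P_def indicator_def)
    qed simp
    finally have "l2_norm M g = 0" unfolding l2_inner_self by simp
    then show ?thesis by (simp add: l2_norm_eq_0_iff[OF g] flip: g_def)
  qed
  have comm: "AE z in M. T t (P f) z = P (T t f) z" if t: "0 \<le> t" for t
  proof -
    have "AE z in M. T t (Q f) z = T t f z - T t (P f) z"
      unfolding Q_def by (rule bounded_operator_diff[OF semigroup_operator[OF T t] f Pl[OF f]])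
    with TQ[OF f t] TP[OF f t] show ?thesis
      by eventually_elim (auto simp: P_def indicator_def split: if_splits)
  qed
  let ?q = "\<lambda>t z. (T t f z - f z) / complex_of_real t - h z"
  let ?r = "\<lambda>t z. (T t (P f) z - P f z) / complex_of_real t - P h z"
  have "((\<lambda>t. l2_norm M (?r t)) \<longlongrightarrow> 0) (at_right 0)"
  proof (rule tendsto_sandwich[OF _ _ tendsto_const])
    show "((\<lambda>t. l2_norm M (?q t)) \<longlongrightarrow> 0) (at_right 0)" using gen by (simp add: generator_def)
    have "l2_norm M (?r t) \<le> l2_norm M (?q t)" if t: "0 < t" for t
    proof -
      note Tf = semigroup_l2[OF T less_imp_le[OF t] f] and TPf = semigroup_l2[OF T less_imp_le[OF t] Pl[OF f]]
      have r: "?r t \<in> borel_measurable M"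
        by (rule l2_measurable[OF l2_diff[OF l2_divide[OF l2_diff[OF TPf Pl[OF f]]] Pl[OF h]]])
      have "AE z in M. cmod (?r t z) \<le> 1 * cmod (?q t z)"
        using comm[OF less_imp_le[OF t]]
        by eventually_elim (auto simp: P_def indicator_def)
      from l2_norm_mono[OF r l2_diff[OF l2_divide[OF l2_diff[OF Tf f]] h] this] show ?thesis by simp
    qed
    then show "\<forall>\<^sub>F t in at_right 0. l2_norm M (?r t) \<le> l2_norm M (?q t)"
      by (auto simp: eventually_at_filter)
  qed simp
  then have "generator M T (P f) (P h)" using Pl f h by (simp add: generator_def)
  then show ?thesis by (simp add: P_def)
qed

lemma generator_linear:
  assumes T: "c0_semigroup M T" and "generator M T f h" "generator M T g k"
  shows "generator M T (\<lambda>z. c * f z + g z) (\<lambda>z. c * h z + k z)"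
proof -
  note f = generator_l2(1)[OF assms(2)] and h = generator_l2(2)[OF assms(2)]
    and g = generator_l2(1)[OF assms(3)] and k = generator_l2(2)[OF assms(3)]
  note cf = l2_scale[OF f, of c] and ch = l2_scale[OF h, of c]
  let ?q = "\<lambda>f h t z. (T t f z - f z) / complex_of_real t - h z"
  let ?f = "\<lambda>z. c * f z + g z" and ?h = "\<lambda>z. c * h z + k z"
  have "((\<lambda>t. l2_norm M (?q ?f ?h t)) \<longlongrightarrow> 0) (at_right 0)"
  proof (rule tendsto_sandwich[OF _ _ tendsto_const])
    show "((\<lambda>t. cmod c * l2_norm M (?q f h t) + l2_norm M (?q g k t)) \<longlongrightarrow> 0) (at_right 0)"
      using assms(2,3) by (intro tendsto_add_zero tendsto_mult_right_zero) (auto simp: generator_def)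
    have "l2_norm M (?q ?f ?h t) \<le> cmod c * l2_norm M (?q f h t) + l2_norm M (?q g k t)" if t: "0 < t" for t
    proof -
      note S = semigroup_operator[OF T less_imp_le[OF t]]
      have l: "?q u v t \<in> l2 M" if "u \<in> l2 M" "v \<in> l2 M" for u v
        by (rule l2_diff[OF l2_divide[OF l2_diff[OF bounded_operator_l2[OF S that(1)] that(1)]] that(2)])
      have "AE z in M. ?q ?f ?h t z = c * ?q f h t z + ?q g k t z"
        using bounded_operator_add[OF S cf g] bounded_operator_scale[OF S f, of c]
        by eventually_elim (simp add: diff_divide_distrib add_divide_distrib right_diff_distrib)
      then have "l2_norm M (?q ?f ?h t) = l2_norm M (\<lambda>z. c * ?q f h t z + ?q g k t z)"
        by (rule l2_norm_AE_cong[OF l2_measurable[OF l[OF l2_add[OF cf g] l2_add[OF ch k]]]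
              l2_measurable[OF l2_add[OF l2_scale[OF l[OF f h]] l[OF g k]]]])
      then show ?thesis
        using l2_norm_triangle[OF l2_scale[OF l[OF f h], of c] l[OF g k]] unfolding l2_norm_scale by simp
    qed
    then show "\<forall>\<^sub>F t in at_right 0. l2_norm M (?q ?f ?h t) \<le> cmod c * l2_norm M (?q f h t) + l2_norm M (?q g k t)"
      by (auto simp: eventually_at_filter)
  qed simp
  then show ?thesis unfolding generator_def using l2_add[OF cf g] l2_add[OF ch k] by blast
qed

section \<open>Smooth cutoff functions\<close>

definition C2 :: "(real \<Rightarrow> real) \<Rightarrow> bool" where
  "C2 f \<longleftrightarrow> (\<exists>f' f''. (\<forall>x. (f has_real_derivative f' x) (at x)) \<and>
     (\<forall>x. (f' has_real_derivative f'' x) (at x)) \<and> continuous_on UNIV f'')"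

lemma C2_deriv:
  assumes "C2 f"
  shows "(f has_real_derivative deriv f x) (at x)"
    and "(deriv f has_real_derivative deriv (deriv f) x) (at x)"
    and "continuous_on UNIV (deriv (deriv f))"
    and "continuous_on UNIV (deriv f)"
    and "continuous_on UNIV f"
proof -
  obtain f' f'' where f: "\<And>x. (f has_real_derivative f' x) (at x)"
    "\<And>x. (f' has_real_derivative f'' x) (at x)" "continuous_on UNIV f''"
    using assms by (auto simp: C2_def)
  have 1: "deriv f = f'" using f(1) by (auto intro!: DERIV_imp_deriv)
  have 2: "deriv f' = f''" using f(2) by (auto intro!: DERIV_imp_deriv)
  show "(f has_real_derivative deriv f x) (at x)" "(deriv f has_real_derivative deriv (deriv f) x) (at x)"
    "continuous_on UNIV (deriv (deriv f))"
    using f unfolding 1 2 by auto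
  show "continuous_on UNIV (deriv f)" unfolding 1 by (rule DERIV_continuous_on[OF DERIV_subset[OF f(2)]]) auto
  show "continuous_on UNIV f" by (rule DERIV_continuous_on[OF DERIV_subset[OF f(1)]]) auto
qed

lemma C2_I:
  assumes "\<And>x. (f has_real_derivative f' x) (at x)" "\<And>x. (f' has_real_derivative f'' x) (at x)"
    "continuous_on UNIV f''"
  shows "C2 f"
  using assms unfolding C2_def by blast

lemma C2_const: "C2 (\<lambda>x. c)"
  by (rule C2_I[of _ "\<lambda>_. 0" "\<lambda>_. 0"]) (auto intro!: derivative_eq_intros)

lemma C2_add:
  assumes "C2 f" "C2 g" shows "C2 (\<lambda>x. f x + g x)"
  by (rule C2_I[of _ "\<lambda>x. deriv f x + deriv g x" "\<lambda>x. deriv (deriv f) x + deriv (deriv g) x"])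
    (intro DERIV_add continuous_intros C2_deriv assms)+

lemma C2_mult:
  assumes "C2 f" "C2 g" shows "C2 (\<lambda>x. f x * g x)"
proof (rule C2_I)
  show "((\<lambda>x. f x * g x) has_real_derivative deriv f x * g x + deriv g x * f x) (at x)" for x
    by (intro DERIV_mult C2_deriv assms)
  show "((\<lambda>x. deriv f x * g x + deriv g x * f x) has_real_derivative
    (deriv (deriv f) x * g x + deriv g x * deriv f x) + (deriv (deriv g) x * f x + deriv f x * deriv g x)) (at x)" for x
    by (intro DERIV_add DERIV_mult C2_deriv assms)
  show "continuous_on UNIV (\<lambda>x. (deriv (deriv f) x * g x + deriv g x * deriv f x) + (deriv (deriv g) x * f x + deriv f x * deriv g x))"
    by (intro continuous_intros C2_deriv assms)
qed

lemma C2_inverse: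
  assumes "C2 f" "\<And>x. f x \<noteq> 0" shows "C2 (\<lambda>x. inverse (f x))"
proof (rule C2_I)
  show "((\<lambda>x. inverse (f x)) has_real_derivative - (deriv f x * inverse (f x * f x))) (at x)" for x
    using DERIV_inverse_fun[OF C2_deriv(1)[OF assms(1)] assms(2), of x] by (simp add: numeral_2_eq_2)
  show "((\<lambda>x. - (deriv f x * inverse (f x * f x))) has_real_derivative
      - (deriv (deriv f) x * inverse (f x * f x) +
        - ((deriv f x * f x + deriv f x * f x) * inverse ((f x * f x) ^ Suc (Suc 0))) * deriv f x)) (at x)" for x
    by (intro DERIV_minus DERIV_mult DERIV_inverse_fun C2_deriv assms(1)) (use assms(2) in simp)
  show "continuous_on UNIV (\<lambda>x. - (deriv (deriv f) x * inverse (f x * f x) +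
        - ((deriv f x * f x + deriv f x * f x) * inverse ((f x * f x) ^ Suc (Suc 0))) * deriv f x))"
    using assms(2) by (intro continuous_intros C2_deriv assms(1)) auto
qed

lemma C2_affine:
  assumes "C2 f" shows "C2 (\<lambda>x. f (a * x + b))"
proof (rule C2_I)
  have aff: "((\<lambda>x. a * x + b) has_real_derivative a) (at x)" for x
    by (auto intro!: derivative_eq_intros)
  show "((\<lambda>x. f (a * x + b)) has_real_derivative deriv f (a * x + b) * a) (at x)" for x
    by (rule DERIV_chain2[OF C2_deriv(1)[OF assms] aff])
  show "((\<lambda>x. deriv f (a * x + b) * a) has_real_derivative deriv (deriv f) (a * x + b) * a * a) (at x)" for x
    by (intro DERIV_cmult_right DERIV_chain2[OF C2_deriv(2)[OF assms] aff])
  have "continuous_on UNIV (\<lambda>x. deriv (deriv f) (a * x + b))"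
    by (rule continuous_on_compose2[OF C2_deriv(3)[OF assms]]) (auto intro!: continuous_intros)
  then show "continuous_on UNIV (\<lambda>x. deriv (deriv f) (a * x + b) * a * a)"
    by (intro continuous_intros)
qed

lemma DERIV_truncated_power:
  "((\<lambda>x::real. max 0 x ^ Suc (Suc n)) has_real_derivative real (Suc (Suc n)) * max 0 x ^ Suc n) (at x)"
proof -
  consider "x > 0" | "x < 0" | "x = 0" by linarith
  then show ?thesis
  proof cases
    case 1
    have "((\<lambda>x. x ^ Suc (Suc n)) has_real_derivative real (Suc (Suc n)) * max 0 x ^ Suc n) (at x)"
      using 1 by (auto intro!: derivative_eq_intros simp del: power_Suc)
    then show ?thesis
      by (rule has_field_derivative_transform_within_open[of _ _ _ "{0<..}"]) (use 1 in auto)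
  next
    case 2
    have "((\<lambda>x. 0) has_real_derivative real (Suc (Suc n)) * max 0 x ^ Suc n) (at x)"
      using 2 by (auto simp: max_def)
    then show ?thesis
      by (rule has_field_derivative_transform_within_open[of _ _ _ "{..<0}"]) (use 2 in \<open>auto simp: max_def\<close>)
  next
    case 3
    have "((\<lambda>h::real. max 0 h ^ Suc n) \<longlongrightarrow> max 0 0 ^ Suc n) (at 0)"
      by (intro tendsto_intros)
    moreover have "\<forall>\<^sub>F h::real in at 0. max 0 h ^ Suc n = (max 0 (0 + h) ^ Suc (Suc n) - max 0 0 ^ Suc (Suc n)) / h"
      by (auto simp: eventually_at_filter max_def)
    ultimately show ?thesis unfolding 3 DERIV_def by (auto elim: Lim_transform_eventually)
  qed
qed

text \<open>
  Rises from \<open>0\<close> to \<open>1\<close> on \<open>[0, 1]\<close>. The cube is the smallest power whose truncation at \<open>0\<close> is twice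
  continuously differentiable.
\<close>

definition smooth_step :: "real \<Rightarrow> real" where
  "smooth_step x = max 0 x ^ 3 * inverse (max 0 x ^ 3 + max 0 (1 - x) ^ 3)"

lemma C2_truncated_cube: "C2 (\<lambda>x. max 0 x ^ 3)"
proof (rule C2_I)
  show "((\<lambda>x. max 0 x ^ 3) has_real_derivative 3 * max 0 x ^ 2) (at x)" for x :: real
    using DERIV_truncated_power[of 1 x] by (simp add: eval_nat_numeral)
  show "((\<lambda>x. 3 * max 0 x ^ 2) has_real_derivative 3 * (2 * max 0 x)) (at x)" for x :: real
    using DERIV_cmult[OF DERIV_truncated_power[of 0 x], of 3] by (simp add: eval_nat_numeral)
  show "continuous_on UNIV (\<lambda>x::real. 3 * (2 * max 0 x))" by (intro continuous_intros)
qed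

lemma smooth_step_denominator: "0 < max 0 x ^ 3 + max 0 (1 - x) ^ 3" for x :: real
  by (cases "x > 0") (auto intro: add_pos_nonneg add_nonneg_pos)

lemma C2_smooth_step: "C2 smooth_step"
proof -
  have "C2 (\<lambda>x. max 0 (1 - x) ^ 3)"
    using C2_affine[OF C2_truncated_cube, of "-1" 1] by simp
  then show ?thesis unfolding smooth_step_def[abs_def]
    by (intro C2_mult C2_inverse C2_add C2_truncated_cube) (use smooth_step_denominator in \<open>auto simp: less_le\<close>)
qed

lemma smooth_step_0: "x \<le> 0 \<Longrightarrow> smooth_step x = 0"
  by (simp add: smooth_step_def max_def)

lemma smooth_step_1: "1 \<le> x \<Longrightarrow> smooth_step x = 1"
  by (simp add: smooth_step_def max_def)

lemma smooth_step_bounds: "0 \<le> smooth_step x" "smooth_step x \<le> 1"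
  using smooth_step_denominator[of x] by (auto simp: smooth_step_def field_simps)

lemma deriv_eq_0_if_locally_const:
  assumes "open S" "x \<in> S" "\<And>y. y \<in> S \<Longrightarrow> f y = (c::real)"
  shows "deriv f x = 0"
proof -
  have "((\<lambda>_. c) has_real_derivative 0) (at x)" by simp
  then have "(f has_real_derivative 0) (at x)"
    by (rule has_field_derivative_transform_within_open[OF _ assms(1,2)]) (use assms(3) in simp)
  then show ?thesis by (rule DERIV_imp_deriv)
qed

lemma test_functionI:
  assumes "\<And>x. (f has_real_derivative f' x) (at x)" "continuous_on UNIV f'"
    and "0 < a" "b < 1" "\<And>x. x \<notin> {a..b} \<Longrightarrow> f x = 0"
  shows "test_function f"
  unfolding test_function_def C1_differentiable_on_def
  using assms by (auto simp: has_real_derivative_iff_has_vector_derivative)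

lemma test_function_C2:
  assumes "C2 f" "0 < a" "b < 1" "\<And>x. x \<notin> {a..b} \<Longrightarrow> f x = 0"
  shows "test_function f"
  by (rule test_functionI[OF C2_deriv(1,4)[OF assms(1)] assms(2-4)])

lemma test_function_deriv_C2:
  assumes "C2 f" "0 < a" "a \<le> b" "b < 1" "\<And>x. x < a \<Longrightarrow> f x = c" "\<And>x. b < x \<Longrightarrow> f x = d"
  shows "test_function (deriv f)"
proof (rule test_functionI[OF C2_deriv(2,3)[OF assms(1)] assms(2,4)])
  fix x assume "x \<notin> {a..b}"
  then consider "x < a" | "b < x" using assms(3) by fastforce
  then show "deriv f x = 0"
  proof cases
    case 1 then show ?thesis
      by (intro deriv_eq_0_if_locally_const[of "{..<a}" x f c]) (use assms(5) in auto)
  next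
    case 2 then show ?thesis
      by (intro deriv_eq_0_if_locally_const[of "{b<..}" x f d]) (use assms(6) in auto)
  qed
qed

lemma test_function_DERIV:
  assumes "test_function \<phi>"
  shows "(\<phi> has_real_derivative deriv \<phi> x) (at x)" "continuous_on UNIV (deriv \<phi>)" "continuous_on UNIV \<phi>"
    "\<phi> 0 = 0" "\<phi> 1 = 0"
proof -
  obtain D where D: "\<And>x. (\<phi> has_real_derivative D x) (at x)" "continuous_on UNIV D"
    using assms unfolding test_function_def C1_differentiable_on_def
    by (auto simp: has_real_derivative_iff_has_vector_derivative)
  have "deriv \<phi> = D" using D(1) by (auto intro!: DERIV_imp_deriv)
  then show "(\<phi> has_real_derivative deriv \<phi> x) (at x)" "continuous_on UNIV (deriv \<phi>)"
    using D by auto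
  show "continuous_on UNIV \<phi>" by (rule DERIV_continuous_on[OF DERIV_subset[OF D(1)]]) auto
  show "\<phi> 0 = 0" "\<phi> 1 = 0" using assms by (auto simp: test_function_def)
qed

text \<open>
  For \<open>\<delta> > 0\<close> this is \<open>1\<close> on \<open>[a + 2 \<delta>, b - 2 \<delta>]\<close> and vanishes outside \<open>[a + \<delta>, b - \<delta>]\<close>. The margin
  \<open>\<delta>\<close> makes it a test function even for \<open>a = 0\<close> and \<open>b = 1\<close>.
\<close>

definition plateau :: "real \<Rightarrow> real \<Rightarrow> real \<Rightarrow> real \<Rightarrow> real" where
  "plateau a b \<delta> x = smooth_step ((x - a) / \<delta> - 1) * smooth_step ((b - x) / \<delta> - 1)"

lemma C2_plateau: "C2 (plateau a b \<delta>)"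
proof -
  have "C2 (\<lambda>x. smooth_step (inverse \<delta> * x + (- a / \<delta> - 1)) * smooth_step (- inverse \<delta> * x + (b / \<delta> - 1)))"
    by (intro C2_mult C2_affine C2_smooth_step)
  also have "(\<lambda>x. smooth_step (inverse \<delta> * x + (- a / \<delta> - 1)) * smooth_step (- inverse \<delta> * x + (b / \<delta> - 1))) = plateau a b \<delta>"
    by (simp add: plateau_def fun_eq_iff divide_inverse algebra_simps)
  finally show ?thesis .
qed

lemma plateau_bounds: "0 \<le> plateau a b \<delta> x" "plateau a b \<delta> x \<le> 1"
  using smooth_step_bounds[of "(x - a) / \<delta> - 1"] smooth_step_bounds[of "(b - x) / \<delta> - 1"]
  by (auto simp: plateau_def mult_le_one)

lemma plateau_eq_1: "0 < \<delta> \<Longrightarrow> a + 2 * \<delta> \<le> x \<Longrightarrow> x \<le> b - 2 * \<delta> \<Longrightarrow> plateau a b \<delta> x = 1"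
  by (simp add: plateau_def smooth_step_1 field_simps)

lemma plateau_eq_0: "0 < \<delta> \<Longrightarrow> x \<le> a + \<delta> \<or> b - \<delta> \<le> x \<Longrightarrow> plateau a b \<delta> x = 0"
  by (auto simp: plateau_def smooth_step_0 field_simps)

lemma plateau_test_functions:
  assumes "0 \<le> a" "b \<le> 1" "0 < \<delta>"
  shows "test_function (plateau a b \<delta>)" "test_function (deriv (plateau a b \<delta>))"
proof -
  show "test_function (plateau a b \<delta>)"
    by (rule test_function_C2[OF C2_plateau, of "a + \<delta>" "b - \<delta>"]) (use assms in \<open>auto intro!: plateau_eq_0\<close>)
  define m where "m = min (a + \<delta>) (1/2)"
  define m' where "m' = max (b - \<delta>) (1/2)"
  show "test_function (deriv (plateau a b \<delta>))"
    by (rule test_function_deriv_C2[OF C2_plateau, of m m' _ _ _ 0 0])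
      (use assms in \<open>auto intro!: plateau_eq_0 simp: m_def m'_def\<close>)
qed

text \<open>A cutoff that is \<open>1\<close> near the initial point of an edge and \<open>0\<close> near its terminal point.\<close>

definition cutoff :: "real \<Rightarrow> real" where
  "cutoff x = smooth_step (2 - 3 * x)"

lemma C2_cutoff: "C2 cutoff"
  using C2_affine[OF C2_smooth_step, of "-3" 2] by (simp add: cutoff_def[abs_def])

lemma cutoff_eq_1: "x \<le> 1/3 \<Longrightarrow> cutoff x = 1"
  by (simp add: cutoff_def smooth_step_1)

lemma cutoff_eq_0: "2/3 \<le> x \<Longrightarrow> cutoff x = 0"
  by (simp add: cutoff_def smooth_step_0)

lemma cutoff_bounds: "0 \<le> cutoff x" "cutoff x \<le> 1"
  by (auto simp: cutoff_def smooth_step_bounds)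

section \<open>The measure of a graph\<close>

abbreviation unit_interval :: "real measure" where
  "unit_interval \<equiv> lebesgue_on {0..1}"

lemma finite_measure_unit_interval: "finite_measure unit_interval"
  by (rule finite_measure_lebesgue_on) simp

lemma sigma_finite_unit_interval: "sigma_finite_measure unit_interval"
  using finite_measure_unit_interval by (simp add: finite_measure_def)

lemma pair_sigma_finite_edges:
  assumes "countable A"
  shows "pair_sigma_finite (count_space A) unit_interval"
  unfolding pair_sigma_finite_def
  using sigma_finite_measure_count_space_countable[OF assms] sigma_finite_unit_interval by simp

lemma space_edge_measure: "space (edge_measure G) = arcs G \<times> {0..1}"
  by (simp add: edge_measure_def space_pair_measure)

lemma edge_measurable_iff:
  assumes "countable (arcs G)"
  shows "f \<in> measurable (edge_measure G) N \<longleftrightarrow> (\<forall>e\<in>arcs G. (\<lambda>x. f (e, x)) \<in> measurable unit_interval N)"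
proof
  assume "f \<in> measurable (edge_measure G) N"
  then show "\<forall>e\<in>arcs G. (\<lambda>x. f (e, x)) \<in> measurable unit_interval N"
    unfolding edge_measure_def by (auto intro: measurable_Pair2)
next
  assume "\<forall>e\<in>arcs G. (\<lambda>x. f (e, x)) \<in> measurable unit_interval N"
  then show "f \<in> measurable (edge_measure G) N"
    unfolding edge_measure_def by (intro measurable_pair_measure_countable1 assms) simp
qed

lemma AE_edge_measure:
  assumes "countable (arcs G)" "AE z in edge_measure G. P z" "e \<in> arcs G"
  shows "AE x in unit_interval. P (e, x)"
proof -
  interpret pair_sigma_finite "count_space (arcs G)" unit_interval by (rule pair_sigma_finite_edges[OF assms(1)])
  show ?thesis using AE_pair[OF assms(2)[unfolded edge_measure_def]] assms(3) by (simp add: AE_count_space)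
qed

lemma edge_integrable_section:
  fixes F :: "'e \<times> real \<Rightarrow> 'b::{banach, second_countable_topology}"
  assumes "countable (arcs G)" "integrable (edge_measure G) F" "e \<in> arcs G"
  shows "integrable unit_interval (\<lambda>x. F (e, x))"
proof -
  interpret pair_sigma_finite "count_space (arcs G)" unit_interval by (rule pair_sigma_finite_edges[OF assms(1)])
  show ?thesis using AE_integrable_fst'[OF assms(2)[unfolded edge_measure_def]] assms(3) by (simp add: AE_count_space)
qed

lemma edge_integral:
  fixes F :: "'e \<times> real \<Rightarrow> 'b::{banach, second_countable_topology}"
  assumes "countable (arcs G)" "integrable (edge_measure G) F"
  shows "(\<lambda>e. norm (\<integral>x. F (e, x) \<partial>unit_interval)) summable_on arcs G"
    and "integral\<^sup>L (edge_measure G) F = (\<Sum>\<^sub>\<infinity>e\<in>arcs G. \<integral>x. F (e, x) \<partial>unit_interval)"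
proof -
  interpret pair_sigma_finite "count_space (arcs G)" unit_interval by (rule pair_sigma_finite_edges[OF assms(1)])
  note F = assms(2)[unfolded edge_measure_def]
  have *: "Infinite_Set_Sum.abs_summable_on (\<lambda>e. \<integral>x. F (e, x) \<partial>unit_interval) (arcs G)"
    unfolding Infinite_Set_Sum.abs_summable_on_def by (rule integrable_fst'[OF F])
  then show "(\<lambda>e. norm (\<integral>x. F (e, x) \<partial>unit_interval)) summable_on arcs G"
    by (simp only: abs_summable_equivalent[symmetric])
  show "integral\<^sup>L (edge_measure G) F = (\<Sum>\<^sub>\<infinity>e\<in>arcs G. \<integral>x. F (e, x) \<partial>unit_interval)"
    unfolding edge_measure_def integral_fst'[OF F, symmetric] infsetsum_infsum[OF *, symmetric]
    by (simp add: infsetsum_def)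
qed

lemma edge_integrable_finite:
  fixes F :: "'e \<times> real \<Rightarrow> 'b::{banach, second_countable_topology}"
  assumes "countable (arcs G)" "finite A"
    and "\<And>e. e \<in> arcs G \<Longrightarrow> integrable unit_interval (\<lambda>x. F (e, x))"
    and "\<And>e x. e \<in> arcs G \<Longrightarrow> e \<notin> A \<Longrightarrow> x \<in> {0..1} \<Longrightarrow> F (e, x) = 0"
  shows "integrable (edge_measure G) F"
proof -
  interpret pair_sigma_finite "count_space (arcs G)" unit_interval by (rule pair_sigma_finite_edges[OF assms(1)])
  have meas: "F \<in> borel_measurable (count_space (arcs G) \<Otimes>\<^sub>M unit_interval)"
    using edge_measurable_iff[OF assms(1), of F borel] assms(3)
    by (auto simp: edge_measure_def)
  show ?thesis unfolding edge_measure_def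
  proof (rule Fubini_integrable[OF meas])
    have "(\<integral>x. norm (F (e, x)) \<partial>unit_interval) = 0" if "e \<in> arcs G" "e \<notin> A" for e
    proof -
      have "(\<integral>x. norm (F (e, x)) \<partial>unit_interval) = (\<integral>x. 0 \<partial>unit_interval)"
        by (rule Bochner_Integration.integral_cong) (use assms(4)[OF that] in auto)
      then show ?thesis by simp
    qed
    then have "Infinite_Set_Sum.abs_summable_on (\<lambda>e. \<integral>x. norm (F (e, x)) \<partial>unit_interval) (arcs G) \<longleftrightarrow>
        Infinite_Set_Sum.abs_summable_on (\<lambda>e. \<integral>x. norm (F (e, x)) \<partial>unit_interval) (A \<inter> arcs G)"
      by (intro Infinite_Set_Sum.abs_summable_on_cong_neutral) auto
    then show "integrable (count_space (arcs G)) (\<lambda>e. \<integral>x. norm (F (e, x)) \<partial>unit_interval)"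
      unfolding Infinite_Set_Sum.abs_summable_on_def[symmetric] using assms(2) by simp
    show "AE e in count_space (arcs G). integrable unit_interval (\<lambda>x. F (e, x))"
      using assms(3) by (simp add: AE_count_space)
  qed
qed

lemma l2_edge_section:
  assumes "countable (arcs G)" "f \<in> l2 (edge_measure G)" "e \<in> arcs G"
  shows "(\<lambda>x. f (e, x)) \<in> l2 unit_interval"
  using assms edge_integrable_section[OF assms(1) l2_sq_integrable[OF assms(2)] assms(3)]
    edge_measurable_iff[OF assms(1), of f borel] by (simp add: l2_def)

lemma l2_edge_finite:
  assumes "countable (arcs G)" "finite A"
    and "\<And>e. e \<in> arcs G \<Longrightarrow> (\<lambda>x. f (e, x)) \<in> l2 unit_interval"
    and "\<And>e x. e \<in> arcs G \<Longrightarrow> e \<notin> A \<Longrightarrow> x \<in> {0..1} \<Longrightarrow> f (e, x) = 0"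
  shows "f \<in> l2 (edge_measure G)"
proof -
  have "integrable (edge_measure G) (\<lambda>z. (cmod (f z))\<^sup>2)"
    by (rule edge_integrable_finite[OF assms(1,2)]) (use assms(3,4) in \<open>auto simp: l2_def\<close>)
  then show ?thesis using assms(3) edge_measurable_iff[OF assms(1), of f borel] by (auto simp: l2_def)
qed

lemma l2_unit_interval_bounded:
  assumes "u \<in> borel_measurable unit_interval" "\<And>x. x \<in> {0..1} \<Longrightarrow> cmod (u x) \<le> C"
  shows "u \<in> l2 unit_interval"
proof (rule l2_dominated[OF assms(1)])
  show "integrable unit_interval (\<lambda>x. C\<^sup>2)"
    by (rule finite_measure.integrable_const[OF finite_measure_unit_interval])
  show "AE x in unit_interval. (cmod (u x))\<^sup>2 \<le> C\<^sup>2"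
    using assms(2) by (intro AE_I2) (auto intro!: power_mono)
qed

lemma continuous_measurable_unit_interval:
  fixes u :: "real \<Rightarrow> 'b::euclidean_space"
  assumes "continuous_on {0..1} u" shows "u \<in> borel_measurable unit_interval"
  using continuous_imp_integrable_real[OF assms] by auto

lemma l2_unit_interval_continuous:
  assumes "continuous_on {0..1} u"
  shows "u \<in> l2 unit_interval"
proof -
  have "bounded (u ` {0..1})" by (intro compact_imp_bounded compact_continuous_image assms) auto
  then obtain C where "\<And>x. x \<in> {0..1} \<Longrightarrow> cmod (u x) \<le> C" unfolding bounded_iff by blast
  then show ?thesis by (rule l2_unit_interval_bounded[OF continuous_measurable_unit_interval[OF assms]])
qed

lemma l2_of_real: "continuous_on UNIV k \<Longrightarrow> (\<lambda>x. complex_of_real (k x)) \<in> l2 unit_interval"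
  by (rule l2_unit_interval_continuous[OF continuous_on_of_real[OF continuous_on_subset[OF _ subset_UNIV]]])

lemma l2_norm_edge_section_summable:
  assumes "countable (arcs G)" "f \<in> l2 (edge_measure G)"
  shows "(\<lambda>e. (l2_norm unit_interval (\<lambda>x. f (e, x)))\<^sup>2) summable_on arcs G"
  using edge_integral(1)[OF assms(1) l2_sq_integrable[OF assms(2)]]
  unfolding l2_norm_power2 by simp

definition single_edge :: "'e \<Rightarrow> (real \<Rightarrow> complex) \<Rightarrow> 'e \<times> real \<Rightarrow> complex" where
  "single_edge e u z = (if fst z = e then u (snd z) else 0)"

lemma single_edge_l2:
  assumes "countable (arcs G)" "u \<in> l2 unit_interval"
  shows "single_edge e u \<in> l2 (edge_measure G)"
proof (rule l2_edge_finite[OF assms(1), of "{e}"])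
  show "(\<lambda>x. single_edge e u (e', x)) \<in> l2 unit_interval" for e'
    using assms(2) by (cases "e' = e") (simp_all add: single_edge_def)
qed (simp_all add: single_edge_def)

lemma l2_inner_single_edge:
  assumes c: "countable (arcs G)" and u: "u \<in> l2 unit_interval" and g: "g \<in> l2 (edge_measure G)" and e: "e \<in> arcs G"
  shows "l2_inner (edge_measure G) (single_edge e u) g = (\<integral>x. u x * cnj (g (e, x)) \<partial>unit_interval)"
proof -
  have "l2_inner (edge_measure G) (single_edge e u) g
      = (\<Sum>\<^sub>\<infinity>e'\<in>arcs G. \<integral>x. single_edge e u (e', x) * cnj (g (e', x)) \<partial>unit_interval)"
    unfolding l2_inner_def
    by (rule edge_integral(2)[OF c l2_mult_integrable(1)[OF single_edge_l2[OF c u] g]])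
  also have "\<dots> = (\<Sum>\<^sub>\<infinity>e'\<in>{e}. \<integral>x. single_edge e u (e', x) * cnj (g (e', x)) \<partial>unit_interval)"
    by (rule infsum_cong_neutral) (use e in \<open>auto simp: single_edge_def\<close>)
  also have "\<dots> = (\<integral>x. u x * cnj (g (e, x)) \<partial>unit_interval)" by (simp add: single_edge_def)
  finally show ?thesis .
qed

section \<open>Density of smooth functions\<close>

lemma AE_unit_interval_iff:
  "(AE x in unit_interval. P x) \<longleftrightarrow> (AE x in lebesgue. x \<in> {0..1} \<longrightarrow> P x)"
  by (rule AE_restrict_space_iff) simp

lemma lebesgue_set_AE_borel:
  assumes "B \<in> sets lebesgue"
  obtains S where "S \<in> sets borel" "AE x in lebesgue. x \<in> B \<longleftrightarrow> x \<in> S"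
proof -
  obtain S N N' where *: "B = S \<union> N" "N \<subseteq> N'" "N' \<in> null_sets lborel" "S \<in> sets lborel"
    using assms by (rule sets_completionE)
  have "AE x in lborel. x \<notin> N'" using *(3) by (rule AE_not_in)
  then have "AE x in lebesgue. x \<notin> N'" by (rule AE_completion)
  then have "AE x in lebesgue. x \<in> B \<longleftrightarrow> x \<in> S"
    by eventually_elim (use *(1,2) in auto)
  then show ?thesis using that *(4) by simp
qed

lemma sum_mem_subspace:
  fixes W :: "('a \<Rightarrow> complex) set"
  assumes zero: "(\<lambda>x. 0) \<in> W" and add: "\<forall>u\<in>W. \<forall>v\<in>W. (\<lambda>x. u x + v x) \<in> W"
    and "finite I" "\<And>i. i \<in> I \<Longrightarrow> f i \<in> W"
  shows "(\<lambda>x. \<Sum>i\<in>I. f i x) \<in> W"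
  using assms(3,4)
proof (induction I rule: finite_induct)
  case (insert i I)
  have "(\<lambda>x. f i x + (\<Sum>i\<in>I. f i x)) \<in> W"
    by (rule add[rule_format]) (use insert in auto)
  with insert(1,2) show ?case by simp
qed (simp add: zero)

text \<open>
  The indicator of an open interval is a bounded pointwise limit of plateau functions. The Borel
  sets whose indicators belong to \<open>W\<close> form a Dynkin system that contains these intervals, so they are
  all Borel sets; simple functions and dominated convergence do the rest.
\<close>

lemma closed_subspace_with_plateaus:
  fixes W :: "(real \<Rightarrow> complex) set"
  assumes W: "W \<subseteq> l2 unit_interval"
    and lin: "\<And>c u v. u \<in> W \<Longrightarrow> v \<in> W \<Longrightarrow> (\<lambda>x. c * u x + v x) \<in> W"
    and lim: "\<And>s u. (\<And>n::nat. s n \<in> W) \<Longrightarrow> u \<in> l2 unit_interval \<Longrightarrow>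
      (\<lambda>n. l2_norm unit_interval (\<lambda>x. s n x - u x)) \<longlonglongrightarrow> 0 \<Longrightarrow> u \<in> W"
    and plateau: "\<And>a b \<delta>. 0 \<le> a \<Longrightarrow> b \<le> 1 \<Longrightarrow> 0 < \<delta> \<Longrightarrow> (\<lambda>x. complex_of_real (plateau a b \<delta> x)) \<in> W"
    and u: "u \<in> l2 unit_interval"
  shows "u \<in> W"
proof -
  let ?L = unit_interval
  have const: "integrable ?L (\<lambda>x. c)" for c :: real
    by (rule finite_measure.integrable_const[OF finite_measure_unit_interval])
  have dom: "v \<in> W" if s: "\<And>n::nat. s n \<in> W" and v: "v \<in> borel_measurable ?L" "\<And>x. cmod (v x) \<le> 1"
    and s1: "\<And>n x. cmod (s n x) \<le> 1"
    and conv: "AE x in ?L. (\<lambda>n. s n x) \<longlonglongrightarrow> v x" for s v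
  proof (rule lim[OF s])
    show vl: "v \<in> l2 ?L" using v by (intro l2_unit_interval_bounded[of v 1]) auto
    have bd: "(cmod (s n x - v x))\<^sup>2 \<le> 4" for n x
    proof -
      have "cmod (s n x - v x) \<le> 2"
        using norm_triangle_ineq4[of "s n x" "v x"] s1[of n x] v(2)[of x] by linarith
      then have "(cmod (s n x - v x))\<^sup>2 \<le> 2\<^sup>2" by (rule power_mono) simp
      then show ?thesis by simp
    qed
    show "(\<lambda>n. l2_norm ?L (\<lambda>x. s n x - v x)) \<longlonglongrightarrow> 0"
    proof (rule l2_dominated_convergence[OF _ vl const conv])
      show "s n \<in> l2 ?L" for n using s W by blast
      show "AE x in ?L. (cmod (s n x - v x))\<^sup>2 \<le> 4" for n using bd by simp
    qed
  qed
  have zero: "(\<lambda>x. 0) \<in> W" using lin[OF plateau plateau, of 0 0 1 0 0 1 "-1"] by simp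
  have add: "(\<lambda>x. u x + v x) \<in> W" if "u \<in> W" "v \<in> W" for u v using lin[OF that, of 1] by simp
  have scale: "(\<lambda>x. c * u x) \<in> W" if "u \<in> W" for c u using lin[OF that zero, of c] by simp
  have AEeq: "v \<in> W" if s: "s \<in> W" and v: "v \<in> l2 ?L" and eq: "AE x in ?L. s x = v x" for s v
  proof (rule lim[of "\<lambda>_. s", OF s v])
    have "(\<lambda>x. s x - v x) \<in> l2 ?L" using s W by (intro l2_diff v) blast
    moreover have "AE x in ?L. s x - v x = 0" using eq by eventually_elim simp
    ultimately have "l2_norm ?L (\<lambda>x. s x - v x) = 0" by (rule l2_norm_eq_0_iff[THEN iffD2])
    then show "(\<lambda>n. l2_norm ?L (\<lambda>x. s x - v x)) \<longlonglongrightarrow> 0" by simp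
  qed
  have "\<forall>u\<in>W. \<forall>v\<in>W. (\<lambda>x. u x + v x) \<in> W" using add by blast
  note sum = sum_mem_subspace[OF zero this]
  have ind_meas: "(indicator (B \<inter> {0<..<1}) :: real \<Rightarrow> complex) \<in> borel_measurable ?L" if "B \<in> sets borel" for B
    using that by (intro borel_measurable_indicator) (auto simp: sets_restrict_space_iff)
  have ind1: "cmod (indicator B x) \<le> 1" for B and x :: real by (simp add: indicator_def)
  have interval: "(indicator {a<..<b} :: real \<Rightarrow> complex) \<in> W" if ab: "0 \<le> a" "b \<le> 1" for a b
  proof (rule dom[of "\<lambda>n x. complex_of_real (plateau a b (1 / real (Suc n)) x)"])
    show "(\<lambda>x. complex_of_real (plateau a b (1 / real (Suc n)) x)) \<in> W" for n
      by (rule plateau[OF ab]) simp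
    show "(indicator {a<..<b} :: real \<Rightarrow> complex) \<in> borel_measurable ?L"
      using ind_meas[of "{a<..<b}"] ab by (simp add: Int_absorb2 greaterThanLessThan_subseteq_greaterThanLessThan)
    show "cmod (complex_of_real (plateau a b (1 / real (Suc n)) x)) \<le> 1" for n x
      using plateau_bounds[of a b "1 / real (Suc n)" x] by (simp add: abs_le_iff)
    show "AE x in ?L. (\<lambda>n. complex_of_real (plateau a b (1 / real (Suc n)) x)) \<longlonglongrightarrow> indicator {a<..<b} x"
    proof (rule AE_I2)
      fix x assume "x \<in> space ?L"
      show "(\<lambda>n. complex_of_real (plateau a b (1 / real (Suc n)) x)) \<longlonglongrightarrow> indicator {a<..<b} x"
      proof (cases "x \<in> {a<..<b}")
        case True
        define m where "m = min (x - a) (b - x) / 2"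
        have m: "0 < m" using True by (simp add: m_def)
        have "(\<lambda>n. 1 / real (Suc n)) \<longlonglongrightarrow> 0"
          using LIMSEQ_inverse_real_of_nat by (simp add: inverse_eq_divide)
        then have "\<forall>\<^sub>F n in sequentially. 1 / real (Suc n) < m" using m by (rule order_tendstoD)
        then have "\<forall>\<^sub>F n in sequentially. plateau a b (1 / real (Suc n)) x = 1"
        proof eventually_elim
          case (elim n)
          have "a + 2 * d \<le> x \<and> x \<le> b - 2 * d" if "d < m" for d
          proof -
            have "m \<le> (x - a) / 2" "m \<le> (b - x) / 2" unfolding m_def by simp_all
            with that show ?thesis by simp
          qed
          from this[OF elim] show ?case by (intro plateau_eq_1) auto
        qed
        then have "\<forall>\<^sub>F n in sequentially. complex_of_real (plateau a b (1 / real (Suc n)) x) = indicator {a<..<b} x"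
          by eventually_elim (use True in simp)
        then show ?thesis by (rule tendsto_eventually)
      next
        case False
        then have "x \<le> a \<or> b \<le> x" by auto
        then have "plateau a b (1 / real (Suc n)) x = 0" for n
        proof -
          have "0 < 1 / real (Suc n)" by simp
          with \<open>x \<le> a \<or> b \<le> x\<close> have "x \<le> a + 1 / real (Suc n) \<or> b - 1 / real (Suc n) \<le> x" by linarith
          then show ?thesis by (intro plateau_eq_0) auto
        qed
        then show ?thesis using False by simp
      qed
    qed
  qed (rule ind1)
  have borel: "(indicator (B \<inter> {0<..<1}) :: real \<Rightarrow> complex) \<in> W" if B: "B \<in> sets borel" for B
  proof -
    let ?G = "range (\<lambda>(a, b). {a<..<b::real})"
    have gen: "sets borel = sigma_sets UNIV ?G"
      using arg_cong[OF borel_eq_box[where 'a=real], of sets] by (simp add: box_real sets_measure_of)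
    have stable: "Int_stable ?G" by (auto simp: Int_stable_def)
    have "?G \<subseteq> Pow UNIV" "B \<in> sigma_sets UNIV ?G" using B gen by simp_all
    with stable show ?thesis
    proof (induction rule: sigma_sets_induct_disjoint)
      case (basic A)
      then obtain a b where A: "A = {a<..<b}" by auto
      have "A \<inter> {0<..<1} = {max a 0<..<min b 1}" unfolding A by auto
      then show ?case using interval[of "max a 0" "min b 1"] by simp
    next
      case empty
      show ?case using zero by (simp add: indicator_def[abs_def])
    next
      case (compl A)
      have "(\<lambda>x. indicator {0<..<1} x + (-1) * indicator (A \<inter> {0<..<1}) x) \<in> W"
        by (rule add[OF interval[of 0 1] scale[OF compl(2)]]) auto
      also have "(\<lambda>x. indicator {0<..<1} x + (-1) * indicator (A \<inter> {0<..<1}) x)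
          = (indicator ((UNIV - A) \<inter> {0<..<1}) :: real \<Rightarrow> complex)"
        by (auto simp: indicator_def fun_eq_iff)
      finally show ?case .
    next
      case (union A)
      let ?s = "\<lambda>n x. \<Sum>i<n. indicator (A i \<inter> {0<..<1}) x :: complex"
      have s_eq: "?s n x = indicator ((\<Union>i<n. A i) \<inter> {0<..<1}) x" for n x
      proof (induction n)
        case (Suc n)
        have "A n \<inter> (\<Union>i<n. A i) = {}"
        proof -
          have "A n \<inter> A i = {}" if "i < n" for i
            using union(1) that by (simp add: disjoint_family_on_def)
          then show ?thesis by blast
        qed
        then have "indicator ((\<Union>i<n. A i) \<inter> {0<..<1}) x + indicator (A n \<inter> {0<..<1}) x
            = (indicator ((\<Union>i<Suc n. A i) \<inter> {0<..<1}) x :: complex)"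
          unfolding lessThan_Suc by (cases "x \<in> A n") (auto simp: indicator_def)
        then show ?case unfolding sum.lessThan_Suc Suc.IH .
      qed simp
      show ?case
      proof (rule dom[of ?s])
        show "?s n \<in> W" for n by (rule sum) (use union(3) in auto)
        have "\<Union> (range A) \<in> sets borel" unfolding gen using union(2) by (intro sigma_sets.Union) auto
        then show "(indicator (\<Union> (range A) \<inter> {0<..<1}) :: real \<Rightarrow> complex) \<in> borel_measurable ?L"
          by (rule ind_meas)
        show "cmod (?s n x) \<le> 1" for n x unfolding s_eq by (rule ind1)
        show "AE x in ?L. (\<lambda>n. ?s n x) \<longlonglongrightarrow> indicator (\<Union> (range A) \<inter> {0<..<1}) x"
        proof (rule AE_I2)
          fix x
          show "(\<lambda>n. ?s n x) \<longlonglongrightarrow> indicator (\<Union> (range A) \<inter> {0<..<1}) x"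
          proof (cases "x \<in> \<Union> (range A)")
            case True
            then obtain i where "x \<in> A i" by auto
            then have "\<forall>\<^sub>F n in sequentially. ?s n x = indicator (\<Union> (range A) \<inter> {0<..<1}) x"
              unfolding s_eq
              by (intro eventually_mono[OF eventually_gt_at_top[of i]]) (auto simp: indicator_def)
            then show ?thesis by (rule tendsto_eventually)
          next
            case False
            then show ?thesis by (simp add: indicator_def)
          qed
        qed
      qed (rule ind1)
    qed
  qed
  have set: "(indicator B :: real \<Rightarrow> complex) \<in> W" if B: "B \<in> sets ?L" for B
  proof -
    have BL: "B \<in> sets lebesgue" using B by (auto simp: sets_restrict_space_iff)
    obtain S where S: "S \<in> sets borel" "AE x in lebesgue. x \<in> B \<longleftrightarrow> x \<in> S"
      by (rule lebesgue_set_AE_borel[OF BL]) (rule that)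
    have ends: "AE x in lebesgue. x \<noteq> (0::real) \<and> x \<noteq> 1"
    proof -
      have "AE x in lborel. x \<noteq> (0::real) \<and> x \<noteq> 1" by (intro AE_conjI AE_lborel_singleton)
      then show ?thesis by (rule AE_completion)
    qed
    show ?thesis
    proof (rule AEeq[OF borel[OF S(1)]])
      show "(indicator B :: real \<Rightarrow> complex) \<in> l2 ?L"
        using B ind1 by (intro l2_unit_interval_bounded[of _ 1] borel_measurable_indicator) auto
      show "AE x in ?L. (indicator (S \<inter> {0<..<1}) x :: complex) = indicator B x"
        unfolding AE_unit_interval_iff using S(2) ends
        by eventually_elim (auto simp: indicator_def)
    qed
  qed
  obtain F where F: "\<And>i. simple_function ?L (F i)" "\<And>x. x \<in> space ?L \<Longrightarrow> (\<lambda>i. F i x) \<longlonglongrightarrow> u x"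
    "\<And>i x. x \<in> space ?L \<Longrightarrow> dist (F i x) 0 \<le> 2 * dist (u x) 0"
    using borel_measurable_implies_sequence_metric[OF l2_measurable[OF u], of 0] by metis
  let ?s = "\<lambda>i x. \<Sum>y\<in>F i ` space ?L. y * indicator (F i -` {y} \<inter> space ?L) x"
  have s_eq: "?s i x = F i x" if "x \<in> space ?L" for i x
  proof -
    have "?s i x = (\<Sum>y\<in>F i ` space ?L. if y = F i x then y else 0)"
      by (rule sum.cong) (use that in \<open>auto simp: indicator_def\<close>)
    also have "\<dots> = F i x" using that simple_functionD(1)[OF F(1)] by simp
    finally show ?thesis .
  qed
  have s: "?s i \<in> W" for i
    by (rule sum[OF simple_functionD(1)[OF F(1)]], rule scale, rule set, rule simple_functionD(2)[OF F(1)])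
  show ?thesis
  proof (rule lim[of ?s, OF s u])
    show "(\<lambda>i. l2_norm ?L (\<lambda>x. ?s i x - u x)) \<longlonglongrightarrow> 0"
    proof (rule l2_dominated_convergence[OF _ u])
      show "?s i \<in> l2 ?L" for i using s W by blast
      show "integrable ?L (\<lambda>x. 9 * (cmod (u x))\<^sup>2)" using l2_sq_integrable[OF u] by simp
      show "AE x in ?L. (\<lambda>i. ?s i x) \<longlonglongrightarrow> u x" using s_eq F(2) by (intro AE_I2) simp
      show "AE x in ?L. (cmod (?s i x - u x))\<^sup>2 \<le> 9 * (cmod (u x))\<^sup>2" for i
      proof (rule AE_I2)
        fix x assume x: "x \<in> space ?L"
        have "cmod (?s i x - u x) \<le> 3 * cmod (u x)"
          unfolding s_eq[OF x] using F(3)[OF x, of i] norm_triangle_ineq4[of "F i x" "u x"] by simp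
        then have "(cmod (?s i x - u x))\<^sup>2 \<le> (3 * cmod (u x))\<^sup>2" by (rule power_mono) simp
        then show "(cmod (?s i x - u x))\<^sup>2 \<le> 9 * (cmod (u x))\<^sup>2" by (simp add: power_mult_distrib)
      qed
    qed
  qed
qed

lemma l2_norm_single_edge:
  assumes c: "countable (arcs G)" and u: "u \<in> l2 unit_interval" and e: "e \<in> arcs G"
  shows "l2_norm (edge_measure G) (single_edge e u) = l2_norm unit_interval u"
proof -
  have "complex_of_real ((l2_norm (edge_measure G) (single_edge e u))\<^sup>2) = l2_inner unit_interval u u"
    unfolding l2_inner_self[symmetric] l2_inner_single_edge[OF c u single_edge_l2[OF c u] e]
    by (simp add: l2_inner_def single_edge_def)
  then have "(l2_norm (edge_measure G) (single_edge e u))\<^sup>2 = (l2_norm unit_interval u)\<^sup>2"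
    unfolding l2_inner_self of_real_eq_iff .
  then show ?thesis by simp
qed

text \<open>
  The closure of \<open>X\<close> is a closed subspace, so it contains all square integrable functions on a single
  edge, hence all those on finitely many edges, and these approximate \<open>f\<close> by dominated convergence.
\<close>

lemma subspace_with_plateaus_dense:
  fixes X :: "('e \<times> real \<Rightarrow> complex) set"
  assumes c: "countable (arcs G)" and X: "X \<subseteq> l2 (edge_measure G)"
    and lin: "\<And>c f g. f \<in> X \<Longrightarrow> g \<in> X \<Longrightarrow> (\<lambda>z. c * f z + g z) \<in> X"
    and zero: "(\<lambda>z. 0) \<in> X"
    and plateau: "\<And>e a b \<delta>. e \<in> arcs G \<Longrightarrow> 0 \<le> a \<Longrightarrow> b \<le> 1 \<Longrightarrow> 0 < \<delta> \<Longrightarrow>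
      single_edge e (\<lambda>x. complex_of_real (plateau a b \<delta> x)) \<in> X"
    and f: "f \<in> l2 (edge_measure G)" and \<epsilon>: "0 < \<epsilon>"
  shows "\<exists>g\<in>X. l2_norm (edge_measure G) (\<lambda>z. f z - g z) < \<epsilon>"
proof -
  let ?M = "edge_measure G"
  define Y where "Y = {f \<in> l2 ?M. \<forall>\<epsilon>>0. \<exists>g\<in>X. l2_norm ?M (\<lambda>z. f z - g z) < \<epsilon>}"
  have XY: "X \<subseteq> Y"
  proof
    fix f assume f: "f \<in> X"
    have "l2_norm ?M (\<lambda>z. f z - f z) = 0" by (simp add: l2_norm_def)
    then have "\<exists>g\<in>X. l2_norm ?M (\<lambda>z. f z - g z) < \<epsilon>" if "0 < \<epsilon>" for \<epsilon>
      using that by (intro bexI[OF _ f]) simp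
    then show "f \<in> Y" using f X unfolding Y_def by blast
  qed
  have Yl: "Y \<subseteq> l2 ?M" by (auto simp: Y_def)
  have Ylin: "(\<lambda>z. a * f z + g z) \<in> Y" if f: "f \<in> Y" and g: "g \<in> Y" for a f g
  proof -
    have fl: "f \<in> l2 ?M" and gl: "g \<in> l2 ?M" using f g Yl by auto
    have "\<exists>h\<in>X. l2_norm ?M (\<lambda>z. a * f z + g z - h z) < \<epsilon>" if "0 < \<epsilon>" for \<epsilon>
    proof -
      define \<eta> where "\<eta> = \<epsilon> / (cmod a + 1)"
      have pos: "0 < cmod a + 1" using norm_ge_zero[of a] by linarith
      have \<eta>: "(cmod a + 1) * \<eta> = \<epsilon>" unfolding \<eta>_def using pos by simp
      have "0 < \<eta>" unfolding \<eta>_def using that pos by (rule divide_pos_pos)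
      then obtain f' g' where f': "f' \<in> X" "l2_norm ?M (\<lambda>z. f z - f' z) < \<eta>"
        and g': "g' \<in> X" "l2_norm ?M (\<lambda>z. g z - g' z) < \<eta>"
        using f g unfolding Y_def by blast
      have "f' \<in> l2 ?M" "g' \<in> l2 ?M" using X f'(1) g'(1) by auto
      note fd = l2_diff[OF fl this(1)] and gd = l2_diff[OF gl this(2)]
      have "l2_norm ?M (\<lambda>z. a * (f z - f' z) + (g z - g' z)) \<le> cmod a * l2_norm ?M (\<lambda>z. f z - f' z) + l2_norm ?M (\<lambda>z. g z - g' z)"
        using l2_norm_triangle[OF l2_scale[OF fd, of a] gd] unfolding l2_norm_scale .
      also have "\<dots> < cmod a * \<eta> + \<eta>"
        by (rule add_le_less_mono[OF mult_left_mono[OF less_imp_le[OF f'(2)]] g'(2)]) simp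
      also have "\<dots> = \<epsilon>" using \<eta> unfolding distrib_right by simp
      also have "(\<lambda>z. a * (f z - f' z) + (g z - g' z)) = (\<lambda>z. a * f z + g z - (a * f' z + g' z))"
        by (simp add: fun_eq_iff right_diff_distrib)
      finally show ?thesis by (rule bexI[OF _ lin[OF f'(1) g'(1)]])
    qed
    then show ?thesis using l2_add[OF l2_scale[OF fl] gl] by (simp add: Y_def)
  qed
  have Ylim: "g \<in> Y" if s: "\<And>n::nat. s n \<in> Y" and g: "g \<in> l2 ?M"
    and conv: "(\<lambda>n. l2_norm ?M (\<lambda>z. s n z - g z)) \<longlonglongrightarrow> 0" for s g
  proof -
    have "\<exists>h\<in>X. l2_norm ?M (\<lambda>z. g z - h z) < \<epsilon>" if "0 < \<epsilon>" for \<epsilon>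
    proof -
      have e2: "0 < \<epsilon> / 2" using that by simp
      have "\<forall>\<^sub>F n in sequentially. l2_norm ?M (\<lambda>z. s n z - g z) < \<epsilon> / 2"
        using conv e2 by (rule order_tendstoD)
      then obtain n where n: "l2_norm ?M (\<lambda>z. s n z - g z) < \<epsilon> / 2" by (auto dest: eventually_happens)
      obtain h where h: "h \<in> X" "l2_norm ?M (\<lambda>z. s n z - h z) < \<epsilon> / 2"
        using s[of n] e2 unfolding Y_def by blast
      have "s n \<in> l2 ?M" "h \<in> l2 ?M" using s Yl h(1) X by auto
      then have "l2_norm ?M (\<lambda>z. g z - h z) \<le> l2_norm ?M (\<lambda>z. g z - s n z) + l2_norm ?M (\<lambda>z. s n z - h z)"
        by (intro l2_norm_triangle_diff g)
      also have "\<dots> < \<epsilon>" using n h(2) by (simp add: l2_norm_minus_commute[of ?M g])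
      finally show ?thesis by (rule bexI[OF _ h(1)])
    qed
    then show ?thesis using g by (simp add: Y_def)
  qed
  have single: "single_edge e u \<in> Y" if e: "e \<in> arcs G" and u: "u \<in> l2 unit_interval" for e u
  proof -
    define W where "W = {u \<in> l2 unit_interval. single_edge e u \<in> Y}"
    have WI: "u \<in> W" if "u \<in> l2 unit_interval" "single_edge e u \<in> Y" for u
      using that by (simp add: W_def)
    have WD: "u \<in> l2 unit_interval" "single_edge e u \<in> Y" if "u \<in> W" for u
      using that by (simp_all add: W_def)
    have "u \<in> W"
    proof (rule closed_subspace_with_plateaus[of W, OF _ _ _ _ u])
      show "W \<subseteq> l2 unit_interval" using WD(1) by blast
      show "(\<lambda>x. a * u x + v x) \<in> W" if u: "u \<in> W" and v: "v \<in> W" for a u v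
      proof (rule WI[OF l2_add[OF l2_scale[OF WD(1)[OF u]] WD(1)[OF v]]])
        have "single_edge e (\<lambda>x. a * u x + v x) = (\<lambda>z. a * single_edge e u z + single_edge e v z)"
          by (rule ext) (simp add: single_edge_def)
        then show "single_edge e (\<lambda>x. a * u x + v x) \<in> Y" using Ylin[OF WD(2)[OF u] WD(2)[OF v], of a] by simp
      qed
      show "u \<in> W" if s: "\<And>n::nat. s n \<in> W" and u: "u \<in> l2 unit_interval"
        and conv: "(\<lambda>n. l2_norm unit_interval (\<lambda>x. s n x - u x)) \<longlonglongrightarrow> 0" for s u
      proof (rule WI[OF u Ylim])
        show "single_edge e (s n) \<in> Y" for n by (rule WD(2)[OF s])
        show "single_edge e u \<in> l2 ?M" by (rule single_edge_l2[OF c u])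
        have "l2_norm ?M (\<lambda>z. single_edge e (s n) z - single_edge e u z) = l2_norm unit_interval (\<lambda>x. s n x - u x)" for n
        proof -
          have "(\<lambda>z. single_edge e (s n) z - single_edge e u z) = single_edge e (\<lambda>x. s n x - u x)"
            by (rule ext) (simp add: single_edge_def)
          then show ?thesis using l2_norm_single_edge[OF c l2_diff[OF WD(1)[OF s[of n]] u] e] by simp
        qed
        then show "(\<lambda>n. l2_norm ?M (\<lambda>z. single_edge e (s n) z - single_edge e u z)) \<longlonglongrightarrow> 0"
          using conv by simp
      qed
      show "(\<lambda>x. complex_of_real (plateau a b \<delta> x)) \<in> W" if ab: "0 \<le> a" "b \<le> 1" "0 < \<delta>" for a b \<delta>
      proof (rule WI)
        show "(\<lambda>x. complex_of_real (plateau a b \<delta> x)) \<in> l2 unit_interval"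
          by (rule l2_of_real[OF C2_deriv(5)[OF C2_plateau]])
        show "single_edge e (\<lambda>x. complex_of_real (plateau a b \<delta> x)) \<in> Y"
          using plateau[OF e ab] XY by blast
      qed
    qed
    then show ?thesis by (rule WD(2))
  qed
  \<comment> \<open>The restrictions of \<open>f\<close> to the finitely many edges enumerated before \<open>n\<close>.\<close>
  define A where "A n = {e \<in> arcs G. to_nat_on (arcs G) e < n}" for n
  have finA: "finite (A n)" for n
  proof (rule finite_imageD)
    show "finite (to_nat_on (arcs G) ` A n)"
      by (rule finite_subset[of _ "{..<n}"]) (auto simp: A_def)
    show "inj_on (to_nat_on (arcs G)) (A n)"
      by (rule inj_on_subset[OF inj_on_to_nat_on[OF c]]) (auto simp: A_def)
  qed
  define s where "s n z = (\<Sum>e\<in>A n. single_edge e (\<lambda>x. f (e, x)) z)" for n z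
  have s_eq: "s n z = (if fst z \<in> A n then f z else 0)" for n z
  proof -
    have "s n z = (\<Sum>e\<in>A n. if e = fst z then f z else 0)"
      unfolding s_def single_edge_def by (rule sum.cong) auto
    then show ?thesis using finA[of n] by simp
  qed
  have sY: "s n \<in> Y" for n
  proof -
    have "\<forall>f\<in>Y. \<forall>g\<in>Y. (\<lambda>z. f z + g z) \<in> Y" using Ylin[where a=1] unfolding mult_1 by blast
    then have "(\<lambda>z. \<Sum>e\<in>A n. single_edge e (\<lambda>x. f (e, x)) z) \<in> Y"
      by (rule sum_mem_subspace[OF _ _ finA single[OF _ l2_edge_section[OF c f]], rotated])
        (use zero XY in \<open>auto simp: A_def\<close>)
    then show ?thesis by (simp add: s_def[abs_def])
  qed
  have "f \<in> Y"
  proof (rule Ylim[of s, OF sY f])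
    show "(\<lambda>n. l2_norm ?M (\<lambda>z. s n z - f z)) \<longlonglongrightarrow> 0"
    proof (rule l2_dominated_convergence[OF _ f l2_sq_integrable[OF f]])
      show "s n \<in> l2 ?M" for n using sY Yl by blast
      show "AE z in ?M. (\<lambda>n. s n z) \<longlonglongrightarrow> f z"
      proof (rule AE_I2)
        fix z assume "z \<in> space ?M"
        then have "fst z \<in> arcs G" by (auto simp: space_edge_measure)
        then have "\<forall>\<^sub>F n in sequentially. s n z = f z"
          by (intro eventually_mono[OF eventually_gt_at_top[of "to_nat_on (arcs G) (fst z)"]])
            (simp add: s_eq A_def)
        then show "(\<lambda>n. s n z) \<longlonglongrightarrow> f z" by (rule tendsto_eventually)
      qed
      show "AE z in ?M. (cmod (s n z - f z))\<^sup>2 \<le> (cmod (f z))\<^sup>2" for n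
        by (rule AE_I2) (simp add: s_eq)
    qed
  qed
  then show ?thesis using \<epsilon> by (simp add: Y_def)
qed

section \<open>Weak derivatives and the energy form\<close>

text \<open>
  The orthogonal complement of \<open>w\<close> is a closed subspace and contains the plateaus, so it contains \<open>w\<close>.
\<close>

lemma orthogonal_to_test_functions:
  assumes w: "w \<in> l2 unit_interval"
    and orth: "\<And>\<phi>. test_function \<phi> \<Longrightarrow> (\<integral>x. w x * complex_of_real (\<phi> x) \<partial>unit_interval) = 0"
  shows "AE x in unit_interval. w x = 0"
proof -
  define W where "W = {u \<in> l2 unit_interval. l2_inner unit_interval u w = 0}"
  have WI: "u \<in> W" if "u \<in> l2 unit_interval" "l2_inner unit_interval u w = 0" for u
    using that by (simp add: W_def)
  have WD: "u \<in> l2 unit_interval" "l2_inner unit_interval u w = 0" if "u \<in> W" for u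
    using that by (simp_all add: W_def)
  have "w \<in> W"
  proof (rule closed_subspace_with_plateaus[of W, OF _ _ _ _ w])
    show "W \<subseteq> l2 unit_interval" using WD(1) by blast
    show "(\<lambda>x. c * u x + v x) \<in> W" if u: "u \<in> W" and v: "v \<in> W" for c u v
      by (rule WI[OF l2_add[OF l2_scale[OF WD(1)[OF u]] WD(1)[OF v]]])
        (simp add: l2_inner_add_left[OF l2_scale[OF WD(1)[OF u]] WD(1)[OF v] w] l2_inner_scale_left WD(2)[OF u] WD(2)[OF v])
    show "u \<in> W" if s: "\<And>n::nat. s n \<in> W" and u: "u \<in> l2 unit_interval"
      and conv: "(\<lambda>n. l2_norm unit_interval (\<lambda>x. s n x - u x)) \<longlonglongrightarrow> 0" for s u
    proof (rule WI[OF u])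
      have "(\<lambda>n. l2_norm unit_interval (\<lambda>x. w x - w x)) \<longlonglongrightarrow> 0" by (simp add: l2_norm_def)
      from l2_inner_tendsto[OF WD(1)[OF s] u conv w w this]
      have "(\<lambda>n. 0) \<longlonglongrightarrow> l2_inner unit_interval u w" by (simp only: WD(2)[OF s])
      then show "l2_inner unit_interval u w = 0" using LIMSEQ_unique tendsto_const by blast
    qed
    show "(\<lambda>x. complex_of_real (plateau a b \<delta> x)) \<in> W" if ab: "0 \<le> a" "b \<le> 1" "0 < \<delta>" for a b \<delta>
    proof (rule WI)
      show "(\<lambda>x. complex_of_real (plateau a b \<delta> x)) \<in> l2 unit_interval"
        by (rule l2_of_real[OF C2_deriv(5)[OF C2_plateau]])
      have "cnj (l2_inner unit_interval (\<lambda>x. complex_of_real (plateau a b \<delta> x)) w) = 0"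
        unfolding l2_inner_cnj using orth[OF plateau_test_functions(1)[OF ab]] by (simp add: l2_inner_def)
      then show "l2_inner unit_interval (\<lambda>x. complex_of_real (plateau a b \<delta> x)) w = 0" by simp
    qed
  qed
  then have "l2_norm unit_interval w = 0" using WD(2)[of w] unfolding l2_inner_self by simp
  then show ?thesis by (simp add: l2_norm_eq_0_iff[OF w])
qed

lemma test_function_l2:
  assumes "test_function \<phi>"
  shows "(\<lambda>x. complex_of_real (\<phi> x)) \<in> l2 unit_interval" "(\<lambda>x. complex_of_real (deriv \<phi> x)) \<in> l2 unit_interval"
  by (rule l2_of_real test_function_DERIV(2,3)[OF assms])+

lemma weak_derivative_unique:
  assumes "has_weak_derivative u v" "has_weak_derivative u v'" and v: "v \<in> l2 unit_interval" and v': "v' \<in> l2 unit_interval"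
  shows "AE x in unit_interval. v x = v' x"
proof -
  have "AE x in unit_interval. v x - v' x = 0"
  proof (rule orthogonal_to_test_functions[OF l2_diff[OF v v']])
    fix \<phi> assume \<phi>: "test_function \<phi>"
    have "integrable unit_interval (\<lambda>x. u x * complex_of_real (\<phi> x))" if "u \<in> l2 unit_interval" for u
      using l2_mult_integrable(1)[OF that test_function_l2(1)[OF \<phi>]] by simp
    from this[OF v] this[OF v']
    have "(\<integral>x. (v x - v' x) * complex_of_real (\<phi> x) \<partial>unit_interval)
      = (\<integral>x. v x * complex_of_real (\<phi> x) \<partial>unit_interval) - (\<integral>x. v' x * complex_of_real (\<phi> x) \<partial>unit_interval)"
      by (simp add: left_diff_distrib)
    also have "\<dots> = 0"
    proof -
      have "- (\<integral>x. v x * complex_of_real (\<phi> x) \<partial>unit_interval) = - (\<integral>x. v' x * complex_of_real (\<phi> x) \<partial>unit_interval)"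
        using assms(1,2) \<phi> unfolding has_weak_derivative_def by metis
      then show ?thesis by simp
    qed
    finally show "(\<integral>x. (v x - v' x) * complex_of_real (\<phi> x) \<partial>unit_interval) = 0" .
  qed
  then show ?thesis by eventually_elim simp
qed

lemma edge_H1_deriv:
  assumes "f \<in> edge_H1 G"
  shows "edgewise_weak_derivative G f (edge_deriv G f)"
proof -
  have "\<exists>f'. edgewise_weak_derivative G f f'" using assms by (simp add: edge_H1_def)
  then show ?thesis unfolding edge_deriv_def by (rule someI_ex)
qed

lemma edgewise_weak_derivative_l2: "edgewise_weak_derivative G f f' \<Longrightarrow> f' \<in> l2 (edge_measure G)"
  by (simp add: edgewise_weak_derivative_def)

lemma edge_deriv_AE_eq:
  assumes c: "countable (arcs G)" and f': "edgewise_weak_derivative G f f'" and f: "f \<in> l2 (edge_measure G)" and e: "e \<in> arcs G"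
  shows "AE x in unit_interval. edge_deriv G f (e, x) = f' (e, x)"
proof (rule weak_derivative_unique)
  have d: "edgewise_weak_derivative G f (edge_deriv G f)"
    using f f' by (intro edge_H1_deriv) (auto simp: edge_H1_def)
  show "has_weak_derivative (\<lambda>x. f (e, x)) (\<lambda>x. edge_deriv G f (e, x))" "has_weak_derivative (\<lambda>x. f (e, x)) (\<lambda>x. f' (e, x))"
    using d f' e by (auto simp: edgewise_weak_derivative_def)
  show "(\<lambda>x. edge_deriv G f (e, x)) \<in> l2 unit_interval" "(\<lambda>x. f' (e, x)) \<in> l2 unit_interval"
    by (rule l2_edge_section[OF c edgewise_weak_derivative_l2[OF d] e] l2_edge_section[OF c edgewise_weak_derivative_l2[OF f'] e])+
qed

text \<open>
  Weak derivatives are unique, so any choice of them gives the same energy; Fubini's theorem turns the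
  sum over the edges into an inner product in \<open>L\<^sup>2\<close> of the whole graph.
\<close>

lemma energy_form_eq_l2_inner:
  assumes c: "countable (arcs G)" and f: "f \<in> l2 (edge_measure G)" and g: "g \<in> l2 (edge_measure G)"
    and f': "edgewise_weak_derivative G f f'" and g': "edgewise_weak_derivative G g g'"
  shows "energy_form G f g = l2_inner (edge_measure G) f' g'"
proof -
  have fl: "edge_deriv G f \<in> l2 (edge_measure G)" and gl: "edge_deriv G g \<in> l2 (edge_measure G)"
    using edgewise_weak_derivative_l2[OF edge_H1_deriv] f g f' g' by (auto simp: edge_H1_def)
  note f'l = edgewise_weak_derivative_l2[OF f'] and g'l = edgewise_weak_derivative_l2[OF g']
  have "energy_form G f g = (\<Sum>\<^sub>\<infinity>e\<in>arcs G. \<integral>x. f' (e, x) * cnj (g' (e, x)) \<partial>unit_interval)"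
    unfolding energy_form_def
  proof (rule infsum_cong)
    fix e assume e: "e \<in> arcs G"
    show "(\<integral>x. edge_deriv G f (e, x) * cnj (edge_deriv G g (e, x)) \<partial>unit_interval)
        = (\<integral>x. f' (e, x) * cnj (g' (e, x)) \<partial>unit_interval)"
      unfolding l2_inner_def[symmetric]
      by (rule l2_inner_AE_cong)
        (rule l2_edge_section[OF c] fl gl f'l g'l e edge_deriv_AE_eq[OF c f' f e] edge_deriv_AE_eq[OF c g' g e])+
  qed
  also have "\<dots> = l2_inner (edge_measure G) f' g'"
    unfolding l2_inner_def by (rule edge_integral(2)[OF c l2_mult_integrable(1)[OF f'l g'l], symmetric])
  finally show ?thesis .
qed

lemma integral_unit_interval_derivative:
  assumes "\<And>x. (F has_real_derivative F' x) (at x)" "continuous_on UNIV F'"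
  shows "(\<integral>x. F' x \<partial>unit_interval) = F 1 - F 0"
proof -
  have "(F' has_integral (F 1 - F 0)) {0..1}"
    by (rule fundamental_theorem_of_calculus)
      (auto simp: has_real_derivative_iff_has_vector_derivative[symmetric] intro!: has_field_derivative_at_within assms(1))
  moreover have "integrable unit_interval F'"
    by (rule continuous_imp_integrable_real[OF continuous_on_subset[OF assms(2) subset_UNIV]])
  then have "(\<integral>x. F' x \<partial>unit_interval) = integral {0..1} F'"
    by (rule lebesgue_integral_eq_integral) simp
  ultimately show ?thesis by (simp add: integral_unique)
qed

lemma has_weak_derivative_C1:
  assumes u: "\<And>x. (u has_real_derivative u' x) (at x)" and u': "continuous_on UNIV u'"
  shows "has_weak_derivative (\<lambda>x. complex_of_real (u x)) (\<lambda>x. complex_of_real (u' x))"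
  unfolding has_weak_derivative_def
proof (intro allI impI)
  fix \<phi> assume \<phi>: "test_function \<phi>"
  have cu: "continuous_on UNIV u" by (rule DERIV_continuous_on[OF DERIV_subset[OF u]]) auto
  have d: "((\<lambda>x. u x * \<phi> x) has_real_derivative u' x * \<phi> x + deriv \<phi> x * u x) (at x)" for x
    by (rule DERIV_mult[OF u test_function_DERIV(1)[OF \<phi>]])
  have "(\<integral>x. u' x * \<phi> x + deriv \<phi> x * u x \<partial>unit_interval) = u 1 * \<phi> 1 - u 0 * \<phi> 0"
    by (rule integral_unit_interval_derivative[OF d])
      (intro continuous_intros u' cu test_function_DERIV(2,3)[OF \<phi>])
  also have "\<dots> = 0" using test_function_DERIV(4,5)[OF \<phi>] by simp
  finally have "(\<integral>x. u' x * \<phi> x + deriv \<phi> x * u x \<partial>unit_interval) = 0" .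
  moreover have "integrable unit_interval k" if "continuous_on UNIV k" for k :: "real \<Rightarrow> real"
    by (rule continuous_imp_integrable_real[OF continuous_on_subset[OF that subset_UNIV]])
  then have "integrable unit_interval (\<lambda>x. u' x * \<phi> x)" "integrable unit_interval (\<lambda>x. deriv \<phi> x * u x)"
    using continuous_on_mult[OF u' test_function_DERIV(3)[OF \<phi>]] continuous_on_mult[OF test_function_DERIV(2)[OF \<phi>] cu]
    by blast+
  ultimately have "(\<integral>x. deriv \<phi> x * u x \<partial>unit_interval) = - (\<integral>x. u' x * \<phi> x \<partial>unit_interval)" by simp
  then have "(\<integral>x. u x * deriv \<phi> x \<partial>unit_interval) = - (\<integral>x. u' x * \<phi> x \<partial>unit_interval)"
    by (simp only: mult.commute)
  then show "(\<integral>x. complex_of_real (u x) * complex_of_real (deriv \<phi> x) \<partial>unit_interval)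
      = - (\<integral>x. complex_of_real (u' x) * complex_of_real (\<phi> x) \<partial>unit_interval)"
    unfolding of_real_mult[symmetric] integral_complex_of_real by simp
qed

text \<open>
  As the derivatives of the functions \<open>U e\<close> are test functions, the definition of the weak derivative of
  the other argument integrates the energy form by parts, and no boundary term arises. The functions
  in question are constant near all nodes; below they are plateaus inside an edge, and functions that
  are \<open>1\<close> near one node.
\<close>

lemma smooth_in_laplacian_domain:
  fixes U :: "'e \<Rightarrow> real \<Rightarrow> real" and d :: "'v \<Rightarrow> complex"
  assumes c: "countable (arcs G)" and A: "finite A" and d: "finite {v. d v \<noteq> 0}"
    and smooth: "\<And>e. e \<in> arcs G \<Longrightarrow> C2 (U e)"
    and test: "\<And>e. e \<in> arcs G \<Longrightarrow> test_function (deriv (U e))"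
    and zero: "\<And>e. e \<in> arcs G \<Longrightarrow> e \<notin> A \<Longrightarrow> U e = (\<lambda>x. 0)"
    and boundary: "\<And>e. e \<in> arcs G \<Longrightarrow> complex_of_real (U e 0) = d (tail G e)"
      "\<And>e. e \<in> arcs G \<Longrightarrow> complex_of_real (U e 1) = d (head G e)"
  shows "graph_laplacian G (\<lambda>(e, x). complex_of_real (U e x)) (\<lambda>(e, x). complex_of_real (deriv (deriv (U e)) x))"
proof -
  let ?M = "edge_measure G"
  define f f' f'' where "f = (\<lambda>(e, x). complex_of_real (U e x))"
    and "f' = (\<lambda>(e, x). complex_of_real (deriv (U e) x))"
    and "f'' = (\<lambda>(e, x). complex_of_real (deriv (deriv (U e)) x))"
  have 0: "deriv (\<lambda>x::real. 0::real) = (\<lambda>x. 0)" by (rule ext) simp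
  have l2I: "(\<lambda>(e, x). complex_of_real (V e x)) \<in> l2 ?M"
    if V: "\<And>e. e \<in> arcs G \<Longrightarrow> continuous_on UNIV (V e)" "\<And>e. e \<in> arcs G \<Longrightarrow> e \<notin> A \<Longrightarrow> V e = (\<lambda>x. 0)"
    for V :: "'e \<Rightarrow> real \<Rightarrow> real"
  proof (rule l2_edge_finite[OF c A])
    show "(\<lambda>x. case (e, x) of (e, x) \<Rightarrow> complex_of_real (V e x)) \<in> l2 unit_interval" if "e \<in> arcs G" for e
      unfolding prod.case
      by (rule l2_of_real[OF V(1)[OF that]])
  qed (simp add: V(2))
  have l2: "f \<in> l2 ?M" "f' \<in> l2 ?M" "f'' \<in> l2 ?M"
    unfolding f_def f'_def f''_def
    by (rule l2I; simp add: zero 0 C2_deriv(3-5)[OF smooth])+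
  have fd: "edgewise_weak_derivative G f f'"
    unfolding edgewise_weak_derivative_def
  proof (intro conjI ballI)
    show "has_weak_derivative (\<lambda>x. f (e, x)) (\<lambda>x. f' (e, x))" if "e \<in> arcs G" for e
      unfolding f_def f'_def prod.case
      by (rule has_weak_derivative_C1[OF C2_deriv(1)[OF smooth[OF that]] C2_deriv(4)[OF smooth[OF that]]])
  qed (rule l2(2))
  have H1: "f \<in> edge_H1 G" using l2(1) fd by (auto simp: edge_H1_def)
  have "has_boundary_values (\<lambda>x. f (e, x)) (d (tail G e)) (d (head G e))" if e: "e \<in> arcs G" for e
    unfolding has_boundary_values_def
  proof (intro exI conjI)
    show "continuous_on {0..1} (\<lambda>x. complex_of_real (U e x))"
      by (intro continuous_on_of_real continuous_on_subset[OF C2_deriv(5)[OF smooth[OF e]] subset_UNIV])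
  qed (use boundary e in \<open>simp_all add: f_def\<close>)
  moreover have "(\<lambda>v. (cmod (d v))\<^sup>2) summable_on verts G"
  proof -
    have "(\<lambda>v. (cmod (d v))\<^sup>2) summable_on {v \<in> verts G. d v \<noteq> 0}"
      by (rule summable_on_finite) (rule finite_subset[OF _ d], auto)
    moreover have "(\<lambda>v. (cmod (d v))\<^sup>2) summable_on {v \<in> verts G. d v \<noteq> 0} \<longleftrightarrow>
        (\<lambda>v. (cmod (d v))\<^sup>2) summable_on verts G"
      by (rule summable_on_cong_neutral) auto
    ultimately show ?thesis by simp
  qed
  ultimately have dom: "f \<in> form_domain G" using H1 by (auto simp: form_domain_def)
  have "energy_form G f g = - l2_inner ?M f'' g" if g: "g \<in> form_domain G" for g
  proof -
    have gH: "g \<in> edge_H1 G" and gl: "g \<in> l2 ?M" using g by (auto simp: form_domain_def edge_H1_def)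
    define g' where "g' = edge_deriv G g"
    have g': "edgewise_weak_derivative G g g'" unfolding g'_def by (rule edge_H1_deriv[OF gH])
    have "energy_form G f g = l2_inner ?M f' g'"
      by (rule energy_form_eq_l2_inner[OF c l2(1) gl fd g'])
    also have "\<dots> = (\<Sum>\<^sub>\<infinity>e\<in>arcs G. \<integral>x. f' (e, x) * cnj (g' (e, x)) \<partial>unit_interval)"
      unfolding l2_inner_def
      by (rule edge_integral(2)[OF c l2_mult_integrable(1)[OF l2(2) edgewise_weak_derivative_l2[OF g']]])
    also have "\<dots> = (\<Sum>\<^sub>\<infinity>e\<in>arcs G. - (\<integral>x. f'' (e, x) * cnj (g (e, x)) \<partial>unit_interval))"
    proof (rule infsum_cong)
      fix e assume e: "e \<in> arcs G"
      have "(\<integral>x. g (e, x) * complex_of_real (deriv (deriv (U e)) x) \<partial>unit_interval)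
          = - (\<integral>x. g' (e, x) * complex_of_real (deriv (U e) x) \<partial>unit_interval)"
        using g' e test[OF e] by (simp add: edgewise_weak_derivative_def has_weak_derivative_def)
      then have "cnj (\<integral>x. g' (e, x) * complex_of_real (deriv (U e) x) \<partial>unit_interval)
          = - cnj (\<integral>x. g (e, x) * complex_of_real (deriv (deriv (U e)) x) \<partial>unit_interval)"
        by simp
      then show "(\<integral>x. f' (e, x) * cnj (g' (e, x)) \<partial>unit_interval) = - (\<integral>x. f'' (e, x) * cnj (g (e, x)) \<partial>unit_interval)"
        unfolding Bochner_Integration.integral_cnj[symmetric]
        by (simp add: f'_def f''_def mult.commute del: Bochner_Integration.integral_cnj)
    qed
    also have "\<dots> = - l2_inner ?M f'' g"
      unfolding infsum_uminus l2_inner_def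
      using edge_integral(2)[OF c l2_mult_integrable(1)[OF l2(3) gl]] by simp
    finally show ?thesis .
  qed
  then have "graph_laplacian G f f''" using dom l2(3) by (simp add: graph_laplacian_def)
  then show ?thesis by (simp add: f_def f''_def)
qed

lemma plateau_in_laplacian_domain:
  assumes c: "countable (arcs G)" and ab: "0 \<le> a" "b \<le> 1" "0 < \<delta>"
  shows "\<exists>h. graph_laplacian G (single_edge e (\<lambda>x. complex_of_real (plateau a b \<delta> x))) h"
proof -
  define U where "U e' = (if e' = e then plateau a b \<delta> else (\<lambda>x. 0))" for e'
  have test0: "test_function (\<lambda>x. 0)"
    by (rule test_function_C2[OF C2_const, of "1/3" "2/3"]) auto
  have "graph_laplacian G (\<lambda>(e, x). complex_of_real (U e x)) (\<lambda>(e, x). complex_of_real (deriv (deriv (U e)) x))"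
  proof (rule smooth_in_laplacian_domain[OF c, of "{e}" "\<lambda>v. 0"])
    show "C2 (U e')" for e' by (simp add: U_def C2_plateau C2_const)
    show "test_function (deriv (U e'))" for e' by (simp add: U_def test0 plateau_test_functions(2)[OF ab])
    have "plateau a b \<delta> 0 = 0" "plateau a b \<delta> 1 = 0" using ab by (auto intro!: plateau_eq_0)
    then show "complex_of_real (U e' 0) = 0" "complex_of_real (U e' 1) = 0" for e' by (simp_all add: U_def)
  qed (simp_all add: U_def)
  moreover have "(\<lambda>(e, x). complex_of_real (U e x)) = single_edge e (\<lambda>x. complex_of_real (plateau a b \<delta> x))"
    by (auto simp: U_def single_edge_def fun_eq_iff)
  ultimately show ?thesis by auto
qed

definition star_function :: "('v, 'e) pre_digraph \<Rightarrow> 'v \<Rightarrow> 'e \<Rightarrow> real \<Rightarrow> real" where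
  "star_function G v e x =
     (if tail G e = v then cutoff x else 0) + (if head G e = v then cutoff (1 - x) else 0)"

lemma C2_star_function: "C2 (star_function G v e)"
proof -
  have r: "C2 (\<lambda>x. cutoff (1 - x))" using C2_affine[OF C2_cutoff, of "-1" 1] by simp
  have ite: "C2 (\<lambda>x. if b then f x else 0)" if "C2 f" for b f
    using that C2_const[of 0] by (cases b) simp_all
  show ?thesis unfolding star_function_def[abs_def] by (rule C2_add[OF ite[OF C2_cutoff] ite[OF r]])
qed

lemma star_function_ends:
  "star_function G v e 0 = of_bool (tail G e = v)" "star_function G v e 1 = of_bool (head G e = v)"
  by (simp_all add: star_function_def cutoff_eq_0 cutoff_eq_1)

lemma star_function_in_laplacian_domain:
  assumes c: "countable (arcs G)" and v: "edegree G v < \<infinity>"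
  shows "\<exists>h. graph_laplacian G (\<lambda>(e, x). complex_of_real (star_function G v e x)) h"
proof -
  have fin: "finite (in_arcs G v)" "finite (out_arcs G v)"
    using v by (auto simp: edegree_def ecard_def split: if_splits)
  show ?thesis
  proof (rule exI, rule smooth_in_laplacian_domain[OF c, of "in_arcs G v \<union> out_arcs G v" "\<lambda>w. of_bool (w = v)"])
    show "finite (in_arcs G v \<union> out_arcs G v)" using fin by simp
    show "finite {w. of_bool (w = v) \<noteq> (0::complex)}" by simp
    show "C2 (star_function G v e)" for e by (rule C2_star_function)
    show "test_function (deriv (star_function G v e))" for e
    proof (rule test_function_deriv_C2[OF C2_star_function, of "1/3" "2/3"])
      show "star_function G v e x = star_function G v e 0" if "x < 1/3" for x
        using that by (simp add: star_function_def cutoff_eq_0 cutoff_eq_1)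
      show "star_function G v e x = star_function G v e 1" if "2/3 < x" for x
        using that by (simp add: star_function_def cutoff_eq_0 cutoff_eq_1)
    qed auto
    show "star_function G v e = (\<lambda>x. 0)" if "e \<in> arcs G" "e \<notin> in_arcs G v \<union> out_arcs G v" for e
      using that by (auto simp: star_function_def fun_eq_iff in_arcs_def out_arcs_def)
  qed (simp_all add: star_function_ends)
qed

section \<open>Boundary values\<close>

text \<open>
  Test the weak derivative of \<open>u\<close> with \<open>\<psi> = s + r - 1\<close>, where \<open>s\<close> rises from \<open>0\<close> to \<open>1\<close> in a region
  close to one end point (or falls, at the other end point), in which \<open>w\<close> differs from its boundary
  value \<open>a\<close> by at most \<open>\<bar>a\<bar> / 2\<close>, and \<open>r\<close> is a fixed cutoff. As \<open>s'\<close> has mean \<open>\<plusminus>1\<close> and constant sign,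
  the term with \<open>s'\<close> is at least \<open>\<bar>a\<bar> / 2\<close>, whereas all others are controlled by \<open>L\<^sup>2\<close> norms.
\<close>

lemma boundary_value_bound_aux:
  fixes s r :: "real \<Rightarrow> real" and \<kappa> :: real
  assumes weak: "has_weak_derivative u v" and u: "u \<in> l2 unit_interval" and v: "v \<in> l2 unit_interval"
    and w: "continuous_on {0..1} w" "AE x in unit_interval. u x = w x"
    and s: "C2 s" and r: "C2 r" and test: "test_function (\<lambda>x. s x + r x - 1)"
    and bd: "\<And>x. \<bar>s x + r x - 1\<bar> \<le> 1"
    and sign: "\<And>x. 0 \<le> \<kappa> * deriv s x" and mass: "\<kappa> * (s 1 - s 0) = 1" and \<kappa>: "\<bar>\<kappa>\<bar> = 1"
    and close: "\<And>x. x \<in> {0..1} \<Longrightarrow> deriv s x \<noteq> 0 \<Longrightarrow> cmod (w x - a) \<le> cmod a / 2"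
  shows "cmod a \<le> 2 * (l2_norm unit_interval v + l2_norm unit_interval (\<lambda>x. complex_of_real (deriv r x)) * l2_norm unit_interval u)"
proof -
  let ?L = unit_interval
  define \<psi> where "\<psi> x = s x + r x - 1" for x
  have deriv_\<psi>: "deriv \<psi> x = deriv s x + deriv r x" for x
  proof (rule DERIV_imp_deriv)
    show "(\<psi> has_real_derivative deriv s x + deriv r x) (at x)"
    proof -
      have "((\<lambda>x. s x + r x - 1) has_real_derivative deriv s x + deriv r x - 0) (at x)"
        by (intro DERIV_diff DERIV_add DERIV_const C2_deriv(1) s r)
      then show ?thesis by (simp add: \<psi>_def[abs_def])
    qed
  qed
  have int_cont: "continuous_on {0..1} k \<Longrightarrow> integrable ?L k" for k :: "real \<Rightarrow> complex"
    by (rule continuous_imp_integrable_real)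
  note sl = l2_of_real[OF C2_deriv(4)[OF s]] and rl = l2_of_real[OF C2_deriv(4)[OF r]]
  have ipair: "integrable ?L (\<lambda>x. f x * complex_of_real (k x))" if "f \<in> l2 ?L" "(\<lambda>x. complex_of_real (k x)) \<in> l2 ?L" for f k
    using l2_mult_integrable(1)[OF that] by simp
  have CS: "cmod (\<integral>x. f x * complex_of_real (k x) \<partial>?L) \<le> l2_norm ?L f * l2_norm ?L (\<lambda>x. complex_of_real (k x))"
    if "f \<in> l2 ?L" "(\<lambda>x. complex_of_real (k x)) \<in> l2 ?L" for f k
    using l2_Cauchy_Schwarz[OF that] by (simp add: l2_inner_def)
  have "(\<integral>x. u x * complex_of_real (deriv \<psi> x) \<partial>?L) = - (\<integral>x. v x * complex_of_real (\<psi> x) \<partial>?L)"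
    using weak test unfolding has_weak_derivative_def \<psi>_def[abs_def] by blast
  moreover have "(\<integral>x. u x * complex_of_real (deriv \<psi> x) \<partial>?L)
      = (\<integral>x. u x * complex_of_real (deriv s x) \<partial>?L) + (\<integral>x. u x * complex_of_real (deriv r x) \<partial>?L)"
    using ipair[OF u sl] ipair[OF u rl] by (simp add: deriv_\<psi> distrib_left)
  ultimately have eq: "(\<integral>x. u x * complex_of_real (deriv s x) \<partial>?L)
      = - (\<integral>x. v x * complex_of_real (\<psi> x) \<partial>?L) - (\<integral>x. u x * complex_of_real (deriv r x) \<partial>?L)"
    by (simp add: algebra_simps)
  have \<psi>l: "(\<lambda>x. complex_of_real (\<psi> x)) \<in> l2 ?L"
    unfolding \<psi>_def by (rule l2_of_real, intro continuous_intros C2_deriv(5) s r)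
  have "l2_norm ?L (\<lambda>x. complex_of_real (\<psi> x)) \<le> 1"
  proof -
    have "l2_norm ?L (\<lambda>x. complex_of_real (\<psi> x)) \<le> 1 * l2_norm ?L (\<lambda>x. 1)"
    proof (rule l2_norm_mono)
      show "(\<lambda>x. complex_of_real (\<psi> x)) \<in> borel_measurable ?L" by (rule l2_measurable[OF \<psi>l])
      show "(\<lambda>x. 1) \<in> l2 ?L" by (rule l2_unit_interval_continuous) simp
      show "AE x in ?L. cmod (complex_of_real (\<psi> x)) \<le> 1 * cmod 1" using bd unfolding \<psi>_def norm_of_real by simp
    qed simp
    also have "l2_norm ?L (\<lambda>x. 1) = 1"
      using integral_unit_interval_derivative[of "\<lambda>x. x" "\<lambda>x. 1"] by (simp add: l2_norm_def)
    finally show ?thesis by simp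
  qed
  then have "l2_norm ?L v * l2_norm ?L (\<lambda>x. complex_of_real (\<psi> x)) \<le> l2_norm ?L v"
    by (simp add: mult_left_le)
  then have vpart: "cmod (\<integral>x. v x * complex_of_real (\<psi> x) \<partial>?L) \<le> l2_norm ?L v"
    using CS[OF v \<psi>l] by linarith
  have upper: "cmod (\<integral>x. u x * complex_of_real (deriv s x) \<partial>?L)
      \<le> l2_norm ?L v + l2_norm ?L (\<lambda>x. complex_of_real (deriv r x)) * l2_norm ?L u"
    unfolding eq using norm_triangle_ineq4[of "- (\<integral>x. v x * complex_of_real (\<psi> x) \<partial>?L)" "\<integral>x. u x * complex_of_real (deriv r x) \<partial>?L"]
      vpart CS[OF u rl] by (simp add: mult.commute)
  have w_l2: "w \<in> l2 ?L" by (rule l2_unit_interval_continuous[OF w(1)])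
  have "(\<integral>x. u x * complex_of_real (deriv s x) \<partial>?L) = (\<integral>x. w x * complex_of_real (deriv s x) \<partial>?L)"
  proof (rule integral_cong_AE)
    show "AE x in ?L. u x * complex_of_real (deriv s x) = w x * complex_of_real (deriv s x)"
      using w(2) by eventually_elim simp
    show "(\<lambda>x. u x * complex_of_real (deriv s x)) \<in> borel_measurable ?L" by (rule borel_measurable_integrable[OF ipair[OF u sl]])
    show "(\<lambda>x. w x * complex_of_real (deriv s x)) \<in> borel_measurable ?L" by (rule borel_measurable_integrable[OF ipair[OF w_l2 sl]])
  qed
  also have "\<dots> = (\<integral>x. (w x - a) * complex_of_real (deriv s x) \<partial>?L) + a * complex_of_real (s 1 - s 0)"
  proof -
    have al: "(\<lambda>x. a) \<in> l2 ?L" by (rule l2_unit_interval_continuous) simp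
    have I: "(\<integral>x. a * complex_of_real (deriv s x) \<partial>?L) = a * complex_of_real (s 1 - s 0)"
      unfolding integral_unit_interval_derivative[OF C2_deriv(1)[OF s] C2_deriv(4)[OF s], symmetric]
      by simp
    show ?thesis
      unfolding left_diff_distrib Bochner_Integration.integral_diff[OF ipair[OF w_l2 sl] ipair[OF al sl]] I
      by (rule diff_add_cancel[symmetric])
  qed
  finally have split: "(\<integral>x. u x * complex_of_real (deriv s x) \<partial>?L)
      = (\<integral>x. (w x - a) * complex_of_real (deriv s x) \<partial>?L) + a * complex_of_real (s 1 - s 0)" .
  have "\<bar>s 1 - s 0\<bar> = 1"
  proof -
    have "\<bar>\<kappa> * (s 1 - s 0)\<bar> = 1" using mass by simp
    then show ?thesis using \<kappa> by (simp add: abs_mult)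
  qed
  then have "cmod (a * complex_of_real (s 1 - s 0)) = cmod a"
    by (simp only: norm_mult norm_of_real mult_1_right)
  moreover have "cmod (\<integral>x. (w x - a) * complex_of_real (deriv s x) \<partial>?L) \<le> cmod a / 2"
  proof -
    have "cmod (\<integral>x. (w x - a) * complex_of_real (deriv s x) \<partial>?L) \<le> (\<integral>x. cmod ((w x - a) * complex_of_real (deriv s x)) \<partial>?L)"
      by (rule integral_norm_bound)
    also have "\<dots> \<le> (\<integral>x. cmod a / 2 * (\<kappa> * deriv s x) \<partial>?L)"
    proof (rule integral_mono)
      show "integrable ?L (\<lambda>x. cmod ((w x - a) * complex_of_real (deriv s x)))"
        by (intro integrable_norm int_cont continuous_on_of_real continuous_intros w(1) continuous_on_subset[OF C2_deriv(4)[OF s] subset_UNIV])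
      show "integrable ?L (\<lambda>x. cmod a / 2 * (\<kappa> * deriv s x))"
        by (intro continuous_imp_integrable_real continuous_intros continuous_on_subset[OF C2_deriv(4)[OF s] subset_UNIV])
      fix x assume "x \<in> space ?L"
      then have x: "x \<in> {0..1}" by simp
      have "\<bar>deriv s x\<bar> = \<kappa> * deriv s x"
        using sign[of x] \<kappa> by (metis abs_mult abs_of_nonneg mult_1)
      moreover have "cmod (w x - a) * \<bar>deriv s x\<bar> \<le> cmod a / 2 * \<bar>deriv s x\<bar>"
        using close[OF x] by (cases "deriv s x = 0") (auto intro: mult_right_mono)
      ultimately show "cmod ((w x - a) * complex_of_real (deriv s x)) \<le> cmod a / 2 * (\<kappa> * deriv s x)"
        by (simp only: norm_mult norm_of_real)
    qed
    also have "\<dots> = cmod a / 2 * (\<kappa> * (s 1 - s 0))"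
      unfolding integral_unit_interval_derivative[OF C2_deriv(1)[OF s] C2_deriv(4)[OF s], symmetric]
      by simp
    finally show ?thesis unfolding mass by simp
  qed
  moreover have "cmod (a * complex_of_real (s 1 - s 0))
      \<le> cmod (\<integral>x. u x * complex_of_real (deriv s x) \<partial>?L) + cmod (\<integral>x. (w x - a) * complex_of_real (deriv s x) \<partial>?L)"
    using norm_triangle_ineq4[of "\<integral>x. u x * complex_of_real (deriv s x) \<partial>?L" "\<integral>x. (w x - a) * complex_of_real (deriv s x) \<partial>?L"]
    unfolding split by simp
  moreover have "q \<le> 2 * X" if "p = q" "m \<le> q / 2" "p \<le> t + m" "t \<le> X" for p q m t X :: real
    using that by linarith
  ultimately show ?thesis using upper by blast
qed

lemma mono_smooth_step: "mono smooth_step"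
proof (rule monoI)
  fix x y :: real assume xy: "x \<le> y"
  define p q where "p t = max 0 t ^ 3" and "q t = max 0 (1 - t) ^ 3" for t :: real
  have "p x \<le> p y" "q y \<le> q x" unfolding p_def q_def using xy by (auto intro!: power_mono)
  then have "p x * q y \<le> p y * q x" by (intro mult_mono) (auto simp: p_def q_def)
  then have "p x * (p y + q y) \<le> p y * (p x + q x)" by (simp add: algebra_simps)
  moreover have "0 < p x + q x" "0 < p y + q y" unfolding p_def q_def by (rule smooth_step_denominator)+
  ultimately have "p x / (p x + q x) \<le> p y / (p y + q y)" by (simp add: frac_le_eq divide_simps mult.commute)
  then show "smooth_step x \<le> smooth_step y" by (simp add: smooth_step_def p_def q_def divide_inverse)
qed

lemma deriv_smooth_step_nonneg: "0 \<le> deriv smooth_step x"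
  by (rule mono_on_imp_deriv_nonneg[OF _ C2_deriv(1)[OF C2_smooth_step], of UNIV])
    (use mono_smooth_step in \<open>auto simp: mono_on_def mono_def\<close>)

lemma deriv_affine:
  assumes "C2 f" shows "deriv (\<lambda>x. f (a * x + b)) x = deriv f (a * x + b) * a"
  by (rule DERIV_imp_deriv, rule DERIV_chain2[OF C2_deriv(1)[OF assms]]) (auto intro!: derivative_eq_intros)

text \<open>
  The trace inequality for \<open>H\<^sup>1(0, 1)\<close>. The modulus of continuity of \<open>w\<close> determines the region where \<open>s\<close>
  varies, but the resulting estimate involves \<open>s\<close> no more, so its constant is universal.
\<close>

lemma boundary_value_bound:
  obtains C where "0 \<le> C"
    "\<And>u v a b. has_weak_derivative u v \<Longrightarrow> u \<in> l2 unit_interval \<Longrightarrow> v \<in> l2 unit_interval \<Longrightarrow>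
      has_boundary_values u a b \<Longrightarrow>
      cmod a \<le> C * (l2_norm unit_interval v + l2_norm unit_interval u) \<and>
      cmod b \<le> C * (l2_norm unit_interval v + l2_norm unit_interval u)"
proof -
  let ?L = unit_interval
  \<comment> \<open>\<open>D p x\<close> is the distance of \<open>x\<close> to the end point \<open>p \<in> {0, 1}\<close>, written as an affine function.\<close>
  define k D where "k p = 1 - 2 * p" and "D p x = k p * x + p" for p x :: real
  define r where "r p x = cutoff (D p x)" for p x
  have C2r: "C2 (r p)" for p
    unfolding r_def[abs_def] D_def[abs_def] by (rule C2_affine[OF C2_cutoff])
  define N where "N p = l2_norm ?L (\<lambda>x. complex_of_real (deriv (r p) x))" for p
  define C where "C = 2 * (1 + N 0 + N 1)"
  have N: "0 \<le> N p" for p by (simp add: N_def)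
  have main: "cmod (w p) \<le> C * (l2_norm ?L v + l2_norm ?L u)"
    if weak: "has_weak_derivative u v" and u: "u \<in> l2 ?L" and v: "v \<in> l2 ?L"
      and w: "continuous_on {0..1} w" "AE x in ?L. u x = w x" and p: "p = 0 \<or> p = 1" for u v w and p :: real
  proof (cases "w p = 0")
    case False
    have D: "D p x = \<bar>x - p\<bar>" if "x \<in> {0..1}" for x using p that by (auto simp: D_def k_def)
    have "p \<in> {0..1}" "0 < cmod (w p) / 2" using p False by auto
    then obtain d where d: "0 < d" "\<And>x. x \<in> {0..1} \<Longrightarrow> dist x p < d \<Longrightarrow> dist (w x) (w p) < cmod (w p) / 2"
      using w(1) unfolding continuous_on_iff by blast
    define \<epsilon> where "\<epsilon> = min (d / 4) (1/6)"
    have \<epsilon>: "0 < \<epsilon>" "2 * \<epsilon> < d" "2 * \<epsilon> \<le> 1/3" using d(1) by (auto simp: \<epsilon>_def min_def)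
    define s where "s x = smooth_step ((k p / \<epsilon>) * x + (p / \<epsilon> - 1))" for x
    have arg: "(k p / \<epsilon>) * x + (p / \<epsilon> - 1) = D p x / \<epsilon> - 1" for x
      by (simp add: D_def add_divide_distrib)
    have C2s: "C2 s" unfolding s_def[abs_def] by (rule C2_affine[OF C2_smooth_step])
    have ds: "deriv s x = deriv smooth_step (D p x / \<epsilon> - 1) * (k p / \<epsilon>)" for x
      using deriv_affine[OF C2_smooth_step, of "k p / \<epsilon>" "p / \<epsilon> - 1" x] unfolding s_def[abs_def] arg .
    have s0: "s x = 0" if "D p x \<le> \<epsilon>" for x
      unfolding s_def arg using that \<epsilon>(1) by (intro smooth_step_0) (simp add: field_simps)
    have s1: "s x = 1" if "2 * \<epsilon> \<le> D p x" for x
      unfolding s_def arg using that \<epsilon>(1) by (intro smooth_step_1) (simp add: field_simps)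
    have "cmod (w p) \<le> 2 * (l2_norm ?L v + N p * l2_norm ?L u)"
      unfolding N_def
    proof (rule boundary_value_bound_aux[OF weak u v w C2s C2r[of p], of "k p"])
      show "test_function (\<lambda>x. s x + r p x - 1)"
      proof (rule test_function_C2[of _ \<epsilon> "1 - \<epsilon>"])
        show "C2 (\<lambda>x. s x + r p x - 1)"
          using C2_add[OF C2_add[OF C2s C2r[of p]] C2_const[of "-1"]] by simp
        show "s x + r p x - 1 = 0" if "x \<notin> {\<epsilon>..1 - \<epsilon>}" for x
        proof -
          have "D p x < \<epsilon> \<or> 1 - \<epsilon> < D p x" using that p by (auto simp: D_def k_def)
          then show ?thesis
          proof
            assume "D p x < \<epsilon>"
            then show ?thesis using s0[of x] \<epsilon>(3) by (simp add: r_def cutoff_eq_1)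
          next
            assume "1 - \<epsilon> < D p x"
            then show ?thesis using s1[of x] \<epsilon>(3) by (simp add: r_def cutoff_eq_0)
          qed
        qed
      qed (use \<epsilon>(1) in auto)
      show "\<bar>s x + r p x - 1\<bar> \<le> 1" for x
        using smooth_step_bounds[of "D p x / \<epsilon> - 1"] cutoff_bounds[of "D p x"]
        unfolding s_def r_def arg by linarith
      have "k p * k p = 1" using p by (auto simp: k_def)
      then have "k p * deriv s x = deriv smooth_step (D p x / \<epsilon> - 1) / \<epsilon>" for x
        unfolding ds by (simp add: mult.left_commute[of "k p"] divide_inverse mult.assoc[symmetric])
      then show "0 \<le> k p * deriv s x" for x using deriv_smooth_step_nonneg \<epsilon>(1) by simp
      show "k p * (s 1 - s 0) = 1"
        using s0[of p] s1[of "1 - p"] p \<epsilon>(1,3) by (auto simp: D_def k_def)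
      show "\<bar>k p\<bar> = 1" using p by (auto simp: k_def)
      show "cmod (w x - w p) \<le> cmod (w p) / 2" if x: "x \<in> {0..1}" and nz: "deriv s x \<noteq> 0" for x
      proof -
        have "open {y. 2 * \<epsilon> < D p y}"
          unfolding D_def by (intro open_Collect_less continuous_intros)
        then have "\<not> 2 * \<epsilon> < D p x"
          using nz deriv_eq_0_if_locally_const[of "{y. 2 * \<epsilon> < D p y}" x s 1] s1 by auto
        then have "dist x p < d" using D[OF x] \<epsilon>(2) by (simp add: dist_real_def)
        then show ?thesis using d(2)[OF x] by (simp add: dist_norm)
      qed
    qed
    also have "\<dots> \<le> C * (l2_norm ?L v + l2_norm ?L u)"
    proof -
      have "N p \<le> 1 + N 0 + N 1" using p N[of 0] N[of 1] by auto
      then have "N p * l2_norm ?L u \<le> (1 + N 0 + N 1) * l2_norm ?L u" by (rule mult_right_mono) simp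
      moreover have "1 * l2_norm ?L v \<le> (1 + N 0 + N 1) * l2_norm ?L v"
        using N[of 0] N[of 1] by (intro mult_right_mono) auto
      ultimately show ?thesis unfolding C_def mult.assoc distrib_left[of "1 + N 0 + N 1"] by simp
    qed
    finally show ?thesis .
  qed (use N in \<open>simp add: C_def\<close>)
  show ?thesis
  proof (rule that)
    show "0 \<le> C" using N by (simp add: C_def)
    show "cmod a \<le> C * (l2_norm ?L v + l2_norm ?L u) \<and> cmod b \<le> C * (l2_norm ?L v + l2_norm ?L u)"
      if "has_weak_derivative u v" "u \<in> l2 ?L" "v \<in> l2 ?L" and bv: "has_boundary_values u a b" for u v a b
    proof -
      obtain w where w: "continuous_on {0..1} w" "AE x in ?L. u x = w x" "w 0 = a" "w 1 = b"
        using bv unfolding has_boundary_values_def by blast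
      show ?thesis using main[OF that(1-3) w(1,2), of 0] main[OF that(1-3) w(1,2), of 1] unfolding w(3,4) by simp
    qed
  qed
qed

text \<open>
  By the trace inequality, every edge at \<open>v\<close> contributes at least a fixed multiple of \<open>\<bar>d v\<bar>\<^sup>2\<close> to the
  \<open>H\<^sup>1\<close> norm of \<open>f\<close>, which is finite.
\<close>

lemma form_domain_boundary_zero_at_infinite_node:
  assumes c: "countable (arcs G)" and f: "f \<in> form_domain G"
    and bv: "\<And>e. e \<in> arcs G \<Longrightarrow> has_boundary_values (\<lambda>x. f (e, x)) (d (tail G e)) (d (head G e))"
    and v: "edegree G v = \<infinity>"
  shows "d v = 0"
proof (rule ccontr)
  assume nz: "d v \<noteq> 0"
  let ?L = unit_interval
  obtain C where C: "0 \<le> C" "\<And>u v a b. has_weak_derivative u v \<Longrightarrow> u \<in> l2 ?L \<Longrightarrow> v \<in> l2 ?L \<Longrightarrow>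
      has_boundary_values u a b \<Longrightarrow> cmod a \<le> C * (l2_norm ?L v + l2_norm ?L u) \<and> cmod b \<le> C * (l2_norm ?L v + l2_norm ?L u)"
    by (rule boundary_value_bound) (rule that)
  have fl: "f \<in> l2 (edge_measure G)" and fH: "f \<in> edge_H1 G" using f by (auto simp: form_domain_def edge_H1_def)
  define f' where "f' = edge_deriv G f"
  have f': "edgewise_weak_derivative G f f'" unfolding f'_def by (rule edge_H1_deriv[OF fH])
  note f'l = edgewise_weak_derivative_l2[OF f']
  define E where "E = in_arcs G v \<union> out_arcs G v"
  have E: "E \<subseteq> arcs G" by (auto simp: E_def in_arcs_def out_arcs_def)
  have inf: "infinite E" using v by (auto simp: E_def edegree_def ecard_def split: if_splits)
  define n where "n e = (l2_norm ?L (\<lambda>x. f' (e, x)))\<^sup>2 + (l2_norm ?L (\<lambda>x. f (e, x)))\<^sup>2" for e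
  have sum: "n summable_on E"
    unfolding n_def[abs_def]
    by (rule summable_on_subset_banach[OF summable_on_add[OF l2_norm_edge_section_summable[OF c f'l] l2_norm_edge_section_summable[OF c fl]] E])
  have le: "(cmod (d v))\<^sup>2 \<le> 2 * C\<^sup>2 * n e" if e: "e \<in> E" for e
  proof -
    have eG: "e \<in> arcs G" using e E by auto
    have weak: "has_weak_derivative (\<lambda>x. f (e, x)) (\<lambda>x. f' (e, x))"
      using f' eG by (simp add: edgewise_weak_derivative_def)
    let ?p = "l2_norm ?L (\<lambda>x. f' (e, x))" and ?q = "l2_norm ?L (\<lambda>x. f (e, x))"
    have "cmod (d v) \<le> C * (?p + ?q)"
      using C(2)[OF weak l2_edge_section[OF c fl eG] l2_edge_section[OF c f'l eG] bv[OF eG]] e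
      by (auto simp: E_def in_arcs_def out_arcs_def)
    then have "(cmod (d v))\<^sup>2 \<le> (C * (?p + ?q))\<^sup>2" by (rule power_mono) simp
    also have "\<dots> = C\<^sup>2 * (?p + ?q)\<^sup>2" by (rule power_mult_distrib)
    also have "\<dots> \<le> C\<^sup>2 * (2 * (?p\<^sup>2 + ?q\<^sup>2))"
      using sum_squares_bound[of ?p ?q] by (intro mult_left_mono) (auto simp: power2_sum)
    finally show ?thesis by (simp add: n_def algebra_simps)
  qed
  have "(\<lambda>e. 2 * C\<^sup>2 * n e) summable_on E" by (rule summable_on_cmult_right[OF sum])
  then have "(\<lambda>e. (cmod (d v))\<^sup>2) summable_on E"
    by (rule summable_on_comparison_test) (use le in auto)
  moreover have "\<not> (\<lambda>e. (cmod (d v))\<^sup>2) summable_on E"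
    by (rule infsum_diverge_constant[OF inf]) (use nz in simp)
  ultimately show False by simp
qed

text \<open>
  \<open>finitely_closed G B\<close> says that no path without infinite stars leaves the set \<open>B\<close> of edges.
\<close>

definition finitely_closed :: "('v, 'e) pre_digraph \<Rightarrow> 'e set \<Rightarrow> bool" where
  "finitely_closed G B \<longleftrightarrow> B \<subseteq> arcs G \<and>
     (\<forall>e\<in>B. \<forall>e'\<in>arcs G - B. \<forall>v. incident G e v \<longrightarrow> incident G e' v \<longrightarrow> edegree G v = \<infinity>)"

lemma edge_set_in_sets: "B \<subseteq> arcs G \<Longrightarrow> B \<times> {0..1} \<in> sets (edge_measure G)"
  unfolding edge_measure_def by (rule pair_measureI) auto

lemma has_weak_derivative_cong:
  assumes "\<And>x. x \<in> {0..1} \<Longrightarrow> u x = u' x" "\<And>x. x \<in> {0..1} \<Longrightarrow> v x = v' x" "has_weak_derivative u v"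
  shows "has_weak_derivative u' v'"
proof -
  have "(\<integral>x. u' x * complex_of_real (k x) \<partial>unit_interval) = (\<integral>x. u x * complex_of_real (k x) \<partial>unit_interval)"
    "(\<integral>x. v' x * complex_of_real (k x) \<partial>unit_interval) = (\<integral>x. v x * complex_of_real (k x) \<partial>unit_interval)" for k
    by (rule Bochner_Integration.integral_cong; use assms(1,2) in simp)+
  then show ?thesis using assms(3) by (simp add: has_weak_derivative_def)
qed

text \<open>
  Cutting off a function in the form domain along a finitely closed set of edges can destroy its
  continuity only at nodes of infinite degree, where it vanishes.
\<close>

lemma indicator_form_domain:
  assumes c: "countable (arcs G)" and B: "finitely_closed G B" and f: "f \<in> form_domain G"
  shows "(\<lambda>z. indicator (B \<times> {0..1}) z * f z) \<in> form_domain G"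
    and "edgewise_weak_derivative G (\<lambda>z. indicator (B \<times> {0..1}) z * f z) (\<lambda>z. indicator (B \<times> {0..1}) z * edge_deriv G f z)"
proof -
  let ?i = "indicator (B \<times> {0..1}) :: _ \<Rightarrow> complex"
  have BG: "B \<subseteq> arcs G" using B by (simp add: finitely_closed_def)
  have fl: "f \<in> l2 (edge_measure G)" and fH: "f \<in> edge_H1 G" using f by (auto simp: form_domain_def edge_H1_def)
  obtain d where d: "(\<lambda>v. (cmod (d v))\<^sup>2) summable_on verts G"
    "\<And>e. e \<in> arcs G \<Longrightarrow> has_boundary_values (\<lambda>x. f (e, x)) (d (tail G e)) (d (head G e))"
    using f by (auto simp: form_domain_def)
  note f' = edge_H1_deriv[OF fH]
  have wd0: "has_weak_derivative (\<lambda>x. 0) (\<lambda>x. 0)" by (simp add: has_weak_derivative_def)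
  show ed: "edgewise_weak_derivative G (\<lambda>z. ?i z * f z) (\<lambda>z. ?i z * edge_deriv G f z)"
    unfolding edgewise_weak_derivative_def
  proof (intro conjI ballI)
    show "(\<lambda>z. ?i z * edge_deriv G f z) \<in> l2 (edge_measure G)"
      by (rule l2_indicator_mult[OF edgewise_weak_derivative_l2[OF f'] edge_set_in_sets[OF BG]])
    fix e assume e: "e \<in> arcs G"
    show "has_weak_derivative (\<lambda>x. ?i (e, x) * f (e, x)) (\<lambda>x. ?i (e, x) * edge_deriv G f (e, x))"
    proof (cases "e \<in> B")
      case True
      have "has_weak_derivative (\<lambda>x. f (e, x)) (\<lambda>x. edge_deriv G f (e, x))"
        using f' e by (simp add: edgewise_weak_derivative_def)
      then show ?thesis by (rule has_weak_derivative_cong[rotated 2]) (use True in simp_all)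
    next
      case False
      then show ?thesis by (intro has_weak_derivative_cong[OF _ _ wd0]) simp_all
    qed
  qed
  have il: "(\<lambda>z. ?i z * f z) \<in> l2 (edge_measure G)" by (rule l2_indicator_mult[OF fl edge_set_in_sets[OF BG]])
  define d' where "d' v = (if \<exists>e\<in>B. incident G e v then d v else 0)" for v
  have "has_boundary_values (\<lambda>x. ?i (e, x) * f (e, x)) (d' (tail G e)) (d' (head G e))" if e: "e \<in> arcs G" for e
  proof (cases "e \<in> B")
    case True
    then have "d' (tail G e) = d (tail G e)" "d' (head G e) = d (head G e)"
      by (auto simp: d'_def incident_def)
    moreover obtain w where w: "continuous_on {0..1} w" "AE x in unit_interval. f (e, x) = w x"
      "w 0 = d (tail G e)" "w 1 = d (head G e)"
      using d(2)[OF e] by (auto simp: has_boundary_values_def)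
    moreover have "AE x in unit_interval. ?i (e, x) * f (e, x) = w x"
      using w(2) AE_space by eventually_elim (use True in simp)
    ultimately show ?thesis unfolding has_boundary_values_def by auto
  next
    case False
    have "d' v = 0" if v: "incident G e v" for v
    proof (cases "\<exists>e\<in>B. incident G e v")
      case True
      then have "edegree G v = \<infinity>" using B e False v by (auto simp: finitely_closed_def)
      from form_domain_boundary_zero_at_infinite_node[OF c f _ this] d(2) have "d v = 0" by blast
      then show ?thesis by (simp add: d'_def)
    qed (simp add: d'_def)
    then have "d' (tail G e) = 0" "d' (head G e) = 0" by (simp_all add: incident_def)
    moreover have "has_boundary_values (\<lambda>x. ?i (e, x) * f (e, x)) 0 0"
      unfolding has_boundary_values_def using False by (intro exI[of _ "\<lambda>x. 0"]) simp
    ultimately show ?thesis by simp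
  qed
  moreover have "(\<lambda>v. (cmod (d' v))\<^sup>2) summable_on verts G"
    by (rule summable_on_comparison_test[OF d(1)]) (auto simp: d'_def)
  ultimately show "(\<lambda>z. ?i z * f z) \<in> form_domain G"
    using il ed unfolding form_domain_def edge_H1_def by blast
qed

text \<open>
  The multiplier commutes with edgewise differentiation, so it can be moved from one argument of the
  energy form to the other.
\<close>

lemma laplacian_intertwines_indicator:
  assumes c: "countable (arcs G)" and B: "finitely_closed G B"
    and fh: "graph_laplacian G f h" and gk: "graph_laplacian G g k"
  shows "l2_inner (edge_measure G) (\<lambda>z. indicator (B \<times> {0..1}) z * h z) g
    = l2_inner (edge_measure G) (\<lambda>z. indicator (B \<times> {0..1}) z * f z) k"
proof -
  let ?M = "edge_measure G"
  let ?i = "indicator (B \<times> {0..1}) :: _ \<Rightarrow> complex"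
  have f: "f \<in> form_domain G" and g: "g \<in> form_domain G" using fh gk by (auto simp: graph_laplacian_def)
  have fl: "f \<in> l2 ?M" "f \<in> edge_H1 G" and gl: "g \<in> l2 ?M" "g \<in> edge_H1 G"
    using f g by (auto simp: form_domain_def edge_H1_def)
  have Pl: "(\<lambda>z. ?i z * u z) \<in> l2 ?M" if "u \<in> l2 ?M" for u
    using l2_indicator_mult[OF that edge_set_in_sets] B by (simp add: finitely_closed_def)
  have swap: "l2_inner ?M (\<lambda>z. ?i z * u z) w = l2_inner ?M u (\<lambda>z. ?i z * w z)" for u w
    unfolding l2_inner_def by (rule Bochner_Integration.integral_cong) (auto simp: indicator_def)
  note f' = edge_H1_deriv[OF fl(2)] and g' = edge_H1_deriv[OF gl(2)]
  note Pf = indicator_form_domain[OF c B f] and Pg = indicator_form_domain[OF c B g]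
  have "l2_inner ?M (\<lambda>z. ?i z * h z) g = l2_inner ?M h (\<lambda>z. ?i z * g z)" by (rule swap)
  also have "\<dots> = - energy_form G f (\<lambda>z. ?i z * g z)" using fh Pg(1) by (simp add: graph_laplacian_def)
  also have "energy_form G f (\<lambda>z. ?i z * g z) = l2_inner ?M (edge_deriv G f) (\<lambda>z. ?i z * edge_deriv G g z)"
    by (rule energy_form_eq_l2_inner[OF c fl(1) Pl[OF gl(1)] f' Pg(2)])
  also have "\<dots> = l2_inner ?M (\<lambda>z. ?i z * edge_deriv G f z) (edge_deriv G g)" by (rule swap[symmetric])
  also have "\<dots> = cnj (l2_inner ?M (edge_deriv G g) (\<lambda>z. ?i z * edge_deriv G f z))" by (rule l2_inner_cnj[symmetric])
  also have "l2_inner ?M (edge_deriv G g) (\<lambda>z. ?i z * edge_deriv G f z) = energy_form G g (\<lambda>z. ?i z * f z)"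
    by (rule energy_form_eq_l2_inner[OF c gl(1) Pl[OF fl(1)] g' Pf(2), symmetric])
  also have "\<dots> = - l2_inner ?M k (\<lambda>z. ?i z * f z)" using gk Pf(1) by (simp add: graph_laplacian_def)
  also have "- cnj (- l2_inner ?M k (\<lambda>z. ?i z * f z)) = l2_inner ?M (\<lambda>z. ?i z * f z) k"
    by (simp add: l2_inner_cnj)
  finally show ?thesis .
qed

section \<open>Finite spans\<close>

lemma edge_path_append:
  assumes p: "edge_path G e es vs e'" and e'': "e'' \<in> arcs G" and v: "v \<in> verts G"
    and inc: "incident G e' v" "incident G e'' v"
  shows "edge_path G e (es @ [e'']) (vs @ [v]) e''"
proof -
  have len: "length es = Suc (length vs)" and hd: "hd es = e" and last: "last es = e'"
    and inc0: "\<And>i. i < length vs \<Longrightarrow> incident G (es ! i) (vs ! i) \<and> incident G (es ! Suc i) (vs ! i)"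
    using p by (auto simp: edge_path_def)
  have ne: "es \<noteq> []" using len by auto
  have lastn: "es ! length vs = e'" using last len ne by (simp add: last_conv_nth)
  have "incident G ((es @ [e'']) ! i) ((vs @ [v]) ! i) \<and> incident G ((es @ [e'']) ! Suc i) ((vs @ [v]) ! i)"
    if "i < length (vs @ [v])" for i
  proof (cases "i < length vs")
    case True
    then show ?thesis using inc0[OF True] len by (simp add: nth_append)
  next
    case False
    with that have "i = length vs" by simp
    then show ?thesis using inc lastn len by (simp add: nth_append)
  qed
  then show ?thesis
    using p e'' v len hd ne unfolding edge_path_def by simp
qed

lemma arcs_finite_span:
  "arcs (finite_span G e) = {e'. \<exists>es vs. edge_path G e es vs e' \<and> finite_weight G vs}"
  by (simp add: finite_span_def Let_def)

lemma finite_span_subset: "arcs (finite_span G e) \<subseteq> arcs G"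
proof
  fix e' assume "e' \<in> arcs (finite_span G e)"
  then obtain es vs where "edge_path G e es vs e'" by (auto simp: arcs_finite_span)
  then have "last es = e'" "set es \<subseteq> arcs G" "es \<noteq> []" by (auto simp: edge_path_def)
  then show "e' \<in> arcs G" by auto
qed

lemma finite_span_refl:
  assumes "e \<in> arcs G" shows "e \<in> arcs (finite_span G e)"
proof -
  have "edge_path G e [e] [] e \<and> finite_weight G []" using assms by (simp add: edge_path_def finite_weight_def)
  then show ?thesis unfolding arcs_finite_span by blast
qed

lemma complement_finite_span_finitely_closed:
  assumes wf: "wf_digraph G"
  shows "finitely_closed G (arcs G - arcs (finite_span G e))"
  unfolding finitely_closed_def
proof (intro conjI ballI allI impI)
  fix e1 e2 v
  assume e1: "e1 \<in> arcs G - arcs (finite_span G e)" and e2: "e2 \<in> arcs G - (arcs G - arcs (finite_span G e))"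
    and inc: "incident G e1 v" "incident G e2 v"
  show "edegree G v = \<infinity>"
  proof (rule ccontr)
    assume fin: "edegree G v \<noteq> \<infinity>"
    from e2 obtain es vs where p: "edge_path G e es vs e2" "finite_weight G vs"
      by (auto simp: arcs_finite_span)
    have "v \<in> verts G" using inc(1) e1 wf by (auto simp: incident_def wf_digraph_def)
    then have "edge_path G e (es @ [e1]) (vs @ [v]) e1" using edge_path_append[OF p(1)] e1 inc by blast
    moreover have "finite_weight G (vs @ [v])" using p(2) fin by (auto simp: finite_weight_def)
    ultimately have "e1 \<in> arcs (finite_span G e)" unfolding arcs_finite_span by blast
    then show False using e1 by simp
  qed
qed auto

lemma edge_path_invariant:
  assumes p: "edge_path G e es vs e'" and w: "finite_weight G vs"
    and inv: "\<And>a b v. a \<in> arcs G \<Longrightarrow> b \<in> arcs G \<Longrightarrow> incident G a v \<Longrightarrow> incident G b v \<Longrightarrow>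
      edegree G v < \<infinity> \<Longrightarrow> P a = P b"
  shows "P e' = P e"
proof -
  have es: "length es = Suc (length vs)" "set es \<subseteq> arcs G" "hd es = e" "last es = e'"
    and inc: "\<And>i. i < length vs \<Longrightarrow> incident G (es ! i) (vs ! i) \<and> incident G (es ! Suc i) (vs ! i)"
    using p by (auto simp: edge_path_def)
  have "P (es ! i) = P e" if "i \<le> length vs" for i
    using that
  proof (induction i)
    case 0
    have "es \<noteq> []" using es(1) by auto
    then show ?case using es(3) by (simp add: hd_conv_nth)
  next
    case (Suc i)
    then have i: "i < length vs" by simp
    have "es ! i \<in> arcs G" "es ! Suc i \<in> arcs G" using es(1,2) i by (auto simp: subset_iff)
    moreover have "edegree G (vs ! i) < \<infinity>" using w i by (simp add: finite_weight_def)
    ultimately have "P (es ! i) = P (es ! Suc i)" using inv inc[OF i] by blast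
    then show ?case using Suc by simp
  qed
  from this[of "length vs"] have "P (es ! length vs) = P e" by simp
  moreover have "es ! length vs = e'"
  proof -
    have "es \<noteq> []" using es(1) by auto
    then show ?thesis using es(1,4) by (simp add: last_conv_nth)
  qed
  ultimately show ?thesis by simp
qed

section \<open>Irreducibility\<close>

lemma heat_generator_iff: "heat_semigroup G T \<Longrightarrow> generator (edge_measure G) T f h \<longleftrightarrow> graph_laplacian G f h"
  by (simp add: heat_semigroup_def)

lemma heat_c0_semigroup: "heat_semigroup G T \<Longrightarrow> c0_semigroup (edge_measure G) T"
  by (simp add: heat_semigroup_def)

lemma heat_generator_dense:
  assumes c: "countable (arcs G)" and heat: "heat_semigroup G T"
    and f: "f \<in> l2 (edge_measure G)" and \<epsilon>: "0 < \<epsilon>"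
  shows "\<exists>g h. generator (edge_measure G) T g h \<and> l2_norm (edge_measure G) (\<lambda>z. f z - g z) < \<epsilon>"
proof -
  let ?M = "edge_measure G"
  note T = heat_c0_semigroup[OF heat]
  define X where "X = {g. \<exists>h. generator ?M T g h}"
  have plateau: "single_edge e (\<lambda>x. complex_of_real (plateau a b \<delta> x)) \<in> X" if "0 \<le> a" "b \<le> 1" "0 < \<delta>" for e a b \<delta>
    using plateau_in_laplacian_domain[OF c that, of e] by (simp add: X_def heat_generator_iff[OF heat])
  have lin: "(\<lambda>z. r * g z + h z) \<in> X" if "g \<in> X" "h \<in> X" for r g h
    using that generator_linear[OF T] unfolding X_def by blast
  note p = plateau[of 0 1 1 undefined, simplified]
  have zero: "(\<lambda>z. 0) \<in> X" using lin[OF p p, of "-1"] by simp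
  have "X \<subseteq> l2 ?M" using generator_l2(1) unfolding X_def by blast
  from subspace_with_plateaus_dense[OF c this lin zero plateau f \<epsilon>]
  show ?thesis unfolding X_def by blast
qed

lemma heat_invariant_ideal:
  assumes c: "countable (arcs G)" and heat: "heat_semigroup G T"
    and A: "A \<subseteq> arcs G" and B: "finitely_closed G (arcs G - A)" and t: "0 \<le> t"
  shows "T t ` l2_ideal (edge_measure G) (A \<times> {0..1}) \<subseteq> l2_ideal (edge_measure G) (A \<times> {0..1})"
proof (rule invariant_ideal_if_intertwines[OF heat_c0_semigroup[OF heat] t edge_set_in_sets[OF A]])
  let ?M = "edge_measure G"
  let ?p = "indicator ((arcs G - A) \<times> {0..1}) :: _ \<Rightarrow> complex"
  fix f g assume f: "f \<in> l2 ?M" and g: "g \<in> l2 ?M"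
  have eq: "space ?M - A \<times> {0..1} = (arcs G - A) \<times> {0..1}" by (auto simp: space_edge_measure)
  have "l2_inner ?M (\<lambda>z. ?p z * T t f z) g = l2_inner ?M (\<lambda>z. ?p z * f z) (T t g)"
  proof (rule semigroup_intertwines[OF heat_c0_semigroup[OF heat] _ _ heat_generator_dense[OF c heat] _ f g t])
    show "?p \<in> borel_measurable ?M"
      by (rule borel_measurable_indicator[OF edge_set_in_sets]) auto
    show "cmod (?p z) \<le> 1" for z by (simp add: indicator_def)
    show "l2_inner ?M (\<lambda>z. ?p z * h z) g = l2_inner ?M (\<lambda>z. ?p z * f z) k"
      if "generator ?M T f h" "generator ?M T g k" for f h g k
      using laplacian_intertwines_indicator[OF c B] that by (simp only: heat_generator_iff[OF heat])
  qed
  then show "l2_inner ?M (\<lambda>z. indicator (space ?M - A \<times> {0..1}) z * T t f z) g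
      = l2_inner ?M (\<lambda>z. indicator (space ?M - A \<times> {0..1}) z * f z) (T t g)"
    unfolding eq .
qed

text \<open>
  The multiplier \<open>1\<close> belongs to the set of all edges, which is trivially closed, so the intertwining
  relation specialises to self-adjointness.
\<close>

lemma heat_self_adjoint:
  assumes c: "countable (arcs G)" and heat: "heat_semigroup G T"
    and t: "0 \<le> t" and f: "f \<in> l2 (edge_measure G)" and g: "g \<in> l2 (edge_measure G)"
  shows "l2_inner (edge_measure G) (T t f) g = l2_inner (edge_measure G) f (T t g)"
proof -
  let ?M = "edge_measure G"
  have all: "finitely_closed G (arcs G)" by (simp add: finitely_closed_def)
  have "l2_inner ?M h g = l2_inner ?M f k" if fh: "generator ?M T f h" and gk: "generator ?M T g k" for f h g k
  proof -
    have "l2_inner ?M (\<lambda>z. indicator (arcs G \<times> {0..1}) z * u z) v = l2_inner ?M u v" for u v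
      unfolding l2_inner_def by (rule Bochner_Integration.integral_cong) (auto simp: space_edge_measure)
    then show ?thesis
      using laplacian_intertwines_indicator[OF c all] that by (simp only: heat_generator_iff[OF heat])
  qed
  then have "l2_inner ?M (\<lambda>z. 1 * T t f z) g = l2_inner ?M (\<lambda>z. 1 * f z) (T t g)"
    by (intro semigroup_intertwines[OF heat_c0_semigroup[OF heat] _ _ heat_generator_dense[OF c heat] _ f g t]) simp_all
  then show ?thesis by simp
qed

lemma emeasure_edge_set_pos:
  assumes c: "countable (arcs G)" and A: "A \<subseteq> arcs G" "A \<noteq> {}"
  shows "emeasure (edge_measure G) (A \<times> {0..1}) \<noteq> 0"
proof
  assume "emeasure (edge_measure G) (A \<times> {0..1}) = 0"
  then have "A \<times> {0..1} \<in> null_sets (edge_measure G)" using edge_set_in_sets[OF A(1)] by (simp add: null_sets_def)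
  then have "AE z in edge_measure G. z \<notin> A \<times> {0..1}" by (rule AE_not_in)
  moreover obtain e where e: "e \<in> A" using A(2) by blast
  ultimately have "AE x in unit_interval. (e, x) \<notin> A \<times> {0..1}" using AE_edge_measure[OF c] A(1) by blast
  then have "AE x in unit_interval. False" using AE_space by eventually_elim (use e in auto)
  then have "emeasure unit_interval (space unit_interval) = 0"
    using emeasure_eq_0_AE[of "\<lambda>x. True" unit_interval] by (simp only: simp_thms Collect_mem_eq)
  then show False by (simp add: emeasure_restrict_space)
qed

text \<open>
  Were the finite span of \<open>e\<close> a proper subset of the edges, it would be invariant; neither it nor its
  complement is a null set.
\<close>

lemma irreducible_imp_finite_span:
  assumes wf: "wf_digraph G" and c: "countable (arcs G)" and heat: "heat_semigroup G T"
    and irr: "irreducible_semigroup (edge_measure G) T" and e: "e \<in> arcs G"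
  shows "arcs (finite_span G e) = arcs G"
proof (rule ccontr)
  define A where "A = arcs (finite_span G e)"
  assume "arcs (finite_span G e) \<noteq> arcs G"
  then have A: "A \<subseteq> arcs G" "A \<noteq> {}" "arcs G - A \<noteq> {}"
    using finite_span_subset[of G e] finite_span_refl[OF e] by (auto simp: A_def)
  have "\<forall>t\<ge>0. T t ` l2_ideal (edge_measure G) (A \<times> {0..1}) \<subseteq> l2_ideal (edge_measure G) (A \<times> {0..1})"
    using heat_invariant_ideal[OF c heat A(1)] complement_finite_span_finitely_closed[OF wf, of e]
    by (simp add: A_def)
  then have "emeasure (edge_measure G) (A \<times> {0..1}) = 0 \<or>
      emeasure (edge_measure G) (space (edge_measure G) - A \<times> {0..1}) = 0"
    using irr edge_set_in_sets[OF A(1)] unfolding irreducible_semigroup_def by blast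
  moreover have "space (edge_measure G) - A \<times> {0..1} = (arcs G - A) \<times> {0..1}" by (auto simp: space_edge_measure)
  ultimately show False
    using emeasure_edge_set_pos[OF c A(1,2)] emeasure_edge_set_pos[OF c _ A(3)] by auto
qed

lemma AE_unit_interval_open:
  assumes "AE x in unit_interval. P x" "open S" "S \<subseteq> {0..1}" "S \<noteq> {}"
  shows "\<exists>x\<in>S. P x"
proof (rule ccontr)
  assume "\<not> (\<exists>x\<in>S. P x)"
  then have "AE x in lebesgue. x \<notin> S"
    using assms(1,3) unfolding AE_unit_interval_iff by (auto elim!: eventually_mono)
  moreover have "S \<in> sets lebesgue" using assms(2) by simp
  ultimately have "negligible S" by (simp add: AE_iff_null_sets negligible_iff_null_sets)
  then show False using open_not_negligible[OF assms(2,4)] by simp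
qed

lemma AE_eq_continuous_imp_eq:
  fixes w w' :: "real \<Rightarrow> complex"
  assumes w: "continuous_on {0..1} w" and w': "continuous_on {0..1} w'"
    and eq: "AE x in unit_interval. w x = w' x" and x: "x \<in> {0..1}"
  shows "w x = w' x"
proof (rule ccontr)
  assume "w x \<noteq> w' x"
  then have pos: "0 < cmod (w x - w' x)" by simp
  have "continuous_on {0..1} (\<lambda>x. w x - w' x)" by (intro continuous_intros w w')
  then obtain d where d: "0 < d" "\<And>y. y \<in> {0..1} \<Longrightarrow> dist y x < d \<Longrightarrow> dist (w y - w' y) (w x - w' x) < cmod (w x - w' x)"
    using x pos unfolding continuous_on_iff by blast
  have ne: "w y \<noteq> w' y" if "y \<in> {0..1}" "dist y x < d" for y
    using d(2)[OF that] by (auto simp: dist_norm norm_minus_commute)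
  let ?S = "ball x d \<inter> {0<..<1}"
  have "?S \<noteq> {}"
  proof (cases "x < 1")
    case True
    define m where "m = min d (1 - x) / 2"
    have "0 < m" "2 * m \<le> d" "2 * m \<le> 1 - x" using True d(1) by (auto simp: m_def)
    then have "x + m \<in> ?S" using x by (simp add: dist_real_def)
    then show ?thesis by blast
  next
    case False
    define m where "m = min d 1 / 2"
    have "0 < m" "2 * m \<le> d" "2 * m \<le> 1" using d(1) by (auto simp: m_def)
    moreover have "x = 1" using False x by simp
    ultimately have "x - m \<in> ?S" by (simp add: dist_real_def)
    then show ?thesis by blast
  qed
  then have "\<exists>y\<in>?S. w y = w' y" by (intro AE_unit_interval_open[OF eq]) auto
  then obtain y where "y \<in> ?S" "w y = w' y" by blast
  then show False using ne[of y] by (auto simp: dist_commute)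
qed

lemma continuous_indicator_constant:
  fixes w :: "real \<Rightarrow> complex"
  assumes w: "continuous_on {0..1} w" and pq: "0 \<le> p" "q \<le> 1"
    and ind: "AE x in unit_interval. x \<in> {p<..<q} \<longrightarrow> w x = 0 \<or> w x = 1"
  shows "(\<forall>x\<in>{p<..<q}. w x = 0) \<or> (\<forall>x\<in>{p<..<q}. w x = 1)"
proof -
  have cw: "continuous_on {p<..<q} w" by (rule continuous_on_subset[OF w]) (use pq in auto)
  have range: "w ` {p<..<q} \<subseteq> {0, 1}"
  proof (rule ccontr)
    assume contra: "\<not> w ` {p<..<q} \<subseteq> {0, 1}"
    let ?S = "{p<..<q} \<inter> w -` (- {0, 1})"
    have "open ?S" by (rule continuous_open_preimage[OF cw]) auto
    moreover have "?S \<noteq> {}" "?S \<subseteq> {0..1}" using contra pq by auto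
    ultimately obtain x where "x \<in> ?S" "x \<in> {p<..<q} \<longrightarrow> w x = 0 \<or> w x = 1"
      using AE_unit_interval_open[OF ind, of ?S] by blast
    then show False by auto
  qed
  have "connected (w ` {p<..<q})" by (rule connected_continuous_image[OF cw]) simp
  moreover have "finite (w ` {p<..<q})" by (rule finite_subset[OF range]) simp
  ultimately have "w ` {p<..<q} = {} \<or> (\<exists>a. w ` {p<..<q} = {a})"
    using connected_finite_iff_sing by blast
  then show ?thesis
  proof
    assume "\<exists>a. w ` {p<..<q} = {a}"
    then obtain a where a: "w ` {p<..<q} = {a}" ..
    then have "w x = a" if "x \<in> {p<..<q}" for x using that by blast
    moreover have "a = 0 \<or> a = 1" using range unfolding a by simp
    ultimately show ?thesis by blast
  qed simp
qed

text \<open>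
  If \<open>L\<^sup>2(\<omega>)\<close> is invariant, multiplication by the indicator of \<open>\<omega>\<close> maps the
  domain of the Laplacian into itself, and hence produces functions with continuous
  representatives. Applied to plateaus this shows that \<open>\<omega>\<close> contains almost all or almost nothing
  of every edge; applied to a function equal to \<open>1\<close> near a node of finite degree it shows that
  the same alternative occurs on all edges at this node.
\<close>

context
  fixes G :: "('v, 'e) pre_digraph" and T and \<omega> :: "('e \<times> real) set"
  assumes c: "countable (arcs G)" and heat: "heat_semigroup G T"
    and \<omega>: "\<omega> \<in> sets (edge_measure G)"
    and inv: "\<forall>t\<ge>0. T t ` l2_ideal (edge_measure G) \<omega> \<subseteq> l2_ideal (edge_measure G) \<omega>"
begin

lemma invariant_indicator_form_domain:
  assumes "graph_laplacian G f h"
  shows "(\<lambda>z. indicator \<omega> z * f z) \<in> form_domain G"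
proof -
  have "generator (edge_measure G) T f h" using assms by (simp only: heat_generator_iff[OF heat])
  from generator_indicator_if_invariant[OF heat_c0_semigroup[OF heat] \<omega> heat_self_adjoint[OF c heat] inv[rule_format] this]
  have "graph_laplacian G (\<lambda>z. indicator \<omega> z * f z) (\<lambda>z. indicator \<omega> z * h z)"
    by (simp only: heat_generator_iff[OF heat])
  then show ?thesis by (simp add: graph_laplacian_def)
qed

lemma invariant_set_full_or_null_on_edge:
  assumes e: "e \<in> arcs G"
  shows "(AE x in unit_interval. (e, x) \<in> \<omega>) \<or> (AE x in unit_interval. (e, x) \<notin> \<omega>)"
proof -
  have inner: "\<exists>b. AE x in unit_interval. x \<in> {2 * \<delta><..<1 - 2 * \<delta>} \<longrightarrow> ((e, x) \<in> \<omega>) = b" if \<delta>: "0 < \<delta>" for \<delta>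
  proof -
    let ?f = "single_edge e (\<lambda>x. complex_of_real (plateau 0 1 \<delta> x))"
    obtain h where "graph_laplacian G ?f h"
      using plateau_in_laplacian_domain[OF c order_refl order_refl \<delta>] by blast
    then have "(\<lambda>z. indicator \<omega> z * ?f z) \<in> form_domain G" by (rule invariant_indicator_form_domain)
    then obtain w where w: "continuous_on {0..1} w" "AE x in unit_interval. indicator \<omega> (e, x) * ?f (e, x) = w x"
      using e unfolding form_domain_def has_boundary_values_def by blast
    have eq: "AE x in unit_interval. x \<in> {2 * \<delta><..<1 - 2 * \<delta>} \<longrightarrow> w x = indicator \<omega> (e, x)"
      using w(2) by eventually_elim (use plateau_eq_1[OF \<delta>] in \<open>auto simp: single_edge_def\<close>)
    then have "AE x in unit_interval. x \<in> {2 * \<delta><..<1 - 2 * \<delta>} \<longrightarrow> w x = 0 \<or> w x = 1"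
      by eventually_elim (auto simp: indicator_def)
    then have "(\<forall>x\<in>{2 * \<delta><..<1 - 2 * \<delta>}. w x = 0) \<or> (\<forall>x\<in>{2 * \<delta><..<1 - 2 * \<delta>}. w x = 1)"
      using \<delta> by (intro continuous_indicator_constant[OF w(1)]) auto
    then obtain b where b: "\<And>x. x \<in> {2 * \<delta><..<1 - 2 * \<delta>} \<Longrightarrow> w x = of_bool b"
    proof
      assume "\<forall>x\<in>{2 * \<delta><..<1 - 2 * \<delta>}. w x = 0"
      then show ?thesis by (intro that[of False]) simp
    next
      assume "\<forall>x\<in>{2 * \<delta><..<1 - 2 * \<delta>}. w x = 1"
      then show ?thesis by (intro that[of True]) simp
    qed
    have "AE x in unit_interval. x \<in> {2 * \<delta><..<1 - 2 * \<delta>} \<longrightarrow> ((e, x) \<in> \<omega>) = b"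
      using eq by eventually_elim (use b in \<open>auto simp: indicator_def split: if_splits\<close>)
    then show ?thesis by blast
  qed
  define \<delta> where "\<delta> n = 1 / (8 * real (Suc n))" for n
  have \<delta>: "0 < \<delta> n" "\<delta> n \<le> 1/8" for n by (simp_all add: \<delta>_def field_simps)
  obtain b where b: "\<And>n. AE x in unit_interval. x \<in> {2 * \<delta> n<..<1 - 2 * \<delta> n} \<longrightarrow> ((e, x) \<in> \<omega>) = b n"
    using inner[OF \<delta>(1)] by metis
  \<comment> \<open>All these intervals contain \<open>(1/4, 3/4)\<close>, so the alternative does not depend on \<open>n\<close>.\<close>
  have same: "b n = b 0" for n
  proof -
    have "AE x in unit_interval. x \<in> {1/4<..<3/4} \<longrightarrow> b n = b 0"
      using b[of n] b[of 0] by eventually_elim (use \<delta>(2)[of n] \<delta>(2)[of 0] in auto)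
    then have "\<exists>x\<in>{1/4<..<3/4::real}. x \<in> {1/4<..<3/4} \<longrightarrow> b n = b 0"
      by (rule AE_unit_interval_open) auto
    then show ?thesis by blast
  qed
  have "AE x in unit_interval. \<forall>n. x \<in> {2 * \<delta> n<..<1 - 2 * \<delta> n} \<longrightarrow> ((e, x) \<in> \<omega>) = b 0"
    unfolding AE_all_countable
  proof
    show "AE x in unit_interval. x \<in> {2 * \<delta> n<..<1 - 2 * \<delta> n} \<longrightarrow> ((e, x) \<in> \<omega>) = b 0" for n
      using b[of n] unfolding same[of n] .
  qed
  moreover have "AE x in unit_interval. x \<noteq> 0 \<and> x \<noteq> 1"
  proof -
    have "AE x in lborel. x \<noteq> (0::real) \<and> x \<noteq> 1" by (intro AE_conjI AE_lborel_singleton)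
    then have "AE x in lebesgue. x \<noteq> (0::real) \<and> x \<noteq> 1" by (rule AE_completion)
    then show ?thesis unfolding AE_unit_interval_iff by eventually_elim simp
  qed
  ultimately have "AE x in unit_interval. ((e, x) \<in> \<omega>) = b 0"
    using AE_space
  proof eventually_elim
    case (elim x)
    then have "0 < min x (1 - x)" by auto
    then obtain n where n: "inverse (real (Suc n)) < min x (1 - x)" using reals_Archimedean by blast
    have "8 * \<delta> n = inverse (real (Suc n))" by (simp add: \<delta>_def field_simps)
    then have "2 * \<delta> n < inverse (real (Suc n))" using \<delta>(1)[of n] by linarith
    with n have "x \<in> {2 * \<delta> n<..<1 - 2 * \<delta> n}" by auto
    then show ?case using elim(1) by blast
  qed
  then show ?thesis by (cases "b 0") simp_all
qed

lemma invariant_set_full_across_finite_node: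
  assumes e: "e \<in> arcs G" and e': "e' \<in> arcs G" and inc: "incident G e v" "incident G e' v"
    and v: "edegree G v < \<infinity>" and full: "AE x in unit_interval. (e, x) \<in> \<omega>"
  shows "AE x in unit_interval. (e', x) \<in> \<omega>"
proof (rule ccontr)
  assume "\<not> ?thesis"
  then have null: "AE x in unit_interval. (e', x) \<notin> \<omega>"
    using invariant_set_full_or_null_on_edge[OF e'] by blast
  let ?f = "\<lambda>(e, x). complex_of_real (star_function G v e x)"
  obtain h where "graph_laplacian G ?f h" using star_function_in_laplacian_domain[OF c v] by blast
  then have "(\<lambda>z. indicator \<omega> z * ?f z) \<in> form_domain G" by (rule invariant_indicator_form_domain)
  then obtain d where d: "\<And>e. e \<in> arcs G \<Longrightarrow>
      has_boundary_values (\<lambda>x. indicator \<omega> (e, x) * ?f (e, x)) (d (tail G e)) (d (head G e))"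
    unfolding form_domain_def by blast
  have "d v = 1"
  proof -
    obtain w where w: "continuous_on {0..1} w" "AE x in unit_interval. indicator \<omega> (e, x) * ?f (e, x) = w x"
      "w 0 = d (tail G e)" "w 1 = d (head G e)"
      using d[OF e] unfolding has_boundary_values_def by blast
    have "AE x in unit_interval. w x = complex_of_real (star_function G v e x)"
      using w(2) full by eventually_elim simp
    moreover have "continuous_on {0..1} (\<lambda>x. complex_of_real (star_function G v e x))"
      by (intro continuous_on_of_real continuous_on_subset[OF C2_deriv(5)[OF C2_star_function] subset_UNIV])
    ultimately have "w x = complex_of_real (star_function G v e x)" if "x \<in> {0..1}" for x
      using AE_eq_continuous_imp_eq[OF w(1)] that by blast
    from this[of 0] this[of 1] show ?thesis
      using inc(1) w(3,4) by (auto simp: incident_def star_function_ends)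
  qed
  moreover have "d v = 0"
  proof -
    obtain w where w: "continuous_on {0..1} w" "AE x in unit_interval. indicator \<omega> (e', x) * ?f (e', x) = w x"
      "w 0 = d (tail G e')" "w 1 = d (head G e')"
      using d[OF e'] unfolding has_boundary_values_def by blast
    have "AE x in unit_interval. w x = 0"
      using w(2) null by eventually_elim simp
    then have "w x = 0" if "x \<in> {0..1}" for x
      using AE_eq_continuous_imp_eq[OF w(1) continuous_on_const] that by blast
    from this[of 0] this[of 1] show ?thesis
      using inc(2) w(3,4) by (auto simp: incident_def)
  qed
  ultimately show False by simp
qed

lemma invariant_set_trivial_if_finite_span:
  assumes e0: "e0 \<in> arcs G" and span: "arcs (finite_span G e0) = arcs G"
  shows "emeasure (edge_measure G) \<omega> = 0 \<or> emeasure (edge_measure G) (space (edge_measure G) - \<omega>) = 0"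
proof -
  interpret pair_sigma_finite "count_space (arcs G)" unit_interval by (rule pair_sigma_finite_edges[OF c])
  define full where "full e \<longleftrightarrow> (AE x in unit_interval. (e, x) \<in> \<omega>)" for e
  have null: "emeasure (edge_measure G) N = 0"
    if N: "N \<in> sets (edge_measure G)" "\<And>e. e \<in> arcs G \<Longrightarrow> AE x in unit_interval. (e, x) \<notin> N" for N
  proof -
    have "AE z in edge_measure G. z \<notin> N"
      unfolding edge_measure_def
      by (rule AE_pair_measure) (use N in \<open>auto simp: edge_measure_def AE_count_space\<close>)
    then have "N \<in> null_sets (edge_measure G)" using N(1) by (simp add: AE_iff_null_sets)
    then show ?thesis by (simp add: null_sets_def)
  qed
  have all: "full e = full e0" if "e \<in> arcs G" for e
  proof -
    have "e \<in> arcs (finite_span G e0)" using that span by simp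
    then obtain es vs where p: "edge_path G e0 es vs e" "finite_weight G vs" by (auto simp: arcs_finite_span)
    show ?thesis
    proof (rule edge_path_invariant[OF p])
      show "full a = full b" if "a \<in> arcs G" "b \<in> arcs G" "incident G a v" "incident G b v" "edegree G v < \<infinity>" for a b v
        unfolding full_def using invariant_set_full_across_finite_node that by blast
    qed
  qed
  show ?thesis
  proof (cases "full e0")
    case True
    have "emeasure (edge_measure G) (space (edge_measure G) - \<omega>) = 0"
    proof (rule null)
      show "space (edge_measure G) - \<omega> \<in> sets (edge_measure G)" using \<omega> by auto
      fix e assume "e \<in> arcs G"
      then have "full e" using all True by simp
      then show "AE x in unit_interval. (e, x) \<notin> space (edge_measure G) - \<omega>"
        unfolding full_def by eventually_elim simp
    qed
    then show ?thesis ..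
  next
    case False
    have "emeasure (edge_measure G) \<omega> = 0"
    proof (rule null[OF \<omega>])
      fix e assume e: "e \<in> arcs G"
      then have "\<not> full e" using all False by simp
      then show "AE x in unit_interval. (e, x) \<notin> \<omega>"
        using invariant_set_full_or_null_on_edge[OF e] unfolding full_def by blast
    qed
    then show ?thesis ..
  qed
qed

end

theorem theorem11:
  fixes G :: "('v, 'e) pre_digraph"
    and T :: "real \<Rightarrow> ('e \<times> real \<Rightarrow> complex) \<Rightarrow> ('e \<times> real \<Rightarrow> complex)"
  assumes "wf_digraph G"
    and "countable (verts G)"
    and "countable (arcs G)"
    and "arcs G \<noteq> {}"
    and "heat_semigroup G T"
  shows "(irreducible_semigroup (edge_measure G) T \<longleftrightarrow>
            (\<exists>e\<in>arcs G. arcs (finite_span G e) = arcs G)) \<and>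
         ((\<exists>e\<in>arcs G. arcs (finite_span G e) = arcs G) \<longleftrightarrow>
            (\<forall>e\<in>arcs G. arcs (finite_span G e) = arcs G))"
proof -
  have ac: "irreducible_semigroup (edge_measure G) T \<Longrightarrow> \<forall>e\<in>arcs G. arcs (finite_span G e) = arcs G"
    by (intro ballI irreducible_imp_finite_span[OF assms(1,3,5)])
  have ba: "irreducible_semigroup (edge_measure G) T" if ex: "\<exists>e\<in>arcs G. arcs (finite_span G e) = arcs G"
    unfolding irreducible_semigroup_def
  proof (intro ballI impI)
    fix \<omega>
    assume \<omega>: "\<omega> \<in> sets (edge_measure G)"
      and inv: "\<forall>t\<ge>0. T t ` l2_ideal (edge_measure G) \<omega> \<subseteq> l2_ideal (edge_measure G) \<omega>"
    obtain e where e: "e \<in> arcs G" "arcs (finite_span G e) = arcs G" using ex by blast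
    from invariant_set_trivial_if_finite_span[OF assms(3,5) \<omega> inv e]
    show "emeasure (edge_measure G) \<omega> = 0 \<or> emeasure (edge_measure G) (space (edge_measure G) - \<omega>) = 0" .
  qed
  show ?thesis using ac ba assms(4) by blast
qed

end
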